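(* Let $H$ be an RO-group and $\lambda$ a cardinal with $|H|\leq\lambda$. Then there is an $\aleph_1$-free, ordered abelian group $(G,+,<)$ of cardinality $\lambda^{\aleph_0}$ with $\operatorname{Aut}(G,+,<)\cong H$.
   Context: A group $(H,\cdot)$ is an RO-group (right orderable group) if there is a linear order $<$ on $H$ such that for all $h,g,k\in H$, $h<g$ implies $hk<gk$. An ordered abelian group $(G,+,<)$ is an abelian group $(G,+)$ with a linear order $<$ such that $x<y$ implies $x+z<y+z$ for all $x,y,z\in G$. $\operatorname{Aut}(G,+,<)$ is the group of all order-preserving group automorphisms of $G$. An abelian group is $\aleph_1$-free if all its countable subgroups are free abelian. *)

theory Defs
  imports "HOL-Algebra.Free_Abelian_Groups" "HOL-Algebra.Bij" "HOL-Library.Countable_Set"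
begin

unbundle cardinal_syntax

text \<open>
  Orders are strict and given as relations; the inclusion in the square of the carrier
  is spelled out because \<^const>\<open>strict_linear_order_on\<close> does not require it.
\<close>

definition right_ordered_group :: "('a, 'm) monoid_scheme \<Rightarrow> 'a rel \<Rightarrow> bool" where
  "right_ordered_group H r \<longleftrightarrow>
     group H \<and> r \<subseteq> carrier H \<times> carrier H \<and> strict_linear_order_on (carrier H) r \<and>
     (\<forall>h\<in>carrier H. \<forall>g\<in>carrier H. \<forall>k\<in>carrier H.
        (h, g) \<in> r \<longrightarrow> (h \<otimes>\<^bsub>H\<^esub> k, g \<otimes>\<^bsub>H\<^esub> k) \<in> r)"

definition right_orderable_group :: "('a, 'm) monoid_scheme \<Rightarrow> bool" where
  "right_orderable_group H \<longleftrightarrow> (\<exists>r. right_ordered_group H r)"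

text \<open>Abelian groups are written multiplicatively, following \<^locale>\<open>comm_group\<close>.\<close>

definition ordered_abelian_group :: "('a, 'm) monoid_scheme \<Rightarrow> 'a rel \<Rightarrow> bool" where
  "ordered_abelian_group G r \<longleftrightarrow>
     comm_group G \<and> r \<subseteq> carrier G \<times> carrier G \<and> strict_linear_order_on (carrier G) r \<and>
     (\<forall>x\<in>carrier G. \<forall>y\<in>carrier G. \<forall>z\<in>carrier G.
        (x, y) \<in> r \<longrightarrow> (x \<otimes>\<^bsub>G\<^esub> z, y \<otimes>\<^bsub>G\<^esub> z) \<in> r)"

text \<open>
  As \<^term>\<open>r\<close> is a strict linear order, the inverse of an order-preserving
  bijection is again order-preserving, so one implication suffices.
\<close>

definition ordered_AutoGroup :: "('a, 'm) monoid_scheme \<Rightarrow> 'a rel \<Rightarrow> ('a \<Rightarrow> 'a) monoid" where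
  "ordered_AutoGroup G r =
     AutoGroup G \<lparr>carrier := {f \<in> auto G. \<forall>x\<in>carrier G. \<forall>y\<in>carrier G.
        (x, y) \<in> r \<longrightarrow> (f x, f y) \<in> r}\<rparr>"

text \<open>
  The index set can be taken of the type of the group elements, since a basis of
  \<^term>\<open>A\<close> is a subset of \<^term>\<open>carrier A\<close>.
\<close>

definition free_abelian :: "('a, 'm) monoid_scheme \<Rightarrow> bool" where
  "free_abelian A \<longleftrightarrow> (\<exists>S :: 'a set. A \<cong> free_Abelian_group S)"

definition aleph1_free :: "('a, 'm) monoid_scheme \<Rightarrow> bool" where
  "aleph1_free G \<longleftrightarrow> comm_group G \<and>
     (\<forall>A. subgroup A G \<and> countable A \<longrightarrow> free_abelian (G\<lparr>carrier := A\<rparr>))"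

text \<open>
  For a cardinal \<^term>\<open>lam :: 'l rel\<close>, the type \<^typ>\<open>nat \<Rightarrow> 'l\<close> contains a set of
  cardinality \<^term>\<open>lam ^c natLeq\<close>; hence every group of that cardinality is isomorphic
  to one with carrier in this type.
\<close>

end

theory Submission
  imports Defs
begin

text \<open>
  Fix an alphabet \<open>A\<close> with \<open>|A|\<^sup>\<omega> = |A|\<close>. The group is generated by the free \<open>\<int>[H]\<close>-module on the
  nodes of the tree of finite sequences over \<open>A\<close> together with, for every branch \<open>\<eta>\<close>, the elements
  \<open>y\<^sub>k = (y - (\<Sum>n<k. n! d\<^sub>n)) / k!\<close>, where \<open>d\<^sub>n = e\<^sub>n + \<epsilon>\<^sub>n u\<close>. Here \<open>e\<^sub>n\<close> is the \<open>n\<close>-th node of \<open>\<eta>\<close>,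
  \<open>u\<close> is an element coded by \<open>\<eta>\<close>, and the 0-1-sequence \<open>\<epsilon>\<close> is one of countably many options.
  Since the letters of \<open>A\<close> code vectors, every map \<open>\<phi>\<close> is predicted by some branch: the \<open>n\<close>-th letter
  codes \<open>\<phi> e\<^sub>n\<close>, \<open>u\<close> and \<open>\<phi> u\<close>. If \<open>\<phi>\<close> were an endomorphism under two different options for \<open>\<eta>\<close>, the
  difference of the two images of \<open>y\<close> would satisfy a recurrence \<open>x\<^sub>k = v\<^sub>k + (k+1) x\<^sub>k\<^sub>+\<^sub>1\<close> with bounded
  integers \<open>v\<^sub>k\<close>, which forces \<open>v\<^sub>k = 0\<close> for large \<open>k\<close> and thus \<open>\<phi> u \<in> u \<rat>[H]\<close>. A good choice of
  options therefore makes every endomorphism act on the nodes as a fixed element of the group ring.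
  For an automorphism this element is a unit, hence \<open>\<plusminus>h\<close> because \<open>H\<close> is right orderable, and order
  preservation decides the sign. Vectors of the group supported in a given finite set have bounded
  denominators, which yields freeness of countable subgroups. The order is lexicographic.
\<close>

section \<open>A recurrence and a colouring\<close>

text \<open>Whether a predicted map is an endomorphism depends on the options of all branches at
  once, so the options cannot be settled one branch after the other. Therefore the symbols of all
  options live in one ambient group \<open>tree_group\<close>, where images of \<open>y\<close>
  under different choices can be subtracted. There a single symbol coordinate has no bounded
  denominator, since in the difference of two symbols of one branch the nodes cancel; only the sum
  over the options of a branch is bounded. This sum shows that two choices that differ at \<eta>
  produce images with the same branches and the same coefficients, so the branches involved in one
  prediction are finitely many, even over all choices together. What remains is the disturbance by
  other branches that use the option of \<eta>. A colouring of the branches by natural numbers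
  removes it, and this is why countably many options are provided although each branch picks between
  two. Endomorphisms are merely additive. As \<open>u\<close> may be any integral vector on the
  nodes, their linearity is a result and not an assumption.\<close>

lemma factorial_recurrence_eventually_zero:
  fixes a v :: "nat \<Rightarrow> rat"
  assumes a: "\<And>k. a k \<in> \<int>"
    and rec: "\<And>k. a k = v k + of_nat (Suc k) * a (Suc k)"
    and bound: "\<And>k. \<bar>v k\<bar> \<le> C"
  obtains N where "\<And>k. k \<ge> N \<Longrightarrow> a k = 0 \<and> v k = 0"
proof -
  \<comment> \<open>The recurrence gives \<open>|a (k+1)| \<le> (|a k| + C) / (k+1)\<close>. The
    bound \<open>M\<close> persists: for \<open>k = 0\<close> by its choice, later because the
    divisor is at least 2 and \<open>M + C \<le> 2 * M\<close>. For large \<open>k\<close> the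
    quotient is below 1, and integers vanish.\<close>
  define M where "M = \<bar>a 0\<bar> + C"
  have C: "C \<ge> 0" using bound[of 0] by linarith
  have step: "of_nat (Suc k) * \<bar>a (Suc k)\<bar> \<le> \<bar>a k\<bar> + C" for k
  proof -
    have "of_nat (Suc k) * \<bar>a (Suc k)\<bar> = \<bar>a k - v k\<bar>"
      using rec[of k] by (simp add: abs_mult del: of_nat_Suc)
    then show ?thesis using bound[of k] by linarith
  qed
  have le: "\<bar>a k\<bar> \<le> M" for k
  proof (induction k)
    case (Suc k)
    show ?case
    proof (cases k)
      case 0
      then show ?thesis using step[of 0] by (simp add: M_def)
    next
      case (Suc l)
      have "M \<ge> C" by (simp add: M_def)
      have "2 * \<bar>a (Suc k)\<bar> \<le> of_nat (Suc k) * \<bar>a (Suc k)\<bar>"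
        using Suc by (intro mult_right_mono) auto
      then show ?thesis using step[of k] Suc.IH \<open>M \<ge> C\<close> by linarith
    qed
  qed (simp add: M_def C)
  obtain N :: nat where N: "of_nat N > M + C" using reals_Archimedean2 by blast
  have zero: "a (Suc k) = 0" if "k \<ge> N" for k
  proof (rule ccontr)
    assume "a (Suc k) \<noteq> 0"
    then have "1 \<le> \<bar>a (Suc k)\<bar>" using a Ints_nonzero_abs_ge1 by blast
    then have "of_nat (Suc k) * 1 \<le> of_nat (Suc k) * \<bar>a (Suc k)\<bar>"
      by (intro mult_left_mono) auto
    moreover have "(of_nat N :: rat) \<le> of_nat (Suc k)" using that by (simp only: of_nat_le_iff)
    ultimately have "of_nat N \<le> of_nat (Suc k) * \<bar>a (Suc k)\<bar>" by (metis mult.right_neutral order_trans)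
    also note step[of k]
    finally show False using le[of k] N by linarith
  qed
  show ?thesis
  proof (rule that[of "Suc N"])
    fix k assume "k \<ge> Suc N"
    then obtain l where l: "k = Suc l" "l \<ge> N" by (cases k) auto
    then show "a k = 0 \<and> v k = 0" using zero[of l] zero[of k] rec[of k] by simp
  qed
qed

text \<open>Greedy colouring along a well-order in which the countable closures under \<open>Z\<close> are blocks: then a point
  has only finitely many earlier neighbours in either direction.\<close>

lemma finite_outdegree_coloring:
  fixes Z :: "'a \<Rightarrow> 'a set"
  assumes fin: "\<And>x. finite (Z x)"
  obtains \<kappa> :: "'a \<Rightarrow> nat" where "\<And>x y. y \<in> Z x \<Longrightarrow> y \<noteq> x \<Longrightarrow> \<kappa> y \<noteq> \<kappa> x"
proof -
  define R where "R = {(x, y). y \<in> Z x}"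
  define cl where "cl x = R\<^sup>* `` {x}" for x
  have finR: "finite ((R ^^ n) `` {x})" for n x
  proof (induction n)
    case (Suc n)
    have "(R ^^ Suc n) `` {x} = (\<Union>y\<in>(R ^^ n) `` {x}. Z y)"
      by (auto simp: R_def)
    then show ?case using Suc fin by simp
  qed simp
  have cnt: "countable (cl x)" for x
  proof -
    have "cl x = (\<Union>n. (R ^^ n) `` {x})" by (auto simp: cl_def rtrancl_power)
    then show ?thesis using finR by (simp add: countable_finite)
  qed
  have cl_refl: "x \<in> cl x" for x by (simp add: cl_def)
  have cl_step: "z \<in> cl x" if "y \<in> cl x" "z \<in> Z y" for x y z
    using that by (auto simp: cl_def R_def intro: rtrancl_into_rtrancl)
  obtain r :: "'a rel" where r: "well_order_on UNIV r"
    using well_order_on by blast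
  define s where "s = r - Id"
  have wf_s: "wf s" using r by (simp add: s_def well_order_on_def)
  have tot: "(x, y) \<in> s \<or> x = y \<or> (y, x) \<in> s" for x y
    using r by (auto simp: s_def well_order_on_def linear_order_on_def total_on_def)
  \<comment> \<open>The block of \<open>y\<close> is named by the least point whose closure contains
    \<open>y\<close>; \<open>key\<close> sorts by these names and enumerates each countable
    block.\<close>
  have "\<exists>x. y \<in> cl x \<and> (\<forall>x'. (x', x) \<in> s \<longrightarrow> y \<notin> cl x')" for y
    using wf_s[unfolded wf_eq_minimal, rule_format, of y "{x. y \<in> cl x}"] cl_refl by blast
  then obtain rk where rk: "\<And>y. y \<in> cl (rk y)" "\<And>y x'. (x', rk y) \<in> s \<Longrightarrow> y \<notin> cl x'"
    by metis
  define key where "key y = (rk y, to_nat_on (cl (rk y)) y)" for y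
  define L where "L = inv_image (s <*lex*> less_than) key"
  have wf_L: "wf L" by (simp add: L_def wf_s wf_lex_prod)
  have inj_key: "x = y" if "key x = key y" for x y
    using that rk(1)[of x] rk(1)[of y] cnt unfolding key_def
    by (metis (no_types, lifting) Pair_inject inj_on_contraD inj_on_to_nat_on)
  have tot_L: "(x, y) \<in> L \<or> (y, x) \<in> L" if "x \<noteq> y" for x y
    using inj_key[of x y] that tot[of "rk x" "rk y"] by (fastforce simp: L_def key_def)
  define N where "N y = {z. (z, y) \<in> L \<and> (z \<in> Z y \<or> y \<in> Z z)}" for y
  have finN: "finite (N y)" for y
  proof -
    \<comment> \<open>An earlier \<open>z\<close> with \<open>y \<in> Z z\<close> lies in the block
      of \<open>y\<close>: from \<open>y \<in> cl (rk z)\<close> the name \<open>rk y\<close> cannot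
      come after \<open>rk z\<close>. Inside a block only finitely many points precede
      \<open>y\<close>.\<close>
    have "N y \<subseteq> Z y \<union> {z. rk z = rk y \<and> to_nat_on (cl (rk y)) z < to_nat_on (cl (rk y)) y}"
    proof
      fix z assume z: "z \<in> N y"
      show "z \<in> Z y \<union> {z. rk z = rk y \<and> to_nat_on (cl (rk y)) z < to_nat_on (cl (rk y)) y}"
      proof (cases "z \<in> Z y")
        case False
        with z have "y \<in> Z z" by (auto simp: N_def)
        then have "y \<in> cl (rk z)" using cl_step rk(1) by blast
        then have "(rk z, rk y) \<notin> s" using rk(2) by blast
        then show ?thesis using z by (auto simp: N_def L_def key_def)
      qed simp
    qed
    moreover have "finite {z. rk z = rk y \<and> to_nat_on (cl (rk y)) z < to_nat_on (cl (rk y)) y}"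
    proof (rule finite_imageD)
      show "finite (to_nat_on (cl (rk y)) ` {z. rk z = rk y \<and> to_nat_on (cl (rk y)) z < to_nat_on (cl (rk y)) y})"
        by (rule finite_subset[of _ "{..<to_nat_on (cl (rk y)) y}"]) auto
      show "inj_on (to_nat_on (cl (rk y))) {z. rk z = rk y \<and> to_nat_on (cl (rk y)) z < to_nat_on (cl (rk y)) y}"
        by (rule inj_on_subset[OF inj_on_to_nat_on[OF cnt[of "rk y"]]]) (metis (mono_tags, lifting) rk(1) mem_Collect_eq subsetI)
    qed
    ultimately show ?thesis using fin by (meson finite_UnI finite_subset)
  qed
  define \<kappa> :: "'a \<Rightarrow> nat" where "\<kappa> = wfrec L (\<lambda>f y. LEAST n. n \<notin> f ` N y)"
  have \<kappa>: "\<kappa> y = (LEAST n. n \<notin> \<kappa> ` N y)" for y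
  proof -
    have "\<kappa> y = (LEAST n. n \<notin> cut \<kappa> L y ` N y)"
      unfolding \<kappa>_def by (subst wfrec[OF wf_L]) simp
    moreover have "cut \<kappa> L y ` N y = \<kappa> ` N y"
      by (intro image_cong) (auto simp: N_def cut_def)
    ultimately show ?thesis by simp
  qed
  have new: "\<kappa> y \<notin> \<kappa> ` N y" for y
  proof -
    have "\<exists>n. n \<notin> \<kappa> ` N y" using ex_new_if_finite[OF infinite_UNIV_nat] finN[of y] by blast
    then show ?thesis unfolding \<kappa>[of y] by (rule LeastI_ex)
  qed
  show ?thesis
  proof (rule that)
    fix x y assume "y \<in> Z x" "y \<noteq> x"
    then have "y \<in> N x \<or> x \<in> N y" using tot_L[of x y] by (auto simp: N_def)
    then show "\<kappa> y \<noteq> \<kappa> x" using new[of x] new[of y] by (metis imageI)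
  qed
qed

section \<open>Groups twisted along the branches of a tree\<close>

text \<open>Vectors are indexed by pairs of such an index and an element of \<open>H\<close>. The symbol of a branch \<open>\<zeta>\<close> and an
  option \<open>i\<close> stands for the element \<open>y\<close> attached to \<open>\<zeta>\<close> under that option.\<close>

datatype 'b idx = Node "'b list" | Symbol "nat \<Rightarrow> 'b" nat

type_synonym ('b, 'h) vec = "'b idx \<times> 'h \<Rightarrow> rat"

definition branch :: "(nat \<Rightarrow> 'b) \<Rightarrow> nat \<Rightarrow> 'b list" where
  "branch \<zeta> n = map \<zeta> [0..<n]"

lemma length_branch [simp]: "length (branch \<zeta> n) = n"
  by (simp add: branch_def)

lemma branch_eq_iff: "branch \<zeta> n = branch \<zeta>' m \<longleftrightarrow> n = m \<and> (\<forall>k<n. \<zeta> k = \<zeta>' k)"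
  by (auto simp: branch_def list_eq_iff_nth_eq)

lemma branch_separated:
  assumes "\<zeta> \<noteq> \<zeta>'"
  shows "\<forall>\<^sub>F n in sequentially. branch \<zeta> n \<noteq> branch \<zeta>' n"
proof -
  obtain k where "\<zeta> k \<noteq> \<zeta>' k" using assms by blast
  then show ?thesis
    unfolding eventually_sequentially by (intro exI[of _ "Suc k"]) (auto simp: branch_eq_iff Suc_le_eq)
qed

lemma branch_leaves_finite:
  assumes "finite S"
  shows "\<forall>\<^sub>F n in sequentially. branch \<zeta> n \<notin> S"
proof -
  have "finite (branch \<zeta> -` S)"
    by (rule finite_vimageI[OF assms]) (auto simp: inj_on_def branch_eq_iff)
  then obtain m where "\<forall>n\<in>branch \<zeta> -` S. n < m" using finite_nat_set_iff_bounded by blast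
  then show ?thesis
    unfolding eventually_sequentially by (intro exI[of _ m]) (meson leD vimageI2)
qed

text \<open>Option \<open>i\<close> is the 0-1-sequence that is 1 exactly at the levels \<open>n\<close> with \<open>level_option n = i\<close>.\<close>

definition level_option :: "nat \<Rightarrow> nat" where
  "level_option k = fst (prod_decode k)"

text \<open>The recurrences give information about large \<open>k\<close> only, so every option must
  be testable at arbitrarily late levels.\<close>

lemma level_option_infinite: "\<exists>k\<ge>N. level_option k = i"
proof -
  have "prod_encode (i, N) \<ge> N" by (rule le_prod_encode_2)
  then show ?thesis by (intro exI[of _ "prod_encode (i, N)"]) (simp add: level_option_def)
qed

definition supp :: "('p \<Rightarrow> rat) \<Rightarrow> 'p set" where
  "supp x = {p. x p \<noteq> 0}"

lemma supp_lin: "supp (\<lambda>p. a * x p + b * y p) \<subseteq> supp x \<union> supp y"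
  by (auto simp: supp_def)

lemma Ints_of_fact_le:
  assumes "fact K * (r::rat) \<in> \<int>" "K \<le> n"
  shows "fact n * r \<in> \<int>"
proof -
  obtain m :: nat where m: "(fact n :: nat) = fact K * m" using fact_dvd[OF assms(2)] by blast
  have "(fact n :: rat) = of_nat m * fact K"
    by (metis m mult.commute of_nat_fact of_nat_mult)
  then have "fact n * r = of_nat m * (fact K * r)" by (simp only: mult.assoc)
  then show ?thesis using assms(1) by (metis Ints_mult Ints_of_nat)
qed

locale tree_vectors = group H for H :: "('h, 'm) monoid_scheme" (structure) +
  fixes A :: "'b set"
begin

definition idxs :: "('b idx \<times> 'h) set" where
  "idxs = (Node ` lists A \<union> {Symbol \<zeta> i | \<zeta> i. range \<zeta> \<subseteq> A}) \<times> carrier H"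

text \<open>Rational coefficients and symbols of all options: a vector space that contains every
  group compared later.\<close>

definition V :: "('b, 'h) vec set" where
  "V = {x. finite (supp x) \<and> supp x \<subseteq> idxs}"

text \<open>Right multiplication by \<open>h\<close>: the unit vector at \<open>(i, g)\<close> moves
  to \<open>(i, g \<otimes> h)\<close>, whence the inverse in the argument. Translations therefore
  compose in reverse order.\<close>

definition translate :: "'h \<Rightarrow> ('b, 'h) vec \<Rightarrow> ('b, 'h) vec" where
  "translate h x = (\<lambda>(i, g). if g \<in> carrier H then x (i, g \<otimes> inv h) else 0)"

lemma translate_int: "(\<And>p. x p \<in> \<int>) \<Longrightarrow> translate h x p \<in> \<int>"
  by (auto simp: translate_def split: prod.split)

lemma V_lin: "x \<in> V \<Longrightarrow> y \<in> V \<Longrightarrow> (\<lambda>p. a * x p + b * y p) \<in> V"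
  using supp_lin[of a x b y] unfolding V_def by (auto intro: finite_subset)

lemma translate_supp:
  assumes "h \<in> carrier H" "supp x \<subseteq> S \<times> carrier H"
  shows "supp (translate h x) = (\<lambda>(i, g). (i, g \<otimes> h)) ` supp x"
proof (intro equalityI subsetI)
  fix p assume p: "p \<in> supp (translate h x)"
  obtain i g where ig: "p = (i, g)" by force
  have g: "g \<in> carrier H" "(i, g \<otimes> inv h) \<in> supp x" using p by (auto simp: ig supp_def translate_def split: if_splits)
  have "p = (\<lambda>(i, g). (i, g \<otimes> h)) (i, g \<otimes> inv h)" using g assms by (simp add: ig m_assoc)
  then show "p \<in> (\<lambda>(i, g). (i, g \<otimes> h)) ` supp x" using g(2) by blast
next
  fix p assume "p \<in> (\<lambda>(i, g). (i, g \<otimes> h)) ` supp x"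
  then obtain i g where ig: "(i, g) \<in> supp x" "p = (i, g \<otimes> h)" by auto
  then have g: "g \<in> carrier H" using assms by auto
  then show "p \<in> supp (translate h x)" using ig assms by (simp add: supp_def translate_def m_assoc)
qed

lemma V_subset: "x \<in> V \<Longrightarrow> supp x \<subseteq> UNIV \<times> carrier H"
  by (auto simp: V_def idxs_def)

lemma translate_V:
  assumes "h \<in> carrier H" "x \<in> V"
  shows "translate h x \<in> V"
  using translate_supp[OF assms(1) V_subset[OF assms(2)]] assms by (auto simp: V_def idxs_def)

end

text \<open>The assignment \<open>u\<close> is arbitrary here; its decoding from letters enters only
  when the rigid group is built. Integrality and node support make every \<open>d\<close> an
  integral combination of nodes.\<close>

locale twisted_tree = tree_vectors H A for H :: "('h, 'm) monoid_scheme" (structure) and A :: "'b set" +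
  fixes u :: "(nat \<Rightarrow> 'b) \<Rightarrow> ('b, 'h) vec"
  assumes u_fin: "finite (supp (u \<zeta>))"
    and u_supp: "supp (u \<zeta>) \<subseteq> (Node ` lists A) \<times> carrier H"
    and u_int: "u \<zeta> p \<in> \<int>"
begin

definition d :: "nat \<Rightarrow> (nat \<Rightarrow> 'b) \<Rightarrow> nat \<Rightarrow> 'h \<Rightarrow> ('b, 'h) vec" where
  "d n \<zeta> i h p = (if p = (Node (branch \<zeta> n), h) then 1 else 0) + (if level_option n = i then translate h (u \<zeta>) p else 0)"

definition increment :: "nat \<Rightarrow> 'b idx \<times> 'h \<Rightarrow> ('b, 'h) vec" where
  "increment n q p = (case fst q of Node t \<Rightarrow> 0 | Symbol \<zeta> i \<Rightarrow> d n \<zeta> i (snd q) p)"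

text \<open>A symbol equals \<open>fact K\<close> times its \<open>y K\<close> plus the sum of
  \<open>fact n * d n\<close> over \<open>n < K\<close>; \<open>D K x\<close> collects these second
  summands over the symbols of \<open>x\<close>.\<close>

definition D :: "nat \<Rightarrow> ('b, 'h) vec \<Rightarrow> ('b, 'h) vec" where
  "D K x p = (\<Sum>q\<in>supp x. x q * (\<Sum>n<K. fact n * increment n q p))"

text \<open>The vectors \<open>y K \<zeta> i h\<close> defined below generate the group together with the integral combinations of
  nodes. Rewriting a vector in terms of those with index \<open>K\<close> gives the coefficients \<open>fact K * x (Symbol \<zeta> i, h)\<close>
  at the symbols and \<open>x (Node t, h) + D K x (Node t, h)\<close> at the nodes.\<close>

definition integral_at :: "nat \<Rightarrow> ('b, 'h) vec \<Rightarrow> bool" where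
  "integral_at K x \<longleftrightarrow> (\<forall>\<zeta> i h. fact K * x (Symbol \<zeta> i, h) \<in> \<int>) \<and> (\<forall>t h. x (Node t, h) + D K x (Node t, h) \<in> \<int>)"

text \<open>Admitting all options keeps the difference of elements of
  \<open>option_group \<iota>\<close> and \<open>option_group \<iota>'\<close> inside. The union
  over \<open>K\<close> is increasing.\<close>

definition tree_group :: "('b, 'h) vec set" where
  "tree_group = {x \<in> V. \<exists>K. integral_at K x}"

definition option_group :: "((nat \<Rightarrow> 'b) \<Rightarrow> nat) \<Rightarrow> ('b, 'h) vec set" where
  "option_group \<iota> = {x \<in> tree_group. \<forall>\<zeta> i h. x (Symbol \<zeta> i, h) \<noteq> 0 \<longrightarrow> i = \<iota> \<zeta>}"

lemma increment_simps [simp]: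
  "increment n (Node t, h) p = 0" "increment n (Symbol \<zeta> i, h) p = d n \<zeta> i h p"
  by (simp_all add: increment_def)

lemma d_int: "d n \<zeta> i h p \<in> \<int>"
  unfolding d_def by (intro Ints_add) (auto intro!: translate_int u_int)

lemma increment_int: "increment n q p \<in> \<int>"
  by (auto simp: increment_def d_int split: idx.split)

lemma D_superset:
  assumes "finite F" "supp x \<subseteq> F"
  shows "D K x p = (\<Sum>q\<in>F. x q * (\<Sum>n<K. fact n * increment n q p))"
  unfolding D_def by (rule sum.mono_neutral_left[OF assms]) (auto simp: supp_def)

lemma D_lin:
  assumes "finite (supp x)" "finite (supp y)"
  shows "D K (\<lambda>p. a * x p + b * y p) p = a * D K x p + b * D K y p"
proof -
  have "D K (\<lambda>p. a * x p + b * y p) p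
      = (\<Sum>q\<in>supp x \<union> supp y. (a * x q + b * y q) * (\<Sum>n<K. fact n * increment n q p))"
    using assms by (intro D_superset supp_lin) auto
  also have "\<dots> = a * (\<Sum>q\<in>supp x \<union> supp y. x q * (\<Sum>n<K. fact n * increment n q p))
      + b * (\<Sum>q\<in>supp x \<union> supp y. y q * (\<Sum>n<K. fact n * increment n q p))"
    by (simp add: algebra_simps sum.distrib sum_distrib_left)
  also have "\<dots> = a * D K x p + b * D K y p"
    using assms by (simp add: D_superset[of "supp x \<union> supp y"])
  finally show ?thesis .
qed

text \<open>Raising the level from \<open>n\<close> by one changes the node coordinates by sums of
  \<open>fact n * x q * increment n q p\<close>, and \<open>fact n * x q\<close> is already an
  integer at each symbol.\<close>

lemma integral_at_mono:
  assumes "integral_at K x" "K \<le> n"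
  shows "integral_at n x"
  using assms(2)
proof (induction n rule: dec_induct)
  case base
  show ?case by (rule assms(1))
next
  case (step n)
  have D: "D (Suc n) x p = D n x p + (\<Sum>q\<in>supp x. fact n * x q * increment n q p)" for p
    by (simp add: D_def algebra_simps sum.distrib)
  have "fact n * x q * increment n q p \<in> \<int>" for q p
  proof (cases q)
    case (Pair j h)
    show ?thesis
    proof (cases j)
      case (Symbol \<zeta> i)
      have "fact n * x (Symbol \<zeta> i, h) \<in> \<int>" using step.IH by (simp add: integral_at_def)
      then show ?thesis using Ints_mult d_int by (simp add: Pair Symbol)
    qed (simp add: Pair)
  qed
  then have sum: "(\<Sum>q\<in>supp x. fact n * x q * increment n q p) \<in> \<int>" for p by (rule Ints_sum)
  show ?case
    unfolding integral_at_def
  proof (intro conjI allI)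
    show "fact (Suc n) * x (Symbol \<zeta> i, h) \<in> \<int>" for \<zeta> i h
      by (rule Ints_of_fact_le[of n]) (use step.IH in \<open>simp_all add: integral_at_def\<close>)
    show "x (Node t, h) + D (Suc n) x (Node t, h) \<in> \<int>" for t h
    proof -
      have "x (Node t, h) + D n x (Node t, h) \<in> \<int>" using step.IH by (simp add: integral_at_def)
      from Ints_add[OF this sum] show ?thesis unfolding D by (simp only: add.assoc)
    qed
  qed
qed

lemma tree_group_lin:
  assumes "x \<in> tree_group" "y \<in> tree_group" "a \<in> \<int>" "b \<in> \<int>"
  shows "(\<lambda>p. a * x p + b * y p) \<in> tree_group"
proof -
  obtain K L where KL: "integral_at K x" "integral_at L y" using assms by (auto simp: tree_group_def)
  have x: "integral_at (max K L) x" and y: "integral_at (max K L) y"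
    using KL by (auto intro: integral_at_mono)
  have fin: "finite (supp x)" "finite (supp y)" using assms by (auto simp: tree_group_def V_def)
  have "integral_at (max K L) (\<lambda>p. a * x p + b * y p)"
    unfolding integral_at_def
  proof (intro conjI allI)
    show "fact (max K L) * (a * x (Symbol \<zeta> i, h) + b * y (Symbol \<zeta> i, h)) \<in> \<int>" for \<zeta> i h
    proof -
      have "a * (fact (max K L) * x (Symbol \<zeta> i, h)) + b * (fact (max K L) * y (Symbol \<zeta> i, h)) \<in> \<int>"
        using x y assms(3,4) unfolding integral_at_def by (meson Ints_add Ints_mult)
      then show ?thesis by (simp add: algebra_simps)
    qed
    show "a * x (Node t, h) + b * y (Node t, h) + D (max K L) (\<lambda>p. a * x p + b * y p) (Node t, h) \<in> \<int>" for t h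
    proof -
      have "a * (x (Node t, h) + D (max K L) x (Node t, h)) + b * (y (Node t, h) + D (max K L) y (Node t, h)) \<in> \<int>"
        using x y assms(3,4) unfolding integral_at_def by (meson Ints_add Ints_mult)
      then show ?thesis by (simp add: D_lin[OF fin] algebra_simps)
    qed
  qed
  moreover have "(\<lambda>p. a * x p + b * y p) \<in> V" using assms by (simp add: tree_group_def V_lin)
  ultimately show ?thesis by (auto simp: tree_group_def)
qed

lemma option_group_lin:
  assumes "x \<in> option_group \<iota>" "y \<in> option_group \<iota>" "a \<in> \<int>" "b \<in> \<int>"
  shows "(\<lambda>p. a * x p + b * y p) \<in> option_group \<iota>"
proof -
  have "(\<lambda>p. a * x p + b * y p) \<in> tree_group" using assms by (intro tree_group_lin) (auto simp: option_group_def)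
  moreover have "i = \<iota> \<zeta>" if "a * x (Symbol \<zeta> i, h) + b * y (Symbol \<zeta> i, h) \<noteq> 0" for \<zeta> i h
  proof -
    have "x (Symbol \<zeta> i, h) \<noteq> 0 \<or> y (Symbol \<zeta> i, h) \<noteq> 0" using that by auto
    then show ?thesis using assms(1,2) unfolding option_group_def by blast
  qed
  ultimately show ?thesis by (auto simp: option_group_def)
qed

lemma integral_in_tree_group:
  assumes "x \<in> V" "\<And>p. x p \<in> \<int>"
  shows "x \<in> tree_group"
proof -
  have "integral_at 0 x" using assms by (auto simp: integral_at_def D_def)
  then show ?thesis using assms by (auto simp: tree_group_def)
qed

lemma tree_group_no_symbol_int:
  assumes x: "x \<in> tree_group" and no: "\<And>\<zeta> i h. x (Symbol \<zeta> i, h) = 0"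
  shows "x p \<in> \<int>"
proof -
  obtain K where K: "integral_at K x" using x by (auto simp: tree_group_def)
  have "x q * (\<Sum>n<K. fact n * increment n q p) = 0" for p q
    by (cases q; cases "fst q") (auto simp: no)
  then have "D K x p = 0" for p unfolding D_def by (intro sum.neutral ballI)
  then show ?thesis using K no by (cases p; cases "fst p") (auto simp: integral_at_def)
qed

definition y :: "nat \<Rightarrow> (nat \<Rightarrow> 'b) \<Rightarrow> nat \<Rightarrow> 'h \<Rightarrow> ('b, 'h) vec" where
  "y k \<zeta> i h p = ((if p = (Symbol \<zeta> i, h) then 1 else 0) - (\<Sum>n<k. fact n * d n \<zeta> i h p)) / fact k"

lemma y_rec: "y k \<zeta> i h p = d k \<zeta> i h p + of_nat (Suc k) * y (Suc k) \<zeta> i h p"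
proof -
  have "of_nat (Suc k) * y (Suc k) \<zeta> i h p = ((if p = (Symbol \<zeta> i, h) then 1 else 0) - (\<Sum>n<Suc k. fact n * d n \<zeta> i h p)) / fact k"
    by (simp add: y_def del: sum.lessThan_Suc)
  then show ?thesis by (simp add: y_def diff_divide_distrib add_divide_distrib)
qed

lemma u_V: "u \<zeta> \<in> V"
  using u_fin u_supp[of \<zeta>] by (auto simp: V_def idxs_def)

lemma d_V:
  assumes "h \<in> carrier H" "range \<zeta> \<subseteq> A"
  shows "d n \<zeta> i h \<in> V"
proof -
  have "(\<lambda>p. if p = (Node (branch \<zeta> n), h) then 1 else 0) \<in> V"
  proof -
    have "supp (\<lambda>p. if p = (Node (branch \<zeta> n), h) then 1 else 0) = {(Node (branch \<zeta> n), h)}"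
      by (auto simp: supp_def)
    moreover have "branch \<zeta> n \<in> lists A" using assms by (auto simp: branch_def image_subset_iff)
    ultimately show ?thesis using assms by (auto simp: V_def idxs_def)
  qed
  from V_lin[OF this translate_V[OF assms(1) u_V[of \<zeta>]], of 1 "if level_option n = i then 1 else 0"]
  have "(\<lambda>p. 1 * (if p = (Node (branch \<zeta> n), h) then 1 else 0) + (if level_option n = i then 1 else 0) * translate h (u \<zeta>) p) \<in> V" .
  moreover have "(\<lambda>p. 1 * (if p = (Node (branch \<zeta> n), h) then 1 else 0) + (if level_option n = i then 1 else 0) * translate h (u \<zeta>) p) = d n \<zeta> i h"
    by (auto simp: d_def)
  ultimately show ?thesis by simp
qed

lemma d_symbol [simp]: "d n \<zeta> i h (Symbol \<zeta>' i', h') = 0"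
proof -
  have "translate h (u \<zeta>) (Symbol \<zeta>' i', h') = 0"
  proof (rule ccontr)
    assume "translate h (u \<zeta>) (Symbol \<zeta>' i', h') \<noteq> 0"
    then have "(Symbol \<zeta>' i', h' \<otimes> inv h) \<in> supp (u \<zeta>)" by (auto simp: translate_def supp_def split: if_splits)
    then show False using u_supp[of \<zeta>] by auto
  qed
  then show ?thesis by (simp add: d_def)
qed

lemma y_symbol: "y k \<zeta> i h (Symbol \<zeta>' i', h') = (if \<zeta>' = \<zeta> \<and> i' = i \<and> h' = h then 1 / fact k else 0)"
  by (auto simp: y_def)

lemma y_V:
  assumes "h \<in> carrier H" "range \<zeta> \<subseteq> A"
  shows "y k \<zeta> i h \<in> V"
proof (induction k)
  case 0
  have "supp (y 0 \<zeta> i h) = {(Symbol \<zeta> i, h)}" by (auto simp: supp_def y_def)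
  then show ?case using assms by (auto simp: V_def idxs_def)
next
  case (Suc k)
  have "y (Suc k) \<zeta> i h = (\<lambda>p. 1 / of_nat (Suc k) * y k \<zeta> i h p + (- 1 / of_nat (Suc k)) * d k \<zeta> i h p)"
  proof
    fix p
    show "y (Suc k) \<zeta> i h p = 1 / of_nat (Suc k) * y k \<zeta> i h p + (- 1 / of_nat (Suc k)) * d k \<zeta> i h p"
      using y_rec[of k \<zeta> i h p] by (simp add: field_simps del: of_nat_Suc)
  qed
  then show ?case using V_lin[OF Suc d_V[OF assms]] by metis
qed

text \<open>At level \<open>k\<close> the sum subtracted in \<open>y k\<close> is exactly what
  \<open>D k\<close> adds, so the node coordinates to be tested become 0.\<close>

lemma y_option_group:
  assumes "h \<in> carrier H" "range \<zeta> \<subseteq> A"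
  shows "y k \<zeta> (\<iota> \<zeta>) h \<in> option_group \<iota>"
proof -
  let ?y = "y k \<zeta> (\<iota> \<zeta>) h"
  have V: "?y \<in> V" by (rule y_V[OF assms])
  have "D k ?y p = (\<Sum>n<k. fact n * d n \<zeta> (\<iota> \<zeta>) h p) / fact k" for p
  proof -
    have "D k ?y p = (\<Sum>q\<in>insert (Symbol \<zeta> (\<iota> \<zeta>), h) (supp ?y). ?y q * (\<Sum>n<k. fact n * increment n q p))"
      using V by (intro D_superset) (auto simp: V_def)
    also have "\<dots> = (\<Sum>q\<in>{(Symbol \<zeta> (\<iota> \<zeta>), h)}. ?y q * (\<Sum>n<k. fact n * increment n q p))"
    proof (rule sum.mono_neutral_right)
      show "\<forall>q\<in>insert (Symbol \<zeta> (\<iota> \<zeta>), h) (supp ?y) - {(Symbol \<zeta> (\<iota> \<zeta>), h)}. ?y q * (\<Sum>n<k. fact n * increment n q p) = 0"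
      proof
        fix q assume q: "q \<in> insert (Symbol \<zeta> (\<iota> \<zeta>), h) (supp ?y) - {(Symbol \<zeta> (\<iota> \<zeta>), h)}"
        show "?y q * (\<Sum>n<k. fact n * increment n q p) = 0"
          using q by (cases q; cases "fst q") (auto simp: y_symbol)
      qed
    qed (use V in \<open>auto simp: V_def\<close>)
    finally show ?thesis by (simp add: y_symbol)
  qed
  then have "integral_at k ?y"
    by (simp add: integral_at_def y_symbol) (simp add: y_def)
  then have "?y \<in> tree_group" using V by (auto simp: tree_group_def)
  then show ?thesis by (auto simp: option_group_def y_symbol split: if_splits)
qed

text \<open>In \<open>d\<close> the vector \<open>u\<close> is translated by the group coordinate of
  the symbol, so the increments are equivariant under right multiplication.\<close>

lemma D_translate:
  assumes h: "h \<in> carrier H" and g: "g \<in> carrier H" and x: "x \<in> V"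
  shows "D K (translate h x) (j, g) = D K x (j, g \<otimes> inv h)"
proof -
  have increment: "increment n (i, f \<otimes> h) (j, g) = increment n (i, f) (j, g \<otimes> inv h)" if f: "f \<in> carrier H" for n i f
  proof (cases i)
    case (Symbol \<zeta> l)
    have 1: "g \<otimes> inv (f \<otimes> h) = g \<otimes> inv h \<otimes> inv f"
      using f g h by (simp add: inv_mult_group m_assoc)
    have "g = f \<otimes> h \<longleftrightarrow> g \<otimes> inv h = f"
      using f g h by (metis inv_solve_right)
    then show ?thesis using f g h 1 by (simp add: Symbol d_def translate_def)
  qed simp
  have inj: "inj_on (\<lambda>(i, g). (i, g \<otimes> h)) (supp x)"
    using V_subset[OF x] h by (auto simp: inj_on_def subset_iff)
  have "D K (translate h x) (j, g) = (\<Sum>q\<in>(\<lambda>(i, g). (i, g \<otimes> h)) ` supp x. translate h x q * (\<Sum>n<K. fact n * increment n q (j, g)))"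
    unfolding D_def translate_supp[OF h V_subset[OF x]] ..
  also have "\<dots> = (\<Sum>q\<in>supp x. x q * (\<Sum>n<K. fact n * increment n q (j, g \<otimes> inv h)))"
    unfolding sum.reindex[OF inj] o_def
  proof (rule sum.cong[OF refl])
    fix q assume "q \<in> supp x"
    moreover obtain i f where q: "q = (i, f)" by force
    ultimately have f: "f \<in> carrier H" using V_subset[OF x] by auto
    have "translate h x (i, f \<otimes> h) = x (i, f)" using f h by (simp add: translate_def m_assoc)
    then show "translate h x (case q of (i, g) \<Rightarrow> (i, g \<otimes> h)) * (\<Sum>n<K. fact n * increment n (case q of (i, g) \<Rightarrow> (i, g \<otimes> h)) (j, g)) =
         x q * (\<Sum>n<K. fact n * increment n q (j, g \<otimes> inv h))" by (simp add: q increment[OF f])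
  qed
  finally show ?thesis by (simp add: D_def)
qed

lemma D_outside:
  assumes "g \<notin> carrier H" and x: "x \<in> V"
  shows "D K x (j, g) = 0"
proof -
  have "increment n q (j, g) = 0" if "q \<in> supp x" for n q
  proof (cases q)
    case (Pair i f)
    with that V_subset[OF x] have "f \<in> carrier H" by auto
    then show ?thesis using assms(1) by (cases i) (auto simp: Pair d_def translate_def)
  qed
  then show ?thesis by (simp add: D_def)
qed

lemma translate_option_group:
  assumes "h \<in> carrier H" "x \<in> option_group \<iota>"
  shows "translate h x \<in> option_group \<iota>"
proof -
  have xV: "x \<in> V" using assms by (simp add: option_group_def tree_group_def)
  obtain K where K: "integral_at K x" using assms by (auto simp: option_group_def tree_group_def)
  have "integral_at K (translate h x)"
    unfolding integral_at_def
  proof (intro conjI allI)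
    show "fact K * translate h x (Symbol \<zeta> i, g) \<in> \<int>" for \<zeta> i g
      using K by (simp add: integral_at_def translate_def)
    show "translate h x (Node t, g) + D K (translate h x) (Node t, g) \<in> \<int>" for t g
      using K D_translate[OF assms(1) _ xV, of g K "Node t"] D_outside[of g "translate h x" K "Node t"] translate_V[OF assms(1) xV]
      by (cases "g \<in> carrier H") (simp_all add: integral_at_def translate_def)
  qed
  then have "translate h x \<in> tree_group" using translate_V[OF assms(1) xV] by (auto simp: tree_group_def)
  then show ?thesis using assms(2) by (auto simp: option_group_def translate_def)
qed

end

section \<open>Comparison of two options\<close>

context twisted_tree
begin

text \<open>The coordinate at the node \<open>branch \<zeta> n\<close> for large \<open>n\<close> only sees the symbols of \<open>\<zeta>\<close>.\<close>

lemma symbol_sums_bounded_denominator: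
  assumes F: "finite F"
  obtains n where "\<And>x \<zeta> h. x \<in> tree_group \<Longrightarrow> supp x \<subseteq> F \<Longrightarrow>
    fact n * (\<Sum>i\<in>{i. (Symbol \<zeta> i, h) \<in> F}. x (Symbol \<zeta> i, h)) \<in> \<int>"
proof -
  \<comment> \<open>\<open>S\<close> and \<open>T\<close> are the branches and nodes to keep apart.
    The default may add one irrelevant branch to \<open>S\<close>; its \<open>u\<close> has finite
    support too.\<close>
  define S where "S = (\<lambda>q. case fst q of Node t \<Rightarrow> undefined | Symbol \<zeta> i \<Rightarrow> \<zeta>) ` F"
  have S: "finite S" "\<And>\<zeta> i h. (Symbol \<zeta> i, h) \<in> F \<Longrightarrow> \<zeta> \<in> S"
    using F by (force simp: S_def)+
  define T where "T = (\<lambda>q. case fst q of Node t \<Rightarrow> t | Symbol \<zeta> i \<Rightarrow> []) ` (F \<union> (\<Union>\<zeta>\<in>S. supp (u \<zeta>)))"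
  have T: "finite T" using F S u_fin by (simp add: T_def)
  have TF: "t \<in> T" if "(Node t, h) \<in> F" for t h
    using that by (force simp: T_def)
  have Tu: "t \<in> T" if "\<zeta> \<in> S" "u \<zeta> (Node t, h) \<noteq> 0" for \<zeta> t h
    using that unfolding T_def by (intro image_eqI[of _ _ "(Node t, h)"]) (auto simp: supp_def)
  \<comment> \<open>At a late level the branches in \<open>S\<close> are pairwise separated and have
    left \<open>F\<close> and the supports of all relevant \<open>u\<close>. The level depends on
    \<open>F\<close> only, which makes the denominator uniform in \<open>x\<close>.\<close>
  have "\<forall>\<^sub>F n in sequentially. \<forall>\<zeta>\<in>S. branch \<zeta> n \<notin> T \<and> (\<forall>\<zeta>'\<in>S. \<zeta> \<noteq> \<zeta>' \<longrightarrow> branch \<zeta> n \<noteq> branch \<zeta>' n)"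
    using S(1) branch_leaves_finite[OF T] branch_separated
    by (simp add: eventually_ball_finite_distrib eventually_conj_iff) blast
  then obtain n where n: "\<And>\<zeta>. \<zeta> \<in> S \<Longrightarrow> branch \<zeta> n \<notin> T"
    "\<And>\<zeta> \<zeta>'. \<zeta> \<in> S \<Longrightarrow> \<zeta>' \<in> S \<Longrightarrow> \<zeta> \<noteq> \<zeta>' \<Longrightarrow> branch \<zeta> n \<noteq> branch \<zeta>' n"
    unfolding eventually_sequentially by blast
  have "fact n * (\<Sum>i\<in>{i. (Symbol \<zeta> i, h) \<in> F}. x (Symbol \<zeta> i, h)) \<in> \<int>"
    if x: "x \<in> tree_group" "supp x \<subseteq> F" for x \<zeta> h
  proof (cases "\<zeta> \<in> S")
    case False
    then have "{i. (Symbol \<zeta> i, h) \<in> F} = {}" using S by auto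
    then show ?thesis by (simp only: sum.empty) simp
  next
    case True
    let ?p = "(Node (branch \<zeta> n), h)"
    obtain K where K: "integral_at K x" using x by (auto simp: tree_group_def)
    \<comment> \<open>The level must exceed \<open>n\<close>, so that \<open>D\<close> contains the
      increment that hits the node \<open>branch \<zeta> n\<close>.\<close>
    then have K: "integral_at (max K (Suc n)) x" by (rule integral_at_mono) simp
    define L where "L = max K (Suc n)"
    have L: "integral_at L x" "n < L" using K by (auto simp: L_def)
    have "?p \<notin> F" using n(1)[OF True] TF by auto
    then have "x ?p = 0" using x by (auto simp: supp_def)
    moreover have "x ?p + D L x ?p \<in> \<int>" using L by (auto simp: integral_at_def)
    moreover have "D L x ?p = fact n * (\<Sum>i\<in>{i. (Symbol \<zeta> i, h) \<in> F}. x (Symbol \<zeta> i, h))"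
    proof -
      have increment: "(\<Sum>m<L. fact m * increment m q ?p) = (if q \<in> (\<lambda>i. (Symbol \<zeta> i, h)) ` UNIV then fact n else 0)"
        if "q \<in> F" for q
      proof (cases q)
        case (Pair j h')
        show ?thesis
        proof (cases j)
          case (Symbol \<zeta>' i)
          have S': "\<zeta>' \<in> S" using S(2) that Pair Symbol by auto
          have "translate h' (u \<zeta>') ?p = 0"
            using Tu[OF S'] n(1)[OF True] by (auto simp: translate_def)
          then have "increment m q ?p = (if ?p = (Node (branch \<zeta>' m), h') then 1 else 0)" for m
            by (simp add: Pair Symbol d_def)
          moreover have "?p = (Node (branch \<zeta>' m), h') \<longleftrightarrow> m = n \<and> \<zeta>' = \<zeta> \<and> h' = h" for m
            using n(2)[OF True S'] by (metis Pair_inject idx.inject(1) length_branch)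
          ultimately have "(\<Sum>m<L. fact m * increment m q ?p) = (\<Sum>m<L. if m = n then (if \<zeta>' = \<zeta> \<and> h' = h then fact n else 0) else 0)"
            by (intro sum.cong) auto
          also have "\<dots> = (if \<zeta>' = \<zeta> \<and> h' = h then fact n else 0)" using L(2) by simp
          finally show ?thesis by (auto simp: Pair Symbol)
        qed (auto simp: Pair)
      qed
      have "D L x ?p = (\<Sum>q\<in>F. x q * (if q \<in> (\<lambda>i. (Symbol \<zeta> i, h)) ` UNIV then fact n else 0))"
        unfolding D_superset[OF F x(2)] by (intro sum.cong) (auto simp only: increment)
      also have "\<dots> = (\<Sum>q\<in>(\<lambda>i. (Symbol \<zeta> i, h)) ` {i. (Symbol \<zeta> i, h) \<in> F}. fact n * x q)"
        by (rule sum.mono_neutral_cong_right[OF F]) auto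
      also have "\<dots> = fact n * (\<Sum>i\<in>{i. (Symbol \<zeta> i, h) \<in> F}. x (Symbol \<zeta> i, h))"
        by (subst sum.reindex) (auto simp: inj_on_def sum_distrib_left)
      finally show ?thesis .
    qed
    ultimately show ?thesis by simp
  qed
  then show ?thesis by (rule that)
qed

text \<open>With a single option per branch the sum over the options is one coordinate. The node
  coordinates follow from the integrality of \<open>x + D K x\<close>, as \<open>D K x\<close>
  depends on symbol coordinates only.\<close>

lemma option_group_bounded_denominator:
  assumes F: "finite F"
  obtains N :: nat where "N > 0" "\<And>x p. x \<in> option_group \<iota> \<Longrightarrow> supp x \<subseteq> F \<Longrightarrow> of_nat N * x p \<in> \<int>"
proof -
  obtain n where n: "\<And>x \<zeta> h. x \<in> tree_group \<Longrightarrow> supp x \<subseteq> F \<Longrightarrow>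
    fact n * (\<Sum>i\<in>{i. (Symbol \<zeta> i, h) \<in> F}. x (Symbol \<zeta> i, h)) \<in> \<int>"
    using symbol_sums_bounded_denominator[OF F] by blast
  have "fact n * x p \<in> \<int>" if x: "x \<in> option_group \<iota>" "supp x \<subseteq> F" for x p
  proof -
    have tree_group: "x \<in> tree_group" using x by (simp add: option_group_def)
    have sym: "fact n * x (Symbol \<zeta> i, h) \<in> \<int>" for \<zeta> i h
    proof (cases "x (Symbol \<zeta> i, h) = 0")
      case False
      then have i: "i = \<iota> \<zeta>" using x by (auto simp: option_group_def)
      have "(\<Sum>i\<in>{i. (Symbol \<zeta> i, h) \<in> F}. x (Symbol \<zeta> i, h)) = (\<Sum>i\<in>{\<iota> \<zeta>}. x (Symbol \<zeta> i, h))"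
      proof (rule sum.mono_neutral_right)
        show "finite {i. (Symbol \<zeta> i, h) \<in> F}"
          using finite_vimageI[OF F, of "\<lambda>i. (Symbol \<zeta> i, h)"] by (simp add: inj_on_def vimage_def)
        show "{\<iota> \<zeta>} \<subseteq> {i. (Symbol \<zeta> i, h) \<in> F}" using False x(2) i by (auto simp: supp_def)
        show "\<forall>i\<in>{i. (Symbol \<zeta> i, h) \<in> F} - {\<iota> \<zeta>}. x (Symbol \<zeta> i, h) = 0" using x by (auto simp: option_group_def)
      qed
      then show ?thesis using n[OF tree_group x(2), of \<zeta> h] i by simp
    qed simp
    show ?thesis
    proof (cases p)
      case (Pair j h)
      show ?thesis
      proof (cases j)
        case (Symbol \<zeta> i)
        then show ?thesis using sym Pair by simp
      next
        case (Node t)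
        obtain K where K: "integral_at K x" using tree_group by (auto simp: tree_group_def)
        have "fact n * x q * (\<Sum>n<K. fact n * increment n q p) \<in> \<int>" for q
        proof (cases q)
          case (Pair j' h')
          show ?thesis
          proof (cases j')
            case (Symbol \<zeta> i)
            have "(\<Sum>n<K. fact n * increment n q p) \<in> \<int>"
              by (intro Ints_sum Ints_mult increment_int) (auto simp: fact_in_Ints)
            then show ?thesis using sym Ints_mult by (simp add: Pair Symbol)
          qed (simp add: Pair)
        qed
        then have "(\<Sum>q\<in>supp x. fact n * x q * (\<Sum>n<K. fact n * increment n q p)) \<in> \<int>" by (rule Ints_sum)
        then have "fact n * D K x p \<in> \<int>" by (simp add: D_def sum_distrib_left mult.assoc)
        moreover have "fact n * (x p + D K x p) \<in> \<int>"
          using K by (intro Ints_mult) (auto simp: integral_at_def Pair Node fact_in_Ints)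
        ultimately have "fact n * (x p + D K x p) - fact n * D K x p \<in> \<int>" by (rule Ints_diff[rotated])
        then show ?thesis by (simp add: algebra_simps)
      qed
    qed
  qed
  then show ?thesis by (intro that[of "fact n"]) auto
qed

text \<open>The equations that \<open>z k = \<phi> (y k \<eta> i \<one>)\<close> satisfies for an endomorphism \<open>\<phi>\<close>, where
  \<open>g k\<close> is the value of \<open>\<phi>\<close> at the \<open>k\<close>-th node of \<open>\<eta>\<close> and \<open>w = \<phi> (u \<eta>)\<close>.\<close>

definition run :: "((nat \<Rightarrow> 'b) \<Rightarrow> nat) \<Rightarrow> nat \<Rightarrow> (nat \<Rightarrow> ('b, 'h) vec) \<Rightarrow> ('b, 'h) vec \<Rightarrow>
    (nat \<Rightarrow> ('b, 'h) vec) \<Rightarrow> bool" where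
  "run \<iota> i g w z \<longleftrightarrow> (\<forall>k. z k \<in> option_group \<iota>) \<and>
    (\<forall>k p. z k p = g k p + (if level_option k = i then w p else 0) + of_nat (Suc k) * z (Suc k) p)"

lemma option_group_fin: "x \<in> option_group \<iota> \<Longrightarrow> finite (supp x)"
  by (simp add: option_group_def tree_group_def V_def)

lemma option_group_symbol_sum:
  assumes "x \<in> option_group \<iota>" "finite F" "supp x \<subseteq> F"
  shows "(\<Sum>i\<in>{i. (Symbol \<zeta> i, h) \<in> F}. x (Symbol \<zeta> i, h)) = x (Symbol \<zeta> (\<iota> \<zeta>), h)"
proof -
  have fin: "finite {i. (Symbol \<zeta> i, h) \<in> F}"
    using finite_vimageI[OF assms(2), of "\<lambda>i. (Symbol \<zeta> i, h)"] by (simp add: inj_on_def vimage_def)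
  have "(\<Sum>i\<in>{i. (Symbol \<zeta> i, h) \<in> F}. x (Symbol \<zeta> i, h)) =
      (\<Sum>i\<in>insert (\<iota> \<zeta>) {i. (Symbol \<zeta> i, h) \<in> F}. x (Symbol \<zeta> i, h))"
    using assms fin by (intro sum.mono_neutral_left) (auto simp: supp_def)
  also have "\<dots> = (\<Sum>i\<in>{\<iota> \<zeta>}. x (Symbol \<zeta> i, h))"
    using assms fin by (intro sum.mono_neutral_right) (auto simp: option_group_def)
  finally show ?thesis by simp
qed

text \<open>In the difference of the runs \<open>g\<close> cancels and leaves
  \<open>x k = \<epsilon> k * w + (k+1) * x (k+1)\<close> with \<open>\<epsilon> k\<close> in {-1,
  0, 1}. Summed over the options of one branch, its symbol coordinates have bounded denominators, so
  the integer recurrence applies.\<close>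

lemma two_runs:
  assumes z: "run \<iota> i g w z" and z': "run \<iota>' j g w z'" and "i \<noteq> j" and w: "w \<in> option_group \<iota>"
  shows "z 0 (Symbol \<zeta> (\<iota> \<zeta>), h) = z' 0 (Symbol \<zeta> (\<iota>' \<zeta>), h)" and "w (Symbol \<zeta> l, h) = 0"
proof -
  define x where "x k p = z' k p - z k p" for k p
  define \<epsilon> :: "nat \<Rightarrow> rat" where "\<epsilon> k = (if level_option k = j then 1 else 0) - (if level_option k = i then 1 else 0)" for k
  have rec: "x k p = \<epsilon> k * w p + of_nat (Suc k) * x (Suc k) p" for k p
  proof -
    have "z k p = g k p + (if level_option k = i then w p else 0) + of_nat (Suc k) * z (Suc k) p"
      "z' k p = g k p + (if level_option k = j then w p else 0) + of_nat (Suc k) * z' (Suc k) p"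
      using z z' unfolding run_def by blast+
    then show ?thesis by (simp add: x_def \<epsilon>_def right_diff_distrib)
  qed
  define F where "F = supp (z 0) \<union> supp (z' 0) \<union> supp w"
  have zG: "z k \<in> option_group \<iota>" "z' k \<in> option_group \<iota>'" for k using z z' unfolding run_def by blast+
  have F: "finite F" using zG[of 0] w unfolding F_def by (meson option_group_fin finite_UnI)
  have subF: "supp (z 0) \<subseteq> F" "supp (z' 0) \<subseteq> F" "supp w \<subseteq> F" by (auto simp: F_def)
  have sub: "supp (x k) \<subseteq> F" for k
  proof (induction k)
    case (Suc k)
    show ?case
    proof
      fix p assume p: "p \<in> supp (x (Suc k))"
      show "p \<in> F"
      proof (rule ccontr)
        assume "p \<notin> F"
        then have "x k p = 0" "w p = 0" using Suc by (auto simp: F_def supp_def)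
        then show False using rec[of k p] p by (simp add: supp_def del: of_nat_Suc)
      qed
    qed
  qed (auto simp: F_def supp_def x_def)
  have tree_group: "x k \<in> tree_group" for k
    using tree_group_lin[of "z' k" "z k" 1 "-1"] zG[of k] by (auto simp: option_group_def x_def[abs_def])
  obtain n where n: "\<And>x \<zeta> h. x \<in> tree_group \<Longrightarrow> supp x \<subseteq> F \<Longrightarrow>
    fact n * (\<Sum>i\<in>{i. (Symbol \<zeta> i, h) \<in> F}. x (Symbol \<zeta> i, h)) \<in> \<int>"
    using symbol_sums_bounded_denominator[OF F] by blast
  define I where "I = {i. (Symbol \<zeta> i, h) \<in> F}"
  define a where "a k = fact n * (\<Sum>i\<in>I. x k (Symbol \<zeta> i, h))" for k
  define W where "W = fact n * (\<Sum>i\<in>I. w (Symbol \<zeta> i, h))"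
  have arec: "a k = \<epsilon> k * W + of_nat (Suc k) * a (Suc k)" for k
    unfolding a_def W_def rec[of k] by (simp add: sum.distrib sum_distrib_left algebra_simps)
  have "\<bar>\<epsilon> k * W\<bar> \<le> \<bar>W\<bar>" for k by (auto simp: \<epsilon>_def)
  moreover have "a k \<in> \<int>" for k using n[OF tree_group sub] by (simp add: a_def I_def)
  ultimately obtain M where M: "\<And>k. k \<ge> M \<Longrightarrow> a k = 0 \<and> \<epsilon> k * W = 0"
    using factorial_recurrence_eventually_zero[of a "\<lambda>k. \<epsilon> k * W", OF _ arec] by metis
  \<comment> \<open>At a level of option \<open>j\<close> the factor \<open>\<epsilon> k\<close> is
    1, which kills \<open>W\<close>. Without \<open>W\<close> the zeros of \<open>a\<close> descend
    from \<open>M\<close> to 0.\<close>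
  obtain k where k: "k \<ge> M" "level_option k = j" using level_option_infinite by blast
  then have "\<epsilon> k = 1" using \<open>i \<noteq> j\<close> by (simp add: \<epsilon>_def)
  then have W: "W = 0" using M[OF k(1)] by simp
  have "a (M - l) = 0" for l
  proof (induction l)
    case (Suc l)
    show ?case
    proof (cases "M - l")
      case m: (Suc m)
      then have "M - Suc l = m" by simp
      then show ?thesis using arec[of m] W Suc m by simp
    qed (use Suc in simp)
  qed (use M in simp)
  from this[of M] have "(\<Sum>i\<in>I. x 0 (Symbol \<zeta> i, h)) = 0" by (simp add: a_def)
  then have "(\<Sum>i\<in>I. z' 0 (Symbol \<zeta> i, h)) = (\<Sum>i\<in>I. z 0 (Symbol \<zeta> i, h))"
    by (simp add: x_def sum_subtractf)
  then show "z 0 (Symbol \<zeta> (\<iota> \<zeta>), h) = z' 0 (Symbol \<zeta> (\<iota>' \<zeta>), h)"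
    using option_group_symbol_sum[OF zG(1) F subF(1), of \<zeta> h] option_group_symbol_sum[OF zG(2) F subF(2), of \<zeta> h]
    by (simp add: I_def)
  have "w (Symbol \<zeta> (\<iota> \<zeta>), h) = 0"
    using option_group_symbol_sum[OF w F subF(3), of \<zeta> h] W by (simp add: I_def W_def)
  then show "w (Symbol \<zeta> l, h) = 0" using w by (auto simp: option_group_def)
qed

text \<open>Now the node coordinates are compared. As \<open>w\<close> has no symbols,
  \<open>x k\<close> is \<open>x 0 / fact k\<close> at symbols, and \<open>x k + D k (x k)\<close>
  is, up to a fixed factor, an integer sequence with bounded inhomogeneity. The latter vanishes
  eventually, which expresses \<open>w\<close> through the increments at a late level; at levels of
  option \<open>i\<close> only translates of \<open>u \<eta>\<close> survive.\<close>

lemma two_runs_conclusion: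
  assumes z: "run \<iota> i g w z" and z': "run \<iota>' j g w z'" and "i \<noteq> j" and w: "w \<in> option_group \<iota>"
    and \<eta>: "\<iota> \<eta> = i" "\<iota>' \<eta> = j"
    and avoid: "\<And>\<zeta> h. \<zeta> \<noteq> \<eta> \<Longrightarrow> z 0 (Symbol \<zeta> (\<iota> \<zeta>), h) \<noteq> 0 \<Longrightarrow> \<iota> \<zeta> \<noteq> i \<and> \<iota>' \<zeta> \<noteq> i"
  shows "\<exists>r. finite (supp r) \<and> supp r \<subseteq> carrier H \<and> (\<forall>p. w p = (\<Sum>h\<in>supp r. r h * translate h (u \<eta>) p))"
proof -
  define x where "x k p = z' k p - z k p" for k p
  define \<epsilon> :: "nat \<Rightarrow> rat" where "\<epsilon> k = (if level_option k = j then 1 else 0) - (if level_option k = i then 1 else 0)" for k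
  have rec: "x k p = \<epsilon> k * w p + of_nat (Suc k) * x (Suc k) p" for k p
  proof -
    have "z k p = g k p + (if level_option k = i then w p else 0) + of_nat (Suc k) * z (Suc k) p"
      "z' k p = g k p + (if level_option k = j then w p else 0) + of_nat (Suc k) * z' (Suc k) p"
      using z z' unfolding run_def by blast+
    then show ?thesis by (simp add: x_def \<epsilon>_def right_diff_distrib)
  qed
  have zG: "z k \<in> option_group \<iota>" "z' k \<in> option_group \<iota>'" for k using z z' unfolding run_def by blast+
  have tree_group: "x k \<in> tree_group" for k
    using tree_group_lin[of "z' k" "z k" 1 "-1"] zG[of k] by (auto simp: option_group_def x_def[abs_def])
  have wsym: "w (Symbol \<zeta> l, h) = 0" for \<zeta> l h
    by (rule two_runs(2)[OF z z' \<open>i \<noteq> j\<close> w])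
  have xsym: "x k q * increment n q p = x 0 q / fact k * increment n q p" for k q n p
  proof (cases q)
    case (Pair m h)
    show ?thesis
    proof (cases m)
      case (Symbol \<zeta> l)
      have "x 0 (Symbol \<zeta> l, h) = fact k * x k (Symbol \<zeta> l, h)"
      proof (induction k)
        case (Suc k)
        then show ?case using rec[of k "(Symbol \<zeta> l, h)"] by (simp add: wsym)
      qed simp
      then show ?thesis by (simp add: Pair Symbol)
    qed (simp add: Pair)
  qed
  define F where "F = supp (x 0) \<union> supp w"
  have F: "finite F" using tree_group[of 0] option_group_fin[OF w] by (auto simp: F_def tree_group_def V_def)
  have sub: "supp (x k) \<subseteq> F" for k
  proof (induction k)
    case (Suc k)
    show ?case
    proof
      fix p assume p: "p \<in> supp (x (Suc k))"
      show "p \<in> F"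
      proof (rule ccontr)
        assume "p \<notin> F"
        then have "x k p = 0" "w p = 0" using Suc by (auto simp: F_def supp_def)
        then show False using rec[of k p] p by (simp add: supp_def del: of_nat_Suc)
      qed
    qed
  qed (auto simp: F_def)
  \<comment> \<open>One factor for all \<open>k\<close>: the vector \<open>x k\<close> is integral
    at some level \<open>K1\<close> that may exceed \<open>k\<close>. Going back to level
    \<open>k\<close> removes terms \<open>fact n / fact k * (x 0 q * increment n q p)\<close> with
    \<open>n \<ge> k\<close>, and \<open>fact K0\<close> makes them integers.\<close>
  obtain K0 where "integral_at K0 (x 0)" using tree_group[of 0] by (auto simp: tree_group_def)
  then have K0: "fact K0 * x 0 (Symbol \<zeta> l, h) \<in> \<int>" for \<zeta> l h by (simp add: integral_at_def)
  have K0dd: "fact K0 * x 0 q * increment n q p \<in> \<int>" for q n p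
  proof (cases q)
    case (Pair m h)
    show ?thesis
    proof (cases m)
      case (Symbol \<zeta> l)
      then show ?thesis using Ints_mult[OF K0 d_int] Pair by simp
    qed (simp add: Pair)
  qed
  have DK: "D K (x k) p = (\<Sum>q\<in>F. \<Sum>n<K. fact n / fact k * (x 0 q * increment n q p))" for K k p
    unfolding D_superset[OF F sub] sum_distrib_left
    by (intro sum.cong refl) (use xsym[of k] in \<open>simp add: algebra_simps\<close>)
  have main: "w (Node t, f) = (\<Sum>h\<in>{h. z 0 (Symbol \<eta> i, h) \<noteq> 0}. z 0 (Symbol \<eta> i, h) * translate h (u \<eta>) (Node t, f))" for t f
  proof -
    let ?p = "(Node t, f)"
    define a where "a k = fact K0 * (x k ?p + D k (x k) ?p)" for k
    define v where "v k = fact K0 * (\<epsilon> k * w ?p - (\<Sum>q\<in>F. x 0 q * increment k q ?p))" for k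
    have "a k \<in> \<int>" for k
    proof -
      obtain K1 where "integral_at K1 (x k)" using tree_group[of k] by (auto simp: tree_group_def)
      then have K: "integral_at (max K1 k) (x k)" by (rule integral_at_mono) simp
      define K where "K = max K1 k"
      have "D K (x k) ?p - D k (x k) ?p = (\<Sum>q\<in>F. \<Sum>n\<in>{k..<K}. fact n / fact k * (x 0 q * increment n q ?p))"
      proof -
        have "(\<Sum>n<K. c n) - (\<Sum>n<k. c n) = (\<Sum>n\<in>{k..<K}. c n)" for c :: "nat \<Rightarrow> rat"
          using sum.union_disjoint[of "{..<k}" "{k..<K}" c] ivl_disj_un_one(2)[of k K]
          by (simp add: K_def ivl_disj_int)
        then show ?thesis unfolding DK sum_subtractf[symmetric] by simp
      qed
      moreover have "fact K0 * (\<Sum>q\<in>F. \<Sum>n\<in>{k..<K}. fact n / fact k * (x 0 q * increment n q ?p)) \<in> \<int>"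
        unfolding sum_distrib_left
      proof (intro Ints_sum)
        fix q n assume "n \<in> {k..<K}"
        then obtain m :: nat where m: "(fact n :: nat) = fact k * m" using fact_dvd[of k n] by auto
        then have "(fact n :: rat) = fact k * of_nat m" by (metis of_nat_fact of_nat_mult)
        then have "fact K0 * (fact n / fact k * (x 0 q * increment n q ?p)) = of_nat m * (fact K0 * x 0 q * increment n q ?p)"
          by simp
        also have "\<dots> \<in> \<int>" using K0dd Ints_mult Ints_of_nat by blast
        finally show "fact K0 * (fact n / fact k * (x 0 q * increment n q ?p)) \<in> \<int>" .
      qed
      moreover have "fact K0 * (x k ?p + D K (x k) ?p) \<in> \<int>"
        using K by (intro Ints_mult) (auto simp: integral_at_def K_def fact_in_Ints)
      ultimately have "fact K0 * (x k ?p + D K (x k) ?p) - fact K0 * (D K (x k) ?p - D k (x k) ?p) \<in> \<int>"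
        by (metis Ints_diff)
      then show ?thesis by (simp add: a_def algebra_simps)
    qed
    moreover have "a k = v k + of_nat (Suc k) * a (Suc k)" for k
    proof -
      have "of_nat (Suc k) * D (Suc k) (x (Suc k)) ?p = (\<Sum>q\<in>F. \<Sum>n<Suc k. fact n / fact k * (x 0 q * increment n q ?p))"
        unfolding DK sum_distrib_left by (intro sum.cong refl) (simp del: of_nat_Suc)
      then have "of_nat (Suc k) * D (Suc k) (x (Suc k)) ?p = D k (x k) ?p + (\<Sum>q\<in>F. x 0 q * increment k q ?p)"
        unfolding DK by (simp add: sum.distrib)
      then show ?thesis using rec[of k ?p] unfolding a_def v_def by (simp add: algebra_simps)
    qed
    moreover
    define b where "b q = 1 + \<bar>translate (snd q) (u (case fst q of Node t \<Rightarrow> undefined | Symbol \<zeta> l \<Rightarrow> \<zeta>)) ?p\<bar>" for q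
    define C where "C = \<bar>w ?p\<bar> + (\<Sum>q\<in>F. \<bar>x 0 q\<bar> * b q)"
    have "\<bar>v k\<bar> \<le> fact K0 * C" for k
    proof -
      have "\<bar>\<epsilon> k * w ?p\<bar> \<le> \<bar>w ?p\<bar>" by (auto simp: \<epsilon>_def)
      moreover have "\<bar>\<Sum>q\<in>F. x 0 q * increment k q ?p\<bar> \<le> (\<Sum>q\<in>F. \<bar>x 0 q\<bar> * b q)"
      proof (rule order_trans[OF sum_abs], rule sum_mono)
        fix q assume "q \<in> F"
        have "\<bar>increment k q ?p\<bar> \<le> b q"
          unfolding b_def by (cases q; cases "fst q") (auto simp: d_def)
        then show "\<bar>x 0 q * increment k q ?p\<bar> \<le> \<bar>x 0 q\<bar> * b q"
          unfolding abs_mult by (rule mult_left_mono) simp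
      qed
      ultimately have "\<bar>\<epsilon> k * w ?p - (\<Sum>q\<in>F. x 0 q * increment k q ?p)\<bar> \<le> C"
        unfolding C_def by linarith
      then have "fact K0 * \<bar>\<epsilon> k * w ?p - (\<Sum>q\<in>F. x 0 q * increment k q ?p)\<bar> \<le> fact K0 * C"
        by (rule mult_left_mono) simp
      then show ?thesis unfolding v_def abs_mult[of "fact K0"] by (simp only: abs_of_nonneg[OF fact_ge_zero])
    qed
    ultimately obtain M where M: "\<And>k. k \<ge> M \<Longrightarrow> a k = 0 \<and> v k = 0"
      using factorial_recurrence_eventually_zero[of a v "fact K0 * C"] by blast
    \<comment> \<open>A level of option \<open>i\<close> beyond the length of \<open>t\<close>: here
      \<open>\<epsilon> k\<close> is -1, no node \<open>branch \<zeta> k\<close> equals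
      \<open>t\<close>, and only symbols of option \<open>i\<close> contribute their
      \<open>u\<close>.\<close>
    obtain k where k: "k \<ge> max M (Suc (length t))" "level_option k = i" using level_option_infinite by blast
    have "\<epsilon> k = -1" using k \<open>i \<noteq> j\<close> by (simp add: \<epsilon>_def)
    moreover have "v k = 0" using M k by simp
    ultimately have "w ?p = - (\<Sum>q\<in>F. x 0 q * increment k q ?p)" by (simp add: v_def)
    also have "(\<Sum>q\<in>F. x 0 q * increment k q ?p) = (\<Sum>q\<in>(\<lambda>h. (Symbol \<eta> i, h)) ` {h. z 0 (Symbol \<eta> i, h) \<noteq> 0}. x 0 q * translate (snd q) (u \<eta>) ?p)"
    proof (rule sum.mono_neutral_cong[OF _ F])
      have "(\<lambda>h. (Symbol \<eta> i, h)) ` {h. z 0 (Symbol \<eta> i, h) \<noteq> 0} \<subseteq> supp (z 0)" by (auto simp: supp_def)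
      then show "finite ((\<lambda>h. (Symbol \<eta> i, h)) ` {h. z 0 (Symbol \<eta> i, h) \<noteq> 0})"
        using option_group_fin[OF zG(1)] by (rule finite_subset)
    next
      fix q assume q: "q \<in> (\<lambda>h. (Symbol \<eta> i, h)) ` {h. z 0 (Symbol \<eta> i, h) \<noteq> 0} - F"
      then have "x 0 q = 0" by (auto simp: F_def supp_def)
      then show "x 0 q * translate (snd q) (u \<eta>) ?p = 0" by simp
    next
      fix q assume q: "q \<in> F - (\<lambda>h. (Symbol \<eta> i, h)) ` {h. z 0 (Symbol \<eta> i, h) \<noteq> 0}"
      show "x 0 q * increment k q ?p = 0"
      proof (rule ccontr)
        assume nz: "x 0 q * increment k q ?p \<noteq> 0"
        then obtain \<zeta> l h where Symbol: "q = (Symbol \<zeta> l, h)" by (cases q; cases "fst q") auto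
        have "branch \<zeta> k \<noteq> t" using k by auto
        then have l: "l = i" using nz k(2) by (auto simp: Symbol d_def split: if_splits)
        have "z' 0 q \<noteq> 0 \<or> z 0 q \<noteq> 0" using nz by (auto simp: x_def)
        then have or: "l = \<iota>' \<zeta> \<and> z' 0 (Symbol \<zeta> (\<iota>' \<zeta>), h) \<noteq> 0 \<or> l = \<iota> \<zeta> \<and> z 0 (Symbol \<zeta> (\<iota> \<zeta>), h) \<noteq> 0"
          using zG[of 0] unfolding option_group_def Symbol by blast
        \<comment> \<open>A symbol that occurs in \<open>z'\<close> has its branch in
          \<open>z\<close> as well, since the coefficients agree; so \<open>avoid\<close> applies to
          it unless the branch is \<eta>.\<close>
        then have "z 0 (Symbol \<zeta> (\<iota> \<zeta>), h) \<noteq> 0" using two_runs(1)[OF z z' \<open>i \<noteq> j\<close> w] by auto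
        then have "\<zeta> = \<eta>" using avoid[of \<zeta> h] or l by auto
        then show False using or q l \<open>i \<noteq> j\<close> \<eta> by (auto simp: Symbol)
      qed
    next
      fix q assume "q \<in> F \<inter> (\<lambda>h. (Symbol \<eta> i, h)) ` {h. z 0 (Symbol \<eta> i, h) \<noteq> 0}"
      then obtain h where h: "q = (Symbol \<eta> i, h)" by auto
      have "branch \<eta> k \<noteq> t" using k by auto
      then show "x 0 q * increment k q ?p = x 0 q * translate (snd q) (u \<eta>) ?p" using k(2) by (auto simp: h d_def)
    qed
    also have "\<dots> = (\<Sum>h\<in>{h. z 0 (Symbol \<eta> i, h) \<noteq> 0}. x 0 (Symbol \<eta> i, h) * translate h (u \<eta>) ?p)"
      by (subst sum.reindex) (auto simp: inj_on_def)
    also have "\<dots> = (\<Sum>h\<in>{h. z 0 (Symbol \<eta> i, h) \<noteq> 0}. - (z 0 (Symbol \<eta> i, h) * translate h (u \<eta>) ?p))"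
    proof (rule sum.cong[OF refl])
      fix h
      have "z' 0 (Symbol \<eta> i, h) = 0" using zG(2)[of 0] \<eta> \<open>i \<noteq> j\<close> by (auto simp: option_group_def)
      then show "x 0 (Symbol \<eta> i, h) * translate h (u \<eta>) ?p = - (z 0 (Symbol \<eta> i, h) * translate h (u \<eta>) ?p)" by (simp add: x_def)
    qed
    finally show ?thesis by (simp add: sum_negf)
  qed
  define r where "r h = z 0 (Symbol \<eta> i, h)" for h
  have "(\<lambda>h. (Symbol \<eta> i, h)) ` supp r \<subseteq> supp (z 0)" by (auto simp: r_def supp_def)
  then have "finite ((\<lambda>h. (Symbol \<eta> i, h)) ` supp r)" using option_group_fin[OF zG(1)] by (rule finite_subset)
  then have "finite (supp r)" by (rule finite_imageD) (simp add: inj_on_def)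
  moreover have "supp r \<subseteq> carrier H"
  proof
    fix h assume "h \<in> supp r"
    then have "(Symbol \<eta> i, h) \<in> supp (z 0)" by (simp add: r_def supp_def)
    then show "h \<in> carrier H" using zG(1)[of 0] V_subset[of "z 0"] by (auto simp: option_group_def tree_group_def)
  qed
  moreover have "w p = (\<Sum>h\<in>supp r. r h * translate h (u \<eta>) p)" for p
  proof (cases p)
    case (Pair m f)
    show ?thesis
    proof (cases m)
      case (Node t)
      then show ?thesis using main[of t f] by (simp add: Pair r_def supp_def)
    next
      case (Symbol \<zeta> l)
      have "u \<eta> (Symbol \<zeta> l, f') = 0" for f' using u_supp[of \<eta>] by (auto simp: supp_def)
      then have "translate h (u \<eta>) p = 0" for h by (simp add: Pair Symbol translate_def)
      then show ?thesis using wsym by (simp add: Pair Symbol)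
    qed
  qed
  ultimately show ?thesis by blast
qed

section \<open>Choice of the options\<close>

definition failing :: "((nat \<Rightarrow> 'b) \<Rightarrow> nat) \<Rightarrow> nat \<Rightarrow> (nat \<Rightarrow> ('b, 'h) vec) \<Rightarrow> ('b, 'h) vec \<Rightarrow>
    (nat \<Rightarrow> 'b) \<Rightarrow> (nat \<Rightarrow> ('b, 'h) vec) \<Rightarrow> bool" where
  "failing \<iota> i g w \<eta> z \<longleftrightarrow> run \<iota> i g w z \<and> w \<in> option_group \<iota> \<and> \<iota> \<eta> = i"

definition clash :: "(nat \<Rightarrow> ('b, 'h) vec) \<Rightarrow> ('b, 'h) vec \<Rightarrow> (nat \<Rightarrow> 'b) \<Rightarrow> (nat \<Rightarrow> 'b) set" where
  "clash g w \<eta> = {\<zeta>. \<exists>\<iota> i z \<iota>' j z' h. failing \<iota> i g w \<eta> z \<and> failing \<iota>' j g w \<eta> z' \<and> i \<noteq> j \<and>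
      z 0 (Symbol \<zeta> (\<iota> \<zeta>), h) \<noteq> 0}"

text \<open>Fix two failing runs with distinct options. The option of any further one differs from
  at least one of theirs, and then \<open>two_runs\<close> equates the coefficients. So every
  clashing branch occurs in one of two fixed finite supports.\<close>

lemma finite_clash: "finite (clash g w \<eta>)"
proof (cases "clash g w \<eta> = {}")
  case False
  then obtain \<iota>\<^sub>1 i\<^sub>1 z\<^sub>1 \<iota>\<^sub>2 i\<^sub>2 z\<^sub>2 where f: "failing \<iota>\<^sub>1 i\<^sub>1 g w \<eta> z\<^sub>1" "failing \<iota>\<^sub>2 i\<^sub>2 g w \<eta> z\<^sub>2" "i\<^sub>1 \<noteq> i\<^sub>2"
    by (auto simp: clash_def)
  have "clash g w \<eta> \<subseteq> (\<lambda>q. case fst q of Node t \<Rightarrow> undefined | Symbol \<zeta> i \<Rightarrow> \<zeta>) ` (supp (z\<^sub>1 0) \<union> supp (z\<^sub>2 0))"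
  proof
    fix \<zeta> assume "\<zeta> \<in> clash g w \<eta>"
    then obtain \<iota> i z h where z: "failing \<iota> i g w \<eta> z" "z 0 (Symbol \<zeta> (\<iota> \<zeta>), h) \<noteq> 0"
      by (auto simp: clash_def)
    have "z\<^sub>1 0 (Symbol \<zeta> (\<iota>\<^sub>1 \<zeta>), h) \<noteq> 0 \<or> z\<^sub>2 0 (Symbol \<zeta> (\<iota>\<^sub>2 \<zeta>), h) \<noteq> 0"
      using two_runs(1)[of \<iota> i g w z \<iota>\<^sub>1 i\<^sub>1 z\<^sub>1 \<zeta> h] two_runs(1)[of \<iota> i g w z \<iota>\<^sub>2 i\<^sub>2 z\<^sub>2 \<zeta> h] z f
      unfolding failing_def by metis
    then show "\<zeta> \<in> (\<lambda>q. case fst q of Node t \<Rightarrow> undefined | Symbol \<zeta> i \<Rightarrow> \<zeta>) ` (supp (z\<^sub>1 0) \<union> supp (z\<^sub>2 0))"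
      by (force simp: supp_def)
  qed
  moreover have "finite (supp (z\<^sub>1 0) \<union> supp (z\<^sub>2 0))"
    using f by (auto simp: failing_def run_def intro: option_group_fin)
  ultimately show ?thesis by (meson finite_imageI finite_subset)
qed simp

text \<open>Each \<open>\<eta>\<close> is offered the two options \<open>2 \<kappa>\<close> and \<open>2 \<kappa> + 1\<close> of its colour \<open>\<kappa>\<close>, and takes the first
  one unless the data predicted by \<open>\<eta>\<close> fit it. The colouring keeps the branches that may occur in
  the values of a predicted map away from both options.\<close>

theorem options_exist:
  fixes g :: "(nat \<Rightarrow> 'b) \<Rightarrow> nat \<Rightarrow> ('b, 'h) vec" and w :: "(nat \<Rightarrow> 'b) \<Rightarrow> ('b, 'h) vec"
  obtains \<iota> where "\<And>\<eta> z. run \<iota> (\<iota> \<eta>) (g \<eta>) (w \<eta>) z \<Longrightarrow> w \<eta> \<in> option_group \<iota> \<Longrightarrow>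
    \<exists>r. finite (supp r) \<and> supp r \<subseteq> carrier H \<and> (\<forall>p. w \<eta> p = (\<Sum>h\<in>supp r. r h * translate h (u \<eta>) p))"
proof -
  obtain \<kappa> :: "(nat \<Rightarrow> 'b) \<Rightarrow> nat" where
    \<kappa>: "\<And>\<eta> \<zeta>. \<zeta> \<in> clash (g \<eta>) (w \<eta>) \<eta> \<Longrightarrow> \<zeta> \<noteq> \<eta> \<Longrightarrow> \<kappa> \<zeta> \<noteq> \<kappa> \<eta>"
    using finite_outdegree_coloring[of "\<lambda>\<eta>. clash (g \<eta>) (w \<eta>) \<eta>"] finite_clash by metis
  \<comment> \<open>The final assignment does not exist yet, so \<open>bad\<close> admits any
    assignment that takes its options from the same pairs.\<close>
  define bad where "bad \<eta> i \<longleftrightarrow> (\<exists>\<iota> z. failing \<iota> i (g \<eta>) (w \<eta>) \<eta> z \<and> (\<forall>\<zeta>. \<iota> \<zeta> div 2 = \<kappa> \<zeta>))" for \<eta> i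
  define \<iota> where "\<iota> \<eta> = (if bad \<eta> (2 * \<kappa> \<eta>) then 2 * \<kappa> \<eta> + 1 else 2 * \<kappa> \<eta>)" for \<eta>
  show ?thesis
  proof (rule that)
    fix \<eta> z assume run: "run \<iota> (\<iota> \<eta>) (g \<eta>) (w \<eta>) z" and w: "w \<eta> \<in> option_group \<iota>"
    have fail: "failing \<iota> (\<iota> \<eta>) (g \<eta>) (w \<eta>) \<eta> z" using run w by (simp add: failing_def)
    have div: "\<iota> \<zeta> div 2 = \<kappa> \<zeta>" for \<zeta> by (simp add: \<iota>_def)
    \<comment> \<open>If the first option were in place, \<iota> itself would witness
      \<open>bad\<close> for it, and the second would have been taken. So the second is in place and
      the first has a witness \<open>\<iota>'\<close>.\<close>
    have "bad \<eta> (\<iota> \<eta>)" using fail div by (auto simp: bad_def)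
    then have "bad \<eta> (2 * \<kappa> \<eta>)" and \<iota>\<eta>: "\<iota> \<eta> = 2 * \<kappa> \<eta> + 1" by (auto simp: \<iota>_def split: if_splits)
    then obtain \<iota>' z' where fail': "failing \<iota>' (2 * \<kappa> \<eta>) (g \<eta>) (w \<eta>) \<eta> z'" and div': "\<And>\<zeta>. \<iota>' \<zeta> div 2 = \<kappa> \<zeta>"
      by (auto simp: bad_def)
    have ne: "\<iota> \<eta> \<noteq> 2 * \<kappa> \<eta>" using \<iota>\<eta> by simp
    show "\<exists>r. finite (supp r) \<and> supp r \<subseteq> carrier H \<and> (\<forall>p. w \<eta> p = (\<Sum>h\<in>supp r. r h * translate h (u \<eta>) p))"
    proof (rule two_runs_conclusion[OF run _ ne w refl])
      show "run \<iota>' (2 * \<kappa> \<eta>) (g \<eta>) (w \<eta>) z'" "\<iota>' \<eta> = 2 * \<kappa> \<eta>" using fail' by (auto simp: failing_def)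
      fix \<zeta> h assume "\<zeta> \<noteq> \<eta>" "z 0 (Symbol \<zeta> (\<iota> \<zeta>), h) \<noteq> 0"
      then have "\<zeta> \<in> clash (g \<eta>) (w \<eta>) \<eta>" using fail fail' ne unfolding clash_def by blast
      then have "\<kappa> \<zeta> \<noteq> \<kappa> \<eta>" using \<kappa> \<open>\<zeta> \<noteq> \<eta>\<close> by blast
      \<comment> \<open>Both assignments give \<zeta> an option from the pair of its colour, and
        \<eta> belongs to another pair.\<close>
      then show "\<iota> \<zeta> \<noteq> \<iota> \<eta> \<and> \<iota>' \<zeta> \<noteq> \<iota> \<eta>" using div[of \<zeta>] div'[of \<zeta>] div[of \<eta>] by metis
    qed
  qed
qed

end

section \<open>Rigid groups\<close>

definition unit_vec :: "'p \<Rightarrow> 'p \<Rightarrow> rat" where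
  "unit_vec q = (\<lambda>p. if p = q then 1 else 0)"

lemma supp_unit_vec [simp]: "supp (unit_vec q) = {q}"
  by (auto simp: supp_def unit_vec_def)

lemma unit_vec_int [simp]: "unit_vec q p \<in> \<int>"
  by (simp add: unit_vec_def)

definition additive_map :: "('p \<Rightarrow> rat) set \<Rightarrow> (('p \<Rightarrow> rat) \<Rightarrow> 'p \<Rightarrow> rat) \<Rightarrow> bool" where
  "additive_map G \<phi> \<longleftrightarrow> (\<forall>x\<in>G. \<phi> x \<in> G) \<and>
     (\<forall>x\<in>G. \<forall>y\<in>G. \<phi> (\<lambda>p. x p + y p) = (\<lambda>p. \<phi> x p + \<phi> y p))"

locale integral_subgroup =
  fixes G :: "('p \<Rightarrow> rat) set"
  assumes nonempty: "G \<noteq> {}"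
    and lin: "x \<in> G \<Longrightarrow> y \<in> G \<Longrightarrow> a \<in> \<int> \<Longrightarrow> b \<in> \<int> \<Longrightarrow> (\<lambda>p. a * x p + b * y p) \<in> G"
begin

lemma zero: "(\<lambda>p. 0) \<in> G"
  using nonempty lin[of _ _ 0 0] by auto

lemma add: "x \<in> G \<Longrightarrow> y \<in> G \<Longrightarrow> (\<lambda>p. x p + y p) \<in> G"
  using lin[of x y 1 1] by simp

lemma scale: "x \<in> G \<Longrightarrow> a \<in> \<int> \<Longrightarrow> (\<lambda>p. a * x p) \<in> G"
  using lin[of x x a 0] by simp

lemma additive_map_lin:
  assumes \<phi>: "additive_map G \<phi>" and "x \<in> G" "y \<in> G" "a \<in> \<int>" "b \<in> \<int>"
  shows "\<phi> (\<lambda>p. a * x p + b * y p) = (\<lambda>p. a * \<phi> x p + b * \<phi> y p)"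
proof -
  have add\<phi>: "\<phi> (\<lambda>p. x p + y p) = (\<lambda>p. \<phi> x p + \<phi> y p)" if "x \<in> G" "y \<in> G" for x y
    using \<phi> that by (simp add: additive_map_def)
  have zero\<phi>: "\<phi> (\<lambda>p. 0) = (\<lambda>p. 0)"
    using add\<phi>[OF zero zero] by (simp add: fun_eq_iff)
  have nat: "\<phi> (\<lambda>p. of_nat n * x p) = (\<lambda>p. of_nat n * \<phi> x p)" if x: "x \<in> G" for x n
  proof (induction n)
    case (Suc n)
    have "(\<lambda>p. of_nat n * x p) \<in> G" using scale[OF x] by simp
    from add\<phi>[OF x this] Suc show ?case by (simp add: algebra_simps)
  qed (simp add: zero\<phi>)
  have neg: "\<phi> (\<lambda>p. - x p) = (\<lambda>p. - \<phi> x p)" if x: "x \<in> G" for x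
  proof -
    have "(\<lambda>p. - x p) \<in> G" using scale[OF x, of "-1"] by simp
    from add\<phi>[OF x this] zero\<phi> have "(\<lambda>p. 0) = (\<lambda>p. \<phi> x p + \<phi> (\<lambda>p. - x p) p)" by simp
    then have "\<phi> x p + \<phi> (\<lambda>p. - x p) p = 0" for p by (simp add: fun_eq_iff)
    then show ?thesis by (auto simp: fun_eq_iff add_eq_0_iff)
  qed
  have int: "\<phi> (\<lambda>p. c * x p) = (\<lambda>p. c * \<phi> x p)" if x: "x \<in> G" and "c \<in> \<int>" for x c
  proof -
    obtain k where k: "c = of_int k" using \<open>c \<in> \<int>\<close> by (auto elim: Ints_cases)
    show ?thesis
    proof (cases k)
      case (nonneg n)
      then show ?thesis using nat[OF x, of n] k by simp
    next
      case (neg n)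
      have "(\<lambda>p. of_nat (Suc n) * x p) \<in> G" by (rule scale[OF x]) (rule Ints_of_nat)
      from \<open>\<And>x. x \<in> G \<Longrightarrow> \<phi> (\<lambda>p. - x p) = (\<lambda>p. - \<phi> x p)\<close>[OF this] nat[OF x, of "Suc n"] show ?thesis
        unfolding k neg by (simp del: of_nat_Suc)
    qed
  qed
  have "\<phi> (\<lambda>p. a * x p + b * y p) = (\<lambda>p. \<phi> (\<lambda>p. a * x p) p + \<phi> (\<lambda>p. b * y p) p)"
    using assms by (intro add\<phi> scale)
  then show ?thesis using int assms by simp
qed

lemma integral_combination:
  assumes \<phi>: "additive_map G \<phi>" and "finite F"
    and F: "\<And>q. q \<in> F \<Longrightarrow> unit_vec q \<in> G"
    and "supp x \<subseteq> F" "\<And>p. x p \<in> \<int>"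
  shows "x \<in> G \<and> \<phi> x = (\<lambda>p. \<Sum>q\<in>F. x q * \<phi> (unit_vec q) p)"
  using assms(2-)
proof (induction F arbitrary: x rule: finite_induct)
  case empty
  then have "x = (\<lambda>p. 0)" by (auto simp: supp_def)
  then show ?case using zero additive_map_lin[OF \<phi> zero zero, of 0 0] by simp
next
  case (insert q F)
  define x' where "x' = x(q := 0)"
  have x': "x' \<in> G \<and> \<phi> x' = (\<lambda>p. \<Sum>q\<in>F. x' q * \<phi> (unit_vec q) p)"
    using insert.prems by (intro insert.IH) (auto simp: x'_def supp_def)
  have x: "x = (\<lambda>p. 1 * x' p + x q * unit_vec q p)" by (auto simp: x'_def unit_vec_def)
  have q: "unit_vec q \<in> G" "x q \<in> \<int>" using insert.prems by auto
  have "x \<in> G" using lin[of x' "unit_vec q" 1 "x q"] x' q x by simp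
  moreover have "\<phi> x = (\<lambda>p. \<phi> x' p + x q * \<phi> (unit_vec q) p)"
    using additive_map_lin[OF \<phi> _ q(1) Ints_1 q(2), of x'] x' x by simp
  moreover have "(\<Sum>q\<in>F. x' q * \<phi> (unit_vec q) p) = (\<Sum>q\<in>F. x q * \<phi> (unit_vec q) p)" for p
    using insert.hyps by (intro sum.cong) (auto simp: x'_def)
  ultimately show ?case using x' insert.hyps by (simp add: add.commute)
qed

end

text \<open>The interface between construction and realization; options and predictions no longer
  occur. In \<open>rigid\<close> the multiplier \<open>r\<close> may depend on \<open>e\<close> and
  take rational values, and \<open>determined\<close> carries information from the nodes to all of
  \<open>G\<close>.\<close>

locale rigid_vectors = tree_vectors H A + integral_subgroup G
  for H :: "('h, 'm) monoid_scheme" (structure) and A :: "'b set" and G :: "('b, 'h) vec set" +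
  assumes G_V: "G \<subseteq> V"
    and unit_vec_G: "t \<in> lists A \<Longrightarrow> h \<in> carrier H \<Longrightarrow> unit_vec (Node t, h) \<in> G"
    and translate_G: "h \<in> carrier H \<Longrightarrow> x \<in> G \<Longrightarrow> translate h x \<in> G"
    and bounded: "finite F \<Longrightarrow> \<exists>N::nat. N > 0 \<and> (\<forall>x p. x \<in> G \<longrightarrow> supp x \<subseteq> F \<longrightarrow> of_nat N * x p \<in> \<int>)"
    and no_symbol: "x \<in> G \<Longrightarrow> (\<And>\<zeta> i h. x (Symbol \<zeta> i, h) = 0) \<Longrightarrow> x p \<in> \<int>"
    and rigid: "additive_map G \<phi> \<Longrightarrow> finite (supp e) \<Longrightarrow> supp e \<subseteq> Node ` lists A \<times> carrier H \<Longrightarrow> (\<And>p. e p \<in> \<int>) \<Longrightarrow>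
      \<exists>r. finite (supp r) \<and> supp r \<subseteq> carrier H \<and> (\<forall>p. \<phi> e p = (\<Sum>h\<in>supp r. r h * translate h e p))"
    and determined: "additive_map G \<phi> \<Longrightarrow>
      (\<And>t h. t \<in> lists A \<Longrightarrow> h \<in> carrier H \<Longrightarrow> \<phi> (unit_vec (Node t, h)) = (\<lambda>p. 0)) \<Longrightarrow> x \<in> G \<Longrightarrow> \<phi> x = (\<lambda>p. 0)"

text \<open>The data at a branch must be a function of the branch alone: \<open>u\<close> and
  \<open>w\<close> are read from its first letter, \<open>g \<eta> n\<close> from the letter at
  \<open>n\<close>. For given \<phi> and \<open>e\<close> the predicting branch is built by
  recursion, as each letter may depend on \<phi> at the node already reached.\<close>

theorem (in tree_vectors) rigid_vectors_exist:
  fixes dec :: "'b \<Rightarrow> ('b, 'h) vec \<times> ('b, 'h) vec \<times> ('b, 'h) vec"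
  assumes dec: "V \<times> V \<times> V \<subseteq> dec ` A"
  shows "\<exists>G. rigid_vectors H A G"
proof -
  define B where "B = {e :: ('b, 'h) vec. finite (supp e) \<and> supp e \<subseteq> Node ` lists A \<times> carrier H \<and> (\<forall>p. e p \<in> \<int>)}"
  \<comment> \<open>Letters that do not decode to an integral node vector get \<open>u = 0\<close>,
    so that the locale assumptions hold at every branch.\<close>
  define u where "u \<eta> = (let e = fst (dec (\<eta> 0)) in if e \<in> B then e else (\<lambda>p. 0))" for \<eta> :: "nat \<Rightarrow> 'b"
  define w where "w \<eta> = fst (snd (dec (\<eta> 0)))" for \<eta> :: "nat \<Rightarrow> 'b"
  define g where "g \<eta> n = snd (snd (dec (\<eta> n)))" for \<eta> :: "nat \<Rightarrow> 'b" and n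
  have "(\<lambda>p. 0) \<in> B" by (simp add: B_def supp_def)
  then have uB: "u \<eta> \<in> B" for \<eta> by (simp add: u_def Let_def)
  interpret twisted_tree H A u
    by unfold_locales (use uB in \<open>auto simp: B_def\<close>)
  obtain \<iota> where \<iota>: "\<And>\<eta> z. run \<iota> (\<iota> \<eta>) (g \<eta>) (w \<eta>) z \<Longrightarrow> w \<eta> \<in> option_group \<iota> \<Longrightarrow>
    \<exists>r. finite (supp r) \<and> supp r \<subseteq> carrier H \<and> (\<forall>p. w \<eta> p = (\<Sum>h\<in>supp r. r h * translate h (u \<eta>) p))"
    using options_exist[of g w] by blast
  define G where "G = option_group \<iota>"
  have GV: "G \<subseteq> V" by (auto simp: G_def option_group_def tree_group_def)
  have int_G: "x \<in> G" if "finite (supp x)" "supp x \<subseteq> idxs" "\<And>p. x p \<in> \<int>" "\<And>\<zeta> i h. x (Symbol \<zeta> i, h) \<noteq> 0 \<Longrightarrow> i = \<iota> \<zeta>" for x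
    using that integral_in_tree_group[of x] by (auto simp: G_def option_group_def V_def)
  have B_G: "B \<subseteq> G"
  proof
    fix e assume e: "e \<in> B"
    show "e \<in> G"
    proof (rule int_G)
      show "i = \<iota> \<zeta>" if "e (Symbol \<zeta> i, h) \<noteq> 0" for \<zeta> i h using e that by (auto simp: B_def supp_def)
    qed (use e in \<open>auto simp: B_def idxs_def\<close>)
  qed
  have svB: "unit_vec (Node t, h) \<in> B" if "t \<in> lists A" "h \<in> carrier H" for t h
    unfolding B_def using that by simp
  interpret integral_subgroup G
  proof
    show "G \<noteq> {}" using B_G uB by blast
  qed (simp add: G_def option_group_lin)
  have one: "\<one> \<in> carrier H" by simp
  have y_G: "y k \<zeta> (\<iota> \<zeta>) h \<in> G" if "range \<zeta> \<subseteq> A" "h \<in> carrier H" for k \<zeta> h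
    using y_option_group that by (simp add: G_def)
  have d_B: "d k \<zeta> i h \<in> B" if "range \<zeta> \<subseteq> A" "h \<in> carrier H" for k \<zeta> i h
  proof -
    have "d k \<zeta> i h \<in> V" using d_V that by simp
    moreover have "supp (d k \<zeta> i h) \<subseteq> Node ` lists A \<times> carrier H" if "supp (d k \<zeta> i h) \<subseteq> idxs"
    proof
      fix q assume q: "q \<in> supp (d k \<zeta> i h)"
      then have "q \<in> idxs" using that by blast
      then show "q \<in> Node ` lists A \<times> carrier H" using q by (auto simp: idxs_def supp_def)
    qed
    ultimately show ?thesis by (auto simp: B_def V_def d_int)
  qed
  have y_step: "\<phi> (y k \<zeta> (\<iota> \<zeta>) h) = (\<lambda>p. \<phi> (d k \<zeta> (\<iota> \<zeta>) h) p + of_nat (Suc k) * \<phi> (y (Suc k) \<zeta> (\<iota> \<zeta>) h) p)"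
    if "additive_map G \<phi>" "range \<zeta> \<subseteq> A" "h \<in> carrier H" for \<phi> k \<zeta> h
  proof -
    have "y k \<zeta> (\<iota> \<zeta>) h = (\<lambda>p. 1 * d k \<zeta> (\<iota> \<zeta>) h p + of_nat (Suc k) * y (Suc k) \<zeta> (\<iota> \<zeta>) h p)"
      unfolding mult_1 by (rule ext, rule y_rec)
    moreover have "\<phi> (\<lambda>p. 1 * d k \<zeta> (\<iota> \<zeta>) h p + of_nat (Suc k) * y (Suc k) \<zeta> (\<iota> \<zeta>) h p)
        = (\<lambda>p. 1 * \<phi> (d k \<zeta> (\<iota> \<zeta>) h) p + of_nat (Suc k) * \<phi> (y (Suc k) \<zeta> (\<iota> \<zeta>) h) p)"
      using that B_G d_B[OF that(2,3)] y_G by (intro additive_map_lin) (auto simp del: of_nat_Suc)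
    ultimately show ?thesis by (simp del: of_nat_Suc)
  qed
  have bounded: "\<exists>N::nat. N > 0 \<and> (\<forall>x p. x \<in> G \<longrightarrow> supp x \<subseteq> F \<longrightarrow> of_nat N * x p \<in> \<int>)" if "finite F" for F
    using option_group_bounded_denominator[OF that, of \<iota>] unfolding G_def by metis
  have "rigid_vectors H A G"
  proof unfold_locales
    show "G \<subseteq> V" by (rule GV)
    show "unit_vec (Node t, h) \<in> G" if "t \<in> lists A" "h \<in> carrier H" for t h
      using svB[OF that] B_G by blast
    show "translate h x \<in> G" if "h \<in> carrier H" "x \<in> G" for h x
      using that translate_option_group by (simp add: G_def)
    show "\<exists>N::nat. N > 0 \<and> (\<forall>x p. x \<in> G \<longrightarrow> supp x \<subseteq> F \<longrightarrow> of_nat N * x p \<in> \<int>)" if "finite F" for F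
      by (rule bounded[OF that])
    show "x p \<in> \<int>" if "x \<in> G" "\<And>\<zeta> i h. x (Symbol \<zeta> i, h) = 0" for x p
      using that tree_group_no_symbol_int by (auto simp: G_def option_group_def)
  next
    fix \<phi> :: "('b, 'h) vec \<Rightarrow> ('b, 'h) vec" and e :: "('b, 'h) vec"
    assume \<phi>: "additive_map G \<phi>" and "finite (supp e)" "supp e \<subseteq> Node ` lists A \<times> carrier H" "\<And>p. e p \<in> \<int>"
    then have e: "e \<in> B" by (auto simp: B_def)
    then have eG: "e \<in> G" "\<phi> e \<in> G" using B_G \<phi> by (auto simp: additive_map_def)
    define cd where "cd t = (SOME a. a \<in> A \<and> dec a = (e, \<phi> e, \<phi> (unit_vec (Node t, \<one>))))" for t
    have cd: "cd t \<in> A \<and> dec (cd t) = (e, \<phi> e, \<phi> (unit_vec (Node t, \<one>)))" if "t \<in> lists A" for t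
    proof -
      have "\<phi> (unit_vec (Node t, \<one>)) \<in> G" using svB[OF that one] B_G \<phi> by (auto simp: additive_map_def)
      then have "(e, \<phi> e, \<phi> (unit_vec (Node t, \<one>))) \<in> dec ` A" using dec GV eG by blast
      then have "\<exists>a. a \<in> A \<and> dec a = (e, \<phi> e, \<phi> (unit_vec (Node t, \<one>)))" by auto
      then show ?thesis unfolding cd_def by (rule someI_ex)
    qed
    define path where "path = rec_nat [] (\<lambda>_ t. t @ [cd t])"
    define \<eta> where "\<eta> n = cd (path n)" for n
    have path: "path 0 = []" "path (Suc n) = path n @ [\<eta> n]" for n
      by (simp_all add: path_def \<eta>_def)
    have branch: "branch \<eta> n = path n" for n
      by (induction n) (simp_all add: branch_def path)
    have lists: "path n \<in> lists A" for n
    proof (induction n)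
      case (Suc n)
      then show ?case using cd[OF Suc] by (simp add: path \<eta>_def)
    qed (simp add: path)
    have \<eta>: "range \<eta> \<subseteq> A" using cd lists by (auto simp: \<eta>_def)
    have decs: "dec (\<eta> n) = (e, \<phi> e, \<phi> (unit_vec (Node (branch \<eta> n), \<one>)))" for n
      using cd[OF lists] by (simp add: \<eta>_def branch)
    have u: "u \<eta> = e" and w: "w \<eta> = \<phi> e" and g: "g \<eta> n = \<phi> (unit_vec (Node (branch \<eta> n), \<one>))" for n
      using e by (simp_all add: u_def w_def g_def decs)
    have tr1: "translate \<one> e = e"
    proof
      fix p :: "'b idx \<times> 'h"
      obtain j f where p: "p = (j, f)" by force
      have "e p = 0" if "f \<notin> carrier H" using e that by (auto simp: p B_def supp_def)
      then show "translate \<one> e p = e p" by (auto simp: translate_def p)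
    qed
    define z where "z k = \<phi> (y k \<eta> (\<iota> \<eta>) \<one>)" for k
    have "run \<iota> (\<iota> \<eta>) (g \<eta>) (w \<eta>) z"
      unfolding run_def
    proof (intro conjI allI)
      show "z k \<in> option_group \<iota>" for k
        using \<phi> y_G[OF \<eta> one] by (simp add: z_def additive_map_def G_def)
      fix k p
      have "d k \<eta> (\<iota> \<eta>) \<one> = (\<lambda>p. 1 * unit_vec (Node (branch \<eta> k), \<one>) p + (if level_option k = \<iota> \<eta> then 1 else 0) * e p)"
        by (auto simp: d_def unit_vec_def u tr1)
      moreover have "\<phi> (\<lambda>p. 1 * unit_vec (Node (branch \<eta> k), \<one>) p + (if level_option k = \<iota> \<eta> then 1 else 0) * e p)
        = (\<lambda>p. 1 * \<phi> (unit_vec (Node (branch \<eta> k), \<one>)) p + (if level_option k = \<iota> \<eta> then 1 else 0) * \<phi> e p)"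
        using \<phi> eG svB[OF lists one] B_G by (intro additive_map_lin) (auto simp: branch)
      ultimately show "z k p = g \<eta> k p + (if level_option k = \<iota> \<eta> then w \<eta> p else 0) + of_nat (Suc k) * z (Suc k) p"
        unfolding z_def y_step[OF \<phi> \<eta> one, of k] g w by (simp del: of_nat_Suc)
    qed
    from \<iota>[OF this] eG show "\<exists>r. finite (supp r) \<and> supp r \<subseteq> carrier H \<and> (\<forall>p. \<phi> e p = (\<Sum>h\<in>supp r. r h * translate h e p))"
      by (simp add: w u G_def)
  next
    fix \<phi> :: "('b, 'h) vec \<Rightarrow> ('b, 'h) vec" and x
    assume \<phi>: "additive_map G \<phi>"
      and 0: "\<And>t h. t \<in> lists A \<Longrightarrow> h \<in> carrier H \<Longrightarrow> \<phi> (unit_vec (Node t, h)) = (\<lambda>p. 0)"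
      and x: "x \<in> G"
    have B0: "\<phi> e = (\<lambda>p. 0)" if e: "e \<in> B" for e
    proof -
      have e': "finite (supp e)" "supp e \<subseteq> Node ` lists A \<times> carrier H" "\<And>p. e p \<in> \<int>" using e by (auto simp: B_def)
      have "\<phi> e = (\<lambda>p. \<Sum>q\<in>supp e. e q * \<phi> (unit_vec q) p)"
        using integral_combination[OF \<phi> e'(1) _ order_refl e'(3)] e'(2) svB B_G by blast
      moreover have "\<phi> (unit_vec q) p = 0" if "q \<in> supp e" for q p using subsetD[OF e'(2) that] 0 by (auto simp: lists_eq_set)
      ultimately show ?thesis by simp
    qed
    \<comment> \<open>Since \<phi> kills \<open>d k\<close>, the images \<open>a k\<close> of
      \<open>y k\<close> satisfy \<open>a k = (k+1) * a (k+1)\<close> and share one finite support;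
      bounded denominators leave only 0.\<close>
    have Y0: "\<phi> (unit_vec (Symbol \<zeta> (\<iota> \<zeta>), h)) = (\<lambda>p. 0)" and YG: "unit_vec (Symbol \<zeta> (\<iota> \<zeta>), h) \<in> G" if \<zeta>: "range \<zeta> \<subseteq> A" "h \<in> carrier H" for \<zeta> h
    proof -
      have y0: "y 0 \<zeta> (\<iota> \<zeta>) h = unit_vec (Symbol \<zeta> (\<iota> \<zeta>), h)" by (auto simp: y_def unit_vec_def)
      then show "unit_vec (Symbol \<zeta> (\<iota> \<zeta>), h) \<in> G" using y_G[OF \<zeta>, of 0] by simp
      define a where "a k = \<phi> (y k \<zeta> (\<iota> \<zeta>) h)" for k
      have rec: "a k = (\<lambda>p. of_nat (Suc k) * a (Suc k) p)" for k
        unfolding a_def y_step[OF \<phi> \<zeta>, of k] B0[OF d_B[OF \<zeta>]] by (simp del: of_nat_Suc)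
      have aG: "a k \<in> G" for k using \<phi> y_G[OF \<zeta>] by (simp add: a_def additive_map_def)
      have supp: "supp (a k) = supp (a 0)" for k
      proof (induction k)
        case (Suc k)
        then show ?case using rec[of k] by (simp add: supp_def del: of_nat_Suc)
      qed simp
      have "finite (supp (a 0))" using aG[of 0] by (simp add: G_def option_group_fin)
      then obtain N :: nat where N: "N > 0" "\<And>x p. x \<in> G \<Longrightarrow> supp x \<subseteq> supp (a 0) \<Longrightarrow> of_nat N * x p \<in> \<int>"
        using bounded by blast
      have "a 0 p = 0" for p
      proof -
        obtain M where M: "\<And>k. k \<ge> M \<Longrightarrow> of_nat N * a k p = 0 \<and> (0::rat) = 0"
        proof (rule factorial_recurrence_eventually_zero[of "\<lambda>k. of_nat N * a k p" "\<lambda>k. 0" 0])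
          show "of_nat N * a k p \<in> \<int>" for k by (rule N(2)[OF aG equalityD1[OF supp]])
          show "of_nat N * a k p = 0 + of_nat (Suc k) * (of_nat N * a (Suc k) p)" for k
            using fun_cong[OF rec[of k], of p] by (simp del: of_nat_Suc)
        qed auto
        have "a M p = 0" using M[of M] N(1) by simp
        then have "p \<notin> supp (a M)" by (simp add: supp_def)
        then have "p \<notin> supp (a 0)" using supp[of M] by blast
        then show ?thesis by (simp add: supp_def)
      qed
      then show "\<phi> (unit_vec (Symbol \<zeta> (\<iota> \<zeta>), h)) = (\<lambda>p. 0)" unfolding a_def y0 by blast
    qed
    have fin: "finite (supp x)" using x by (simp add: G_def option_group_fin)
    \<comment> \<open>Only a multiple of \<open>x\<close> is an integral combination of nodes and
      symbols.\<close>
    obtain N :: nat where N: "N > 0" "\<And>p. of_nat N * x p \<in> \<int>" using bounded[OF fin] x by blast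
    have "unit_vec q \<in> G \<and> \<phi> (unit_vec q) = (\<lambda>p. 0)" if "q \<in> supp x" for q
    proof -
      have "q \<in> idxs" using x GV that by (auto simp: V_def)
      then consider t h where "t \<in> lists A" "h \<in> carrier H" "q = (Node t, h)"
        | \<zeta> i h where "range \<zeta> \<subseteq> A" "h \<in> carrier H" "q = (Symbol \<zeta> i, h)" by (auto simp: idxs_def)
      then show ?thesis
      proof cases
        case 1
        then show ?thesis using 0 svB B_G by blast
      next
        case 2
        then have "i = \<iota> \<zeta>" using x that by (auto simp: G_def option_group_def supp_def)
        then show ?thesis using Y0 YG 2 by blast
      qed
    qed
    then have "\<phi> (\<lambda>p. of_nat N * x p) = (\<lambda>p. 0)"
      using integral_combination[OF \<phi> fin, of "\<lambda>p. of_nat N * x p"] N(2) by (auto simp: supp_def)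
    moreover have "\<phi> (\<lambda>p. of_nat N * x p + 0 * x p) = (\<lambda>p. of_nat N * \<phi> x p + 0 * \<phi> x p)"
      using additive_map_lin[OF \<phi> x x Ints_of_nat Ints_0] .
    ultimately show "\<phi> x = (\<lambda>p. 0)" using N(1) by (simp add: fun_eq_iff)
  qed
  then show ?thesis by blast
qed

section \<open>Units, lexicographic orders and freeness\<close>

lemma finite_strict_linear_order_max:
  assumes "finite P" "P \<noteq> {}" "P \<subseteq> C" "strict_linear_order_on C R"
  shows "\<exists>m\<in>P. \<forall>x\<in>P. x = m \<or> (x, m) \<in> R"
  using assms(1-3)
proof (induction P rule: finite_ne_induct)
  case (insert a P)
  then obtain m where m: "m \<in> P" "\<forall>x\<in>P. x = m \<or> (x, m) \<in> R" by auto
  have trans: "trans R" and total: "total_on C R"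
    using assms(4) by (auto simp: strict_linear_order_on_def)
  have "a = m \<or> (a, m) \<in> R \<or> (m, a) \<in> R"
    using total insert.prems m(1) unfolding total_on_def by blast
  then show ?case
  proof (elim disjE)
    assume "(m, a) \<in> R"
    then have "\<forall>x\<in>P. (x, a) \<in> R" using m(2) trans by (auto dest: transD)
    then show ?thesis by auto
  qed (use m in auto)
qed simp

section \<open>Units of the group ring of a right ordered group\<close>

lemma right_ordered_group_converse:
  "right_ordered_group H R \<Longrightarrow> right_ordered_group H (R\<inverse>)"
  by (auto simp: right_ordered_group_def strict_linear_order_on_def irrefl_def)

text \<open>Right multiplication is monotone, so with \<open>k\<close> largest in
  \<open>supp r\<close> the largest product of all has the form \<open>k \<otimes> b\<close>. Left
  multiplication need not be monotone, hence \<open>b\<close> is chosen by comparing the products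
  and not the factors. This product arises from one pair only, so its coefficient cannot cancel and
  it must be \<open>\<one>\<close>.\<close>

lemma (in group) unit_extreme_factors:
  assumes R: "right_ordered_group G R"
    and r: "finite (supp r)" "supp r \<subseteq> carrier G" and s: "finite (supp s)" "supp s \<subseteq> carrier G"
    and unit: "\<And>f. f \<in> carrier G \<Longrightarrow> (\<Sum>k\<in>supp r. r k * s (inv k \<otimes> f)) = (if f = \<one> then 1 else 0)"
  obtains k b where "k \<in> supp r" "b \<in> supp s" "k \<otimes> b = \<one>"
    "\<And>k'. k' \<in> supp r \<Longrightarrow> k' = k \<or> (k', k) \<in> R" "\<And>b'. b' \<in> supp s \<Longrightarrow> k \<otimes> b' = \<one> \<or> (k \<otimes> b', \<one>) \<in> R"
proof -
  have lin: "strict_linear_order_on (carrier G) R"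
    and mono: "\<And>h g k. (h, g) \<in> R \<Longrightarrow> h \<in> carrier G \<Longrightarrow> g \<in> carrier G \<Longrightarrow> k \<in> carrier G \<Longrightarrow> (h \<otimes> k, g \<otimes> k) \<in> R"
    using R by (auto simp: right_ordered_group_def)
  have trans: "trans R" and irrefl: "\<And>x. (x, x) \<notin> R"
    using lin by (auto simp: strict_linear_order_on_def irrefl_def)
  have "(\<Sum>k\<in>supp r. r k * s (inv k \<otimes> \<one>)) \<noteq> 0" using unit[of \<one>] by simp
  then obtain k0 where "k0 \<in> supp r" "r k0 * s (inv k0 \<otimes> \<one>) \<noteq> 0" by (meson sum.neutral)
  then have ne: "supp r \<noteq> {}" "supp s \<noteq> {}" by (auto simp: supp_def)
  obtain k where k: "k \<in> supp r" "\<And>k'. k' \<in> supp r \<Longrightarrow> k' = k \<or> (k', k) \<in> R"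
    using finite_strict_linear_order_max[OF r(1) ne(1) r(2) lin] by blast
  have kc: "k \<in> carrier G" using k r by auto
  have "\<exists>m\<in>(\<otimes>) k ` supp s. \<forall>x\<in>(\<otimes>) k ` supp s. x = m \<or> (x, m) \<in> R"
    using s ne kc by (intro finite_strict_linear_order_max[OF _ _ _ lin]) auto
  then obtain b where b: "b \<in> supp s" "\<And>b'. b' \<in> supp s \<Longrightarrow> k \<otimes> b' = k \<otimes> b \<or> (k \<otimes> b', k \<otimes> b) \<in> R"
    by auto
  have bc: "b \<in> carrier G" using b s by auto
  have "(\<Sum>k'\<in>supp r. r k' * s (inv k' \<otimes> (k \<otimes> b))) = (\<Sum>k'\<in>{k}. r k' * s (inv k' \<otimes> (k \<otimes> b)))"
  proof (rule sum.mono_neutral_right[OF r(1)])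
    show "\<forall>k'\<in>supp r - {k}. r k' * s (inv k' \<otimes> (k \<otimes> b)) = 0"
    proof
      fix k' assume k': "k' \<in> supp r - {k}"
      have k'c: "k' \<in> carrier G" using k' r by auto
      show "r k' * s (inv k' \<otimes> (k \<otimes> b)) = 0"
      proof (rule ccontr)
        assume nz: "r k' * s (inv k' \<otimes> (k \<otimes> b)) \<noteq> 0"
        define b' where "b' = inv k' \<otimes> (k \<otimes> b)"
        have b': "b' \<in> supp s" "b' \<in> carrier G" using nz k'c kc bc by (auto simp: b'_def supp_def)
        have eq: "k' \<otimes> b' = k \<otimes> b" using k'c kc bc by (simp add: b'_def m_assoc[symmetric])
        have "(k', k) \<in> R" using k(2) k' by auto
        then have "(k \<otimes> b, k \<otimes> b') \<in> R" using mono[of k' k b'] k'c kc b' eq by simp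
        then show False using b(2)[OF b'(1)] irrefl trans by (metis transD)
      qed
    qed
  qed (use k in auto)
  also have "\<dots> = r k * s b" using kc bc by (simp add: m_assoc[symmetric])
  finally have "(if k \<otimes> b = \<one> then 1 else 0) = r k * s b" using unit[of "k \<otimes> b"] kc bc by simp
  moreover have "r k * s b \<noteq> 0" using k(1) b(1) by (simp add: supp_def)
  ultimately have "k \<otimes> b = \<one>" by (auto split: if_splits)
  then show ?thesis using that k b by metis
qed

text \<open>The extreme factors are taken for the order and its converse, giving \<open>k\<close>
  largest and \<open>l\<close> smallest in \<open>supp r\<close>. Some \<open>b\<close> has
  \<open>k \<otimes> b = \<one>\<close> while \<open>l \<otimes> b\<close> is not below
  \<open>\<one>\<close>, so \<open>l\<close> is not below \<open>k\<close>.\<close>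

lemma (in group) unit_trivial:
  assumes R: "right_ordered_group G R"
    and r: "finite (supp r)" "supp r \<subseteq> carrier G" and s: "finite (supp s)" "supp s \<subseteq> carrier G"
    and unit: "\<And>f. f \<in> carrier G \<Longrightarrow> (\<Sum>k\<in>supp r. r k * s (inv k \<otimes> f)) = (if f = \<one> then 1 else 0)"
  obtains a where "a \<in> carrier G" "supp r = {a}"
proof -
  obtain k b where k: "k \<in> supp r" "b \<in> supp s" "k \<otimes> b = \<one>"
    "\<And>k'. k' \<in> supp r \<Longrightarrow> k' = k \<or> (k', k) \<in> R"
    using unit_extreme_factors[OF R r s unit] by metis
  obtain l where l: "l \<in> supp r" "\<And>k'. k' \<in> supp r \<Longrightarrow> k' = l \<or> (l, k') \<in> R"
    "\<And>b'. b' \<in> supp s \<Longrightarrow> l \<otimes> b' = \<one> \<or> (\<one>, l \<otimes> b') \<in> R"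
    using unit_extreme_factors[OF right_ordered_group_converse[OF R] r s unit] by (metis converse_iff)
  have irrefl: "\<And>x. (x, x) \<notin> R" and trans: "trans R"
    and mono: "\<And>h g k. (h, g) \<in> R \<Longrightarrow> h \<in> carrier G \<Longrightarrow> g \<in> carrier G \<Longrightarrow> k \<in> carrier G \<Longrightarrow> (h \<otimes> k, g \<otimes> k) \<in> R"
    using R by (auto simp: right_ordered_group_def strict_linear_order_on_def irrefl_def)
  have "l = k"
  proof (rule ccontr)
    assume "l \<noteq> k"
    then have "(l, k) \<in> R" using k(4) l(1) by auto
    then have "(l \<otimes> b, \<one>) \<in> R" using mono[of l k b] k l r s by (metis subsetD)
    then show False using l(3)[OF k(2)] irrefl trans by (metis transD)
  qed
  then have "x = k" if "x \<in> supp r" for x using k(4)[OF that] l(2)[OF that] irrefl trans by (metis transD)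
  then have "supp r = {k}" using k(1) by blast
  then show ?thesis using that k r by auto
qed

section \<open>Lexicographic orders on groups of vectors\<close>

definition vector_group :: "('p \<Rightarrow> rat) set \<Rightarrow> ('p \<Rightarrow> rat) monoid" where
  "vector_group G = \<lparr>carrier = G, monoid.mult = (\<lambda>x y p. x p + y p), one = (\<lambda>p. 0)\<rparr>"

lemma vector_group_simps [simp]:
  "carrier (vector_group G) = G" "x \<otimes>\<^bsub>vector_group G\<^esub> y = (\<lambda>p. x p + y p)" "\<one>\<^bsub>vector_group G\<^esub> = (\<lambda>p. 0)"
  by (simp_all add: vector_group_def)

lemma (in integral_subgroup) comm_group_vector_group: "comm_group (vector_group G)"
proof (rule comm_groupI)
  show "\<exists>y\<in>carrier (vector_group G). y \<otimes>\<^bsub>vector_group G\<^esub> x = \<one>\<^bsub>vector_group G\<^esub>" if "x \<in> carrier (vector_group G)" for x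
    using that scale[of x "-1"] by (intro bexI[of _ "\<lambda>p. - x p"]) auto
qed (auto simp: add zero add.assoc add.commute)

definition lex_positive :: "'p rel \<Rightarrow> ('p \<Rightarrow> rat) \<Rightarrow> bool" where
  "lex_positive L x \<longleftrightarrow> (\<exists>p. x p > 0 \<and> (\<forall>q\<in>supp x. q = p \<or> (q, p) \<in> L))"

lemma lex_positive_add:
  assumes L: "strict_linear_order_on C L" and C: "supp x \<subseteq> C" "supp y \<subseteq> C"
    and "lex_positive L x" "lex_positive L y"
  shows "lex_positive L (\<lambda>p. x p + y p)"
proof -
  obtain p q where p: "x p > 0" "\<And>s. s \<in> supp x \<Longrightarrow> s = p \<or> (s, p) \<in> L"
    and q: "y q > 0" "\<And>s. s \<in> supp y \<Longrightarrow> s = q \<or> (s, q) \<in> L"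
    using assms by (auto simp: lex_positive_def)
  have trans: "trans L" and irrefl: "\<And>x. (x, x) \<notin> L" and total: "total_on C L"
    using L by (auto simp: strict_linear_order_on_def irrefl_def)
  have pq: "p \<in> C" "q \<in> C" using C p q by (auto simp: supp_def)
  have s: "s \<in> supp x \<or> s \<in> supp y" if "s \<in> supp (\<lambda>p. x p + y p)" for s
    using that by (auto simp: supp_def)
  consider "p = q" | "(p, q) \<in> L" | "(q, p) \<in> L"
    using total pq unfolding total_on_def by blast
  then show ?thesis
  proof cases
    case 1
    then show ?thesis unfolding lex_positive_def using p q s by (intro exI[of _ p]) auto
  next
    case 2
    then have "q \<notin> supp x" using p(2)[of q] irrefl trans by (metis transD)
    then have "x q + y q > 0" using q(1) by (simp add: supp_def)
    moreover have "s = q \<or> (s, q) \<in> L" if "s \<in> supp (\<lambda>p. x p + y p)" for s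
      using s[OF that] p(2)[of s] q(2)[of s] 2 trans by (metis transD)
    ultimately show ?thesis unfolding lex_positive_def by blast
  next
    case 3
    then have "p \<notin> supp y" using q(2)[of p] irrefl trans by (metis transD)
    then have "x p + y p > 0" using p(1) by (simp add: supp_def)
    moreover have "s = p \<or> (s, p) \<in> L" if "s \<in> supp (\<lambda>p. x p + y p)" for s
      using s[OF that] p(2)[of s] q(2)[of s] 3 trans by (metis transD)
    ultimately show ?thesis unfolding lex_positive_def by blast
  qed
qed

lemma lex_positive_total:
  assumes L: "strict_linear_order_on C L" and x: "finite (supp x)" "supp x \<subseteq> C" and "x \<noteq> (\<lambda>p. 0)"
  shows "lex_positive L x \<or> lex_positive L (\<lambda>p. - x p)"
proof -
  have "supp x \<noteq> {}" using assms(4) by (auto simp: supp_def)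
  then obtain m where m: "m \<in> supp x" "\<forall>q\<in>supp x. q = m \<or> (q, m) \<in> L"
    using finite_strict_linear_order_max[OF x(1) _ x(2) L] by blast
  have "supp (\<lambda>p. - x p) = supp x" by (simp add: supp_def)
  moreover have "x m > 0 \<or> - x m > 0" using m(1) by (auto simp: supp_def)
  ultimately show ?thesis using m(2) by (auto simp: lex_positive_def)
qed

definition lex_less :: "'p rel \<Rightarrow> ('p \<Rightarrow> rat) set \<Rightarrow> ('p \<Rightarrow> rat) rel" where
  "lex_less L G = {(x, y). x \<in> G \<and> y \<in> G \<and> lex_positive L (\<lambda>p. y p - x p)}"

lemma (in integral_subgroup) ordered_vector_group:
  assumes L: "strict_linear_order_on C L" and G: "\<And>x. x \<in> G \<Longrightarrow> finite (supp x) \<and> supp x \<subseteq> C"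
  shows "ordered_abelian_group (vector_group G) (lex_less L G)"
proof -
  have diff: "(\<lambda>p. y p - x p) \<in> G" if "x \<in> G" "y \<in> G" for x y
    using lin[OF that(2,1), of 1 "-1"] by simp
  have "trans (lex_less L G)"
  proof (rule transI)
    fix x y z assume xyz: "(x, y) \<in> lex_less L G" "(y, z) \<in> lex_less L G"
    then have "lex_positive L (\<lambda>p. (y p - x p) + (z p - y p))"
      using G diff by (intro lex_positive_add[OF L]) (auto simp: lex_less_def)
    then show "(x, z) \<in> lex_less L G" using xyz by (simp add: lex_less_def)
  qed
  moreover have "irrefl (lex_less L G)" by (auto simp: irrefl_def lex_less_def lex_positive_def)
  moreover have "total_on G (lex_less L G)"
  proof (rule total_onI)
    fix x y assume xy: "x \<in> G" "y \<in> G" "x \<noteq> y"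
    then have "(\<lambda>p. y p - x p) \<noteq> (\<lambda>p. 0)" by (metis eq_iff_diff_eq_0 ext)
    then have "lex_positive L (\<lambda>p. y p - x p) \<or> lex_positive L (\<lambda>p. - (y p - x p))"
      using G[OF diff] xy by (intro lex_positive_total[OF L]) auto
    then show "(x, y) \<in> lex_less L G \<or> (y, x) \<in> lex_less L G" using xy by (simp add: lex_less_def)
  qed
  ultimately show ?thesis
    unfolding ordered_abelian_group_def strict_linear_order_on_def
    using comm_group_vector_group add by (auto simp: lex_less_def)
qed

section \<open>Freeness of groups with countable support\<close>

lemma (in integral_subgroup) sum_closed:
  assumes "finite F" "\<And>s. s \<in> F \<Longrightarrow> f s \<in> G" "\<And>s. a s \<in> \<int>"
  shows "(\<lambda>p. \<Sum>s\<in>F. a s * f s p) \<in> G"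
  using assms(1,2)
proof (induction F rule: finite_induct)
  case (insert s F)
  then have "(\<lambda>p. a s * f s p + 1 * (\<Sum>s\<in>F. a s * f s p)) \<in> G" using assms(3) by (intro lin) auto
  then show ?case using insert by simp
qed (simp add: zero)

text \<open>Enumerate the coordinates. Bounded denominators make the leading coefficients at each coordinate
  a cyclic group, and vectors with generating leading coefficients form a basis.\<close>

lemma (in integral_subgroup) free_vector_group:
  fixes \<kappa> :: "'c \<Rightarrow> 'p \<Rightarrow> rat"
  assumes \<kappa>: "bij_betw \<kappa> M G" and cnt: "countable (\<Union>x\<in>G. supp x)" and fin: "\<And>x. x \<in> G \<Longrightarrow> finite (supp x)"
    and bounded: "\<And>F. finite F \<Longrightarrow> \<exists>N::nat. N > 0 \<and> (\<forall>x p. x \<in> G \<longrightarrow> supp x \<subseteq> F \<longrightarrow> of_nat N * x p \<in> \<int>)"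
  shows "\<exists>S :: 'c set. free_Abelian_group S \<cong> vector_group G"
proof -
  define P where "P = (\<Union>x\<in>G. supp x)"
  define \<tau> where "\<tau> = to_nat_on P"
  have inj: "p = q" if "p \<in> P" "q \<in> P" "\<tau> p = \<tau> q" for p q
    using that inj_on_to_nat_on[OF cnt] by (auto simp: P_def \<tau>_def inj_on_def)
  define D where "D p = {q \<in> P. \<tau> q \<le> \<tau> p}" for p
  have finD: "finite (D p)" for p
  proof (rule inj_on_finite[of \<tau> _ "{..\<tau> p}"])
    show "inj_on \<tau> (D p)" using inj by (auto simp: inj_on_def D_def)
  qed (auto simp: D_def)
  define lead where "lead x p \<longleftrightarrow> x \<in> G \<and> supp x \<subseteq> D p \<and> x p \<noteq> 0" for x p
  define I where "I = {p. \<exists>x. lead x p}"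
  have "\<exists>b. lead b p \<and> (\<forall>x\<in>G. supp x \<subseteq> D p \<longrightarrow> (\<exists>m::int. x p = of_int m * b p))" if p: "p \<in> I" for p
  proof -
    obtain N :: nat where N: "N > 0" "\<And>x q. x \<in> G \<Longrightarrow> supp x \<subseteq> D p \<Longrightarrow> of_nat N * x q \<in> \<int>"
      using bounded[OF finD[of p]] by blast
    \<comment> \<open>Numerators, over the common denominator \<open>N\<close>, of the positive
      leading coefficients at \<open>p\<close>; the least one generates all.\<close>
    define J where "J n \<longleftrightarrow> n > 0 \<and> (\<exists>x\<in>G. supp x \<subseteq> D p \<and> of_nat N * x p = of_nat n)" for n :: nat
    have "\<exists>n. J n"
    proof -
      obtain x where x: "x \<in> G" "supp x \<subseteq> D p" "x p \<noteq> 0" using p by (auto simp: I_def lead_def)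
      then obtain k where k: "of_nat N * x p = of_int k" using N(2) by (meson Ints_cases)
      have "k \<noteq> 0" using x(3) N(1) k by (metis less_irrefl mult_eq_0_iff of_int_0 of_nat_eq_0_iff)
      define x' where "x' = (\<lambda>q. of_int (sgn k) * x q)"
      have "x' \<in> G" unfolding x'_def by (rule scale[OF x(1)]) simp
      moreover have "supp x' \<subseteq> D p" using x(2) by (auto simp: x'_def supp_def)
      moreover have "of_nat N * x' p = of_nat (nat \<bar>k\<bar>)"
      proof -
        have "of_nat N * x' p = of_int (sgn k) * (of_nat N * x p)" by (simp add: x'_def)
        also have "\<dots> = of_int (sgn k * k)" unfolding k by simp
        also have "sgn k * k = int (nat \<bar>k\<bar>)" by (simp add: sgn_if)
        finally show ?thesis by simp
      qed
      ultimately show ?thesis using \<open>k \<noteq> 0\<close> unfolding J_def by (intro exI[of _ "nat \<bar>k\<bar>"]) auto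
    qed
    then have J: "J (LEAST n. J n)" by (rule LeastI_ex)
    define n where "n = (LEAST n. J n)"
    obtain b where b: "b \<in> G" "supp b \<subseteq> D p" "of_nat N * b p = of_nat n" "n > 0"
      using J by (auto simp: J_def n_def)
    have min: "n \<le> l" if "J l" for l using that by (simp add: n_def Least_le)
    have "\<exists>m::int. x p = of_int m * b p" if x: "x \<in> G" "supp x \<subseteq> D p" for x
    proof -
      obtain k where k: "of_nat N * x p = of_int k" using N(2)[OF x] by (meson Ints_cases)
      \<comment> \<open>Division with remainder: subtracting the quotient times \<open>b\<close>
        leaves the remainder as numerator, and minimality of \<open>n\<close> makes it 0.\<close>
      define m where "m = k div int n"
      define x' where "x' = (\<lambda>q. 1 * x q + (- of_int m) * b q)"
      have "x' \<in> G" unfolding x'_def by (rule lin[OF x(1) b(1)]) auto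
      moreover have "supp x' \<subseteq> D p" unfolding x'_def using x(2) b(2) by (intro order_trans[OF supp_lin] Un_least)
      moreover have x'p: "of_nat N * x' p = of_nat (nat (k mod int n))"
      proof -
        have "of_nat N * x' p = of_nat N * x p - of_int m * (of_nat N * b p)" by (simp add: x'_def algebra_simps)
        also have "\<dots> = of_int (k - m * int n)" unfolding k b(3) by simp
        also have "k - m * int n = k mod int n" by (simp add: m_def minus_div_mult_eq_mod)
        also have "k mod int n = int (nat (k mod int n))" using b(4) by simp
        finally show ?thesis by simp
      qed
      ultimately have "nat (k mod int n) = 0 \<or> n \<le> nat (k mod int n)"
        using min[of "nat (k mod int n)"] unfolding J_def by (metis gr0I)
      moreover have "nat (k mod int n) < n" using b(4) by (simp add: nat_less_iff)
      ultimately have "nat (k mod int n) = 0" by linarith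
      then have "x' p = 0" using x'p N(1) by simp
      then show ?thesis by (intro exI[of _ m]) (simp add: x'_def)
    qed
    moreover have "lead b p" using b N(1) by (auto simp: lead_def)
    ultimately show ?thesis by blast
  qed
  then obtain b where lead: "\<And>p. p \<in> I \<Longrightarrow> lead (b p) p"
    and gen: "\<And>p x. p \<in> I \<Longrightarrow> x \<in> G \<Longrightarrow> supp x \<subseteq> D p \<Longrightarrow> \<exists>m::int. x p = of_int m * b p p"
    by metis
  have IP: "p \<in> P" if "p \<in> I" for p using that by (auto simp: I_def lead_def P_def supp_def)
  \<comment> \<open>Basis vectors are named by their preimages under \<kappa>, which gives the index
    set the type of the original elements.\<close>
  define f where "f p = inv_into M \<kappa> (b p)" for p
  have \<kappa>f: "\<kappa> (f p) = b p" if "p \<in> I" for p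
    using \<kappa> lead[OF that] unfolding f_def by (auto simp: bij_betw_def lead_def intro: f_inv_into_f)
  have triangular: "b q p = 0" if "q \<in> I" "\<tau> q < \<tau> p" for p q
    using lead[OF that(1)] that(2) by (auto simp: lead_def D_def supp_def)
  have inj_f: "inj_on f I"
  proof (rule inj_onI)
    fix p q assume pq: "p \<in> I" "q \<in> I" "f p = f q"
    then have "b p = b q" using \<kappa>f by metis
    then have "b q p \<noteq> 0" "b p q \<noteq> 0" using lead pq by (metis lead_def)+
    then have "\<tau> p = \<tau> q" using triangular pq by (meson linorder_neqE_nat)
    then show "p = q" using inj IP pq by blast
  qed
  define S where "S = f ` I"
  have SG: "\<kappa> s \<in> G" if "s \<in> S" for s using that \<kappa>f lead by (auto simp: S_def lead_def)
  define h where "h c = (\<lambda>y. \<Sum>s\<in>Poly_Mapping.keys c. of_int (Poly_Mapping.lookup c s) * \<kappa> s y)" for c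
  have h_sup: "h c = (\<lambda>y. \<Sum>s\<in>F. of_int (Poly_Mapping.lookup c s) * \<kappa> s y)"
    if "finite F" "Poly_Mapping.keys c \<subseteq> F" for c F
    unfolding h_def using that by (intro ext sum.mono_neutral_left) (auto simp: in_keys_iff)
  have hG: "h c \<in> G" if "Poly_Mapping.keys c \<subseteq> S" for c
    unfolding h_def by (intro sum_closed finite_keys Ints_of_int SG subsetD[OF that])
  have h_add: "h (c + c') = (\<lambda>y. h c y + h c' y)" for c c'
  proof -
    let ?F = "Poly_Mapping.keys c \<union> Poly_Mapping.keys c'"
    have "Poly_Mapping.keys (c + c') \<subseteq> ?F" by (rule Poly_Mapping.keys_add)
    then show ?thesis using h_sup[of ?F c] h_sup[of ?F c'] h_sup[of ?F "c + c'"]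
      by (simp add: lookup_add algebra_simps sum.distrib)
  qed
  have "h \<in> iso (free_Abelian_group S) (vector_group G)"
  proof (rule isoI)
    show "h \<in> hom (free_Abelian_group S) (vector_group G)"
    proof (rule homI)
      fix c assume "c \<in> carrier (free_Abelian_group S)"
      then show "h c \<in> carrier (vector_group G)" using hG by simp
    qed (simp add: h_add)
    show "bij_betw h (carrier (free_Abelian_group S)) (carrier (vector_group G))"
      unfolding bij_betw_def
    proof (intro conjI equalityI subsetI)
      show "inj_on h (carrier (free_Abelian_group S))"
      proof (rule inj_onI, rule ccontr)
        fix c c' assume c: "c \<in> carrier (free_Abelian_group S)" "c' \<in> carrier (free_Abelian_group S)"
          and eq: "h c = h c'" and "c \<noteq> c'"
        define e where "e = c - c'"
        have "h c = (\<lambda>y. h e y + h c' y)" using h_add[of e c'] by (simp add: e_def)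
        then have he: "h e y = 0" for y using eq by (simp add: fun_eq_iff)
        have "Poly_Mapping.keys e \<subseteq> S" using c keys_diff[of c c'] by (auto simp: e_def)
        then obtain T where T: "Poly_Mapping.keys e = f ` T" "T \<subseteq> I"
          unfolding S_def by (meson subset_image_iff)
        have "finite T" using T inj_f by (metis finite_imageD finite_keys inj_on_subset)
        moreover have "T \<noteq> {}" using \<open>c \<noteq> c'\<close> T(1) by (auto simp: e_def)
        \<comment> \<open>At the last leading coordinate all other basis vectors in the combination
          vanish, so a single coefficient is isolated.\<close>
        ultimately have "Max (\<tau> ` T) \<in> \<tau> ` T" by (intro Max_in) auto
        then obtain p where "p \<in> T" "\<tau> p = Max (\<tau> ` T)" by auto
        then have p: "p \<in> T" "\<And>q. q \<in> T \<Longrightarrow> \<tau> q \<le> \<tau> p" using \<open>finite T\<close> by auto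
        have "h e p = (\<Sum>q\<in>T. of_int (Poly_Mapping.lookup e (f q)) * b q p)"
        proof -
          have "inj_on f T" using T(2) inj_f by (rule inj_on_subset[rotated])
          then have "h e p = (\<Sum>q\<in>T. of_int (Poly_Mapping.lookup e (f q)) * \<kappa> (f q) p)"
            unfolding h_def T(1) by (simp add: sum.reindex)
          also have "\<dots> = (\<Sum>q\<in>T. of_int (Poly_Mapping.lookup e (f q)) * b q p)"
            using T(2) by (intro sum.cong) (auto simp: \<kappa>f subsetD)
          finally show ?thesis .
        qed
        also have "\<dots> = (\<Sum>q\<in>{p}. of_int (Poly_Mapping.lookup e (f q)) * b q p)"
        proof (rule sum.mono_neutral_right[OF \<open>finite T\<close>])
          show "\<forall>q\<in>T - {p}. of_int (Poly_Mapping.lookup e (f q)) * b q p = 0"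
          proof
            fix q assume q: "q \<in> T - {p}"
            then have "\<tau> q \<noteq> \<tau> p" using inj IP T(2) p(1) by blast
            then have "\<tau> q < \<tau> p" using p(2)[of q] q by auto
            then show "of_int (Poly_Mapping.lookup e (f q)) * b q p = 0" using triangular T(2) q by auto
          qed
        qed (use p in auto)
        finally have "of_int (Poly_Mapping.lookup e (f p)) * b p p = 0" using he by simp
        moreover have "Poly_Mapping.lookup e (f p) \<noteq> 0" using T(1) p(1) by (auto simp: in_keys_iff[symmetric])
        moreover have "b p p \<noteq> 0" using lead p(1) T(2) by (auto simp: lead_def)
        ultimately show False by simp
      qed
    next
      fix x assume "x \<in> h ` carrier (free_Abelian_group S)"
      then show "x \<in> carrier (vector_group G)" using hG by auto
    next
      fix x assume "x \<in> carrier (vector_group G)"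
      then have xG: "x \<in> G" by simp
      \<comment> \<open>Induction on a bound for the enumeration numbers in the support: a multiple
        of the basis vector at the last coordinate clears it.\<close>
      have "\<exists>c. Poly_Mapping.keys c \<subseteq> S \<and> h c = x" if "x \<in> G" "\<And>q. q \<in> supp x \<Longrightarrow> \<tau> q < n" for n x
        using that
      proof (induction n arbitrary: x)
        case 0
        then have "x = (\<lambda>p. 0)" by (auto simp: supp_def)
        then show ?case by (intro exI[of _ 0]) (simp add: h_def)
      next
        case (Suc n)
        show ?case
        proof (cases "\<forall>q\<in>supp x. \<tau> q < n")
          case True
          then show ?thesis using Suc by blast
        next
          case False
          then obtain p where p: "p \<in> supp x" "\<tau> p = n" using Suc.prems(2) by (metis less_SucE)
          have subP: "supp x \<subseteq> P" using Suc.prems(1) by (auto simp: P_def)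
          then have sub: "supp x \<subseteq> D p" using Suc.prems(2) p by (auto simp: D_def less_Suc_eq_le)
          then have "p \<in> I" using p Suc.prems(1) by (auto simp: I_def lead_def supp_def)
          then obtain m :: int where m: "x p = of_int m * b p p" using gen Suc.prems(1) sub by blast
          define x' where "x' = (\<lambda>q. 1 * x q + (- of_int m) * b p q)"
          have bG: "b p \<in> G" "supp (b p) \<subseteq> D p" using lead[OF \<open>p \<in> I\<close>] by (auto simp: lead_def)
          have "x' \<in> G" unfolding x'_def by (rule lin[OF Suc.prems(1) bG(1)]) auto
          moreover have "\<tau> q < n" if "q \<in> supp x'" for q
          proof -
            have "supp x' \<subseteq> D p" unfolding x'_def using sub bG(2) by (intro order_trans[OF supp_lin] Un_least)
            then have "q \<in> D p" using that by blast
            moreover have "q \<noteq> p" using that m by (auto simp: x'_def supp_def)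
            ultimately show ?thesis using inj[of q p] p subP by (auto simp: D_def le_less)
          qed
          ultimately obtain c where c: "Poly_Mapping.keys c \<subseteq> S" "h c = x'" using Suc.IH by blast
          have "h (Poly_Mapping.single (f p) m) = (\<lambda>q. of_int m * b p q)"
            using h_sup[of "{f p}" "Poly_Mapping.single (f p) m"] \<kappa>f[OF \<open>p \<in> I\<close>] by simp
          then have "h (c + Poly_Mapping.single (f p) m) = x" unfolding h_add c(2) by (simp add: x'_def)
          moreover have "Poly_Mapping.keys (c + Poly_Mapping.single (f p) m) \<subseteq> S"
            using c(1) Poly_Mapping.keys_add[of c "Poly_Mapping.single (f p) m"] \<open>p \<in> I\<close>
            by (auto simp: S_def split: if_splits)
          ultimately show ?thesis by blast
        qed
      qed
      moreover obtain n where "\<And>q. q \<in> supp x \<Longrightarrow> \<tau> q < n"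
        using finite_nat_set_iff_bounded[of "\<tau> ` supp x"] fin[OF xG] by auto
      ultimately obtain c where "Poly_Mapping.keys c \<subseteq> S" "h c = x" using xG by blast
      then show "x \<in> h ` carrier (free_Abelian_group S)" by (intro image_eqI[of _ _ c]) auto
    qed
  qed
  then show ?thesis by (auto simp: is_iso_def)
qed

section \<open>Order automorphisms\<close>

context rigid_vectors
begin

lemma G_fin: "x \<in> G \<Longrightarrow> finite (supp x)"
  and G_supp: "x \<in> G \<Longrightarrow> supp x \<subseteq> idxs"
  using G_V by (auto simp: V_def)

lemma translate_apply [simp]: "f \<in> carrier H \<Longrightarrow> translate h x (j, f) = x (j, f \<otimes> inv h)"
  by (simp add: translate_def)

lemma translate_outside [simp]: "f \<notin> carrier H \<Longrightarrow> translate h x (j, f) = 0"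
  by (simp add: translate_def)

lemma G_outside: "x \<in> G \<Longrightarrow> f \<notin> carrier H \<Longrightarrow> x (j, f) = 0"
  using G_supp by (auto simp: supp_def idxs_def)

lemma translate_one: "x \<in> G \<Longrightarrow> translate \<one> x = x"
  by (rule ext, rename_tac p, case_tac "snd p \<in> carrier H") (auto simp: translate_def G_outside split: prod.splits)

lemma translate_translate:
  assumes "h \<in> carrier H" "k \<in> carrier H" "x \<in> G"
  shows "translate h (translate k x) = translate (k \<otimes> h) x"
proof
  fix p :: "'b idx \<times> 'h"
  obtain j f where p: "p = (j, f)" by force
  show "translate h (translate k x) p = translate (k \<otimes> h) x p"
    using assms by (cases "f \<in> carrier H") (simp_all add: p inv_mult_group m_assoc)
qed

lemma translate_unit_vec:
  assumes "h \<in> carrier H" "k \<in> carrier H"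
  shows "translate k (unit_vec (j, h)) = unit_vec (j, h \<otimes> k)"
proof
  fix p :: "'b idx \<times> 'h"
  obtain i f where p: "p = (i, f)" by force
  have "f \<otimes> inv k = h \<longleftrightarrow> f = h \<otimes> k" if "f \<in> carrier H"
    using assms that by (metis inv_solve_right)
  moreover have "f \<noteq> h \<otimes> k" if "f \<notin> carrier H" using assms that by auto
  ultimately show "translate k (unit_vec (j, h)) p = unit_vec (j, h \<otimes> k) p"
    using assms by (cases "f \<in> carrier H") (auto simp: p unit_vec_def)
qed

lemma translate_additive: "h \<in> carrier H \<Longrightarrow> additive_map G (translate h)"
  by (simp add: additive_map_def translate_G) (simp add: translate_def fun_eq_iff)

text \<open>Right multiplication by the group ring element \<open>r\<close>: the product of
  \<open>h\<close> with \<open>r\<close> has the coefficient \<open>r (inv h \<otimes> f)\<close> at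
  \<open>f\<close>.\<close>

definition acts_by :: "('h \<Rightarrow> rat) \<Rightarrow> (('b, 'h) vec \<Rightarrow> ('b, 'h) vec) \<Rightarrow> bool" where
  "acts_by r \<phi> \<longleftrightarrow> (\<forall>t\<in>lists A. \<forall>h\<in>carrier H.
     \<phi> (unit_vec (Node t, h)) = (\<lambda>(j, f). if j = Node t \<and> f \<in> carrier H then r (inv h \<otimes> f) else 0))"

text \<open>\<open>rigid\<close> grants each vector its own multiplier. For the sum of unit vectors
  at two distinct nodes one multiplier serves both summands and can be read off at each node
  separately, so the multipliers of the summands agree.\<close>

lemma additive_map_group_ring:
  assumes \<phi>: "additive_map G \<phi>" and A: "A \<noteq> {}"
  obtains r where "finite (supp r)" "supp r \<subseteq> carrier H" "\<And>k. r k \<in> \<int>"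
    "acts_by r \<phi>"
proof -
  have single: "\<phi> (unit_vec (Node t, h)) (j, f) = 0" if "t \<in> lists A" "h \<in> carrier H" "j \<noteq> Node t \<or> f \<notin> carrier H" for t h j f
  proof -
    obtain r where r: "finite (supp r)" "supp r \<subseteq> carrier H" "\<And>p. \<phi> (unit_vec (Node t, h)) p = (\<Sum>k\<in>supp r. r k * translate k (unit_vec (Node t, h)) p)"
      using rigid[OF \<phi>, of "unit_vec (Node t, h)"] \<open>t \<in> lists A\<close> \<open>h \<in> carrier H\<close> by auto
    have "translate k (unit_vec (Node t, h)) (j, f) = 0" if "k \<in> supp r" for k
    proof -
      have "k \<in> carrier H" using that r by auto
      then show ?thesis
        using \<open>j \<noteq> Node t \<or> f \<notin> carrier H\<close> \<open>h \<in> carrier H\<close>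
        unfolding translate_unit_vec[OF \<open>h \<in> carrier H\<close> \<open>k \<in> carrier H\<close>] by (auto simp: unit_vec_def)
    qed
    then show ?thesis unfolding r by simp
  qed
  have same: "\<phi> (unit_vec (Node t, h)) (Node t, h \<otimes> k) = \<phi> (unit_vec (Node t', h')) (Node t', h' \<otimes> k)"
    if t: "t \<in> lists A" "t' \<in> lists A" "t \<noteq> t'" and h: "h \<in> carrier H" "h' \<in> carrier H" "k \<in> carrier H" for t t' h h' k
  proof -
    define e where "e = (\<lambda>p. unit_vec (Node t, h) p + unit_vec (Node t', h') p)"
    have sub: "supp e \<subseteq> {(Node t, h), (Node t', h')}" by (auto simp: e_def supp_def unit_vec_def)
    have fin: "finite (supp e)" using sub by (rule finite_subset) simp
    have "{(Node t, h), (Node t', h')} \<subseteq> Node ` lists A \<times> carrier H" using t h by blast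
    with sub have sub': "supp e \<subseteq> Node ` lists A \<times> carrier H" by (rule order_trans)
    have int: "e p \<in> \<int>" for p by (simp add: e_def)
    obtain r where r: "finite (supp r)" "supp r \<subseteq> carrier H" "\<And>p. \<phi> e p = (\<Sum>k\<in>supp r. r k * translate k e p)"
      using rigid[OF \<phi> fin sub' int] by blast
    have \<phi>e: "\<phi> e = (\<lambda>p. \<phi> (unit_vec (Node t, h)) p + \<phi> (unit_vec (Node t', h')) p)"
      using \<phi> unit_vec_G t h by (simp add: additive_map_def e_def)
    have "\<phi> e (Node t, h \<otimes> k) = r k" "\<phi> e (Node t', h' \<otimes> k) = r k"
    proof -
      have l: "l = k \<longleftrightarrow> h \<otimes> k = h \<otimes> l" "l = k \<longleftrightarrow> h' \<otimes> k = h' \<otimes> l" if "l \<in> supp r" for l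
        using that h r by auto
      have tr_e: "translate l e = (\<lambda>p. unit_vec (Node t, h \<otimes> l) p + unit_vec (Node t', h' \<otimes> l) p)" if "l \<in> supp r" for l
      proof -
        have lc: "l \<in> carrier H" using that r by auto
        have "translate l e = (\<lambda>p. translate l (unit_vec (Node t, h)) p + translate l (unit_vec (Node t', h')) p)" by (auto simp: e_def translate_def)
        then show ?thesis using translate_unit_vec[OF h(1) lc] translate_unit_vec[OF h(2) lc] by simp
      qed
      have "(\<Sum>l\<in>supp r. r l * translate l e (Node t, h \<otimes> k)) = (\<Sum>l\<in>supp r. if l = k then r l else 0)"
        using t l by (intro sum.cong) (auto simp: tr_e unit_vec_def)
      then show "\<phi> e (Node t, h \<otimes> k) = r k" unfolding r(3) using r(1) by (simp add: supp_def)
      have "(\<Sum>l\<in>supp r. r l * translate l e (Node t', h' \<otimes> k)) = (\<Sum>l\<in>supp r. if l = k then r l else 0)"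
        using t l by (intro sum.cong) (auto simp: tr_e unit_vec_def)
      then show "\<phi> e (Node t', h' \<otimes> k) = r k" unfolding r(3) using r(1) by (simp add: supp_def)
    qed
    then show ?thesis using single t h unfolding \<phi>e by auto
  qed
  obtain a where a: "a \<in> A" using A by auto
  \<comment> \<open>Two summands at the same node could overlap, so at the root the comparison takes
    a detour through the node \<open>[a]\<close>.\<close>
  have same': "\<phi> (unit_vec (Node t, h)) (Node t, h \<otimes> k) = \<phi> (unit_vec (Node [], \<one>)) (Node [], \<one> \<otimes> k)"
    if "t \<in> lists A" "h \<in> carrier H" "k \<in> carrier H" for t h k
  proof (cases "t = []")
    case True
    have "\<phi> (unit_vec (Node t, h)) (Node t, h \<otimes> k) = \<phi> (unit_vec (Node [a], \<one>)) (Node [a], \<one> \<otimes> k)"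
      using that a True by (intro same) auto
    also have "\<dots> = \<phi> (unit_vec (Node [], \<one>)) (Node [], \<one> \<otimes> k)" using that a by (intro same) auto
    finally show ?thesis .
  qed (use that in \<open>intro same, auto\<close>)
  define r where "r k = (if k \<in> carrier H then \<phi> (unit_vec (Node [], \<one>)) (Node [], k) else 0)" for k
  have \<phi>G: "\<phi> (unit_vec (Node [], \<one>)) \<in> G" using \<phi> unit_vec_G[of "[]" \<one>] by (simp add: additive_map_def)
  show ?thesis
  proof (rule that[of r])
    have "(\<lambda>k. (Node [], k)) ` supp r \<subseteq> supp (\<phi> (unit_vec (Node [], \<one>)))"
      by (auto simp: r_def supp_def split: if_splits)
    then have "finite ((\<lambda>k. (Node [] :: 'b idx, k)) ` supp r)" using G_fin[OF \<phi>G] by (rule finite_subset)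
    then show "finite (supp r)" by (rule finite_imageD) (simp add: inj_on_def)
    show "supp r \<subseteq> carrier H" by (auto simp: r_def supp_def)
    \<comment> \<open>The image of a node has no symbol coordinates, so membership in
      \<open>G\<close> forces integral values although \<open>rigid\<close> only gives rational
      ones.\<close>
    show "r k \<in> \<int>" for k
      using no_symbol[OF \<phi>G] single[of "[]" \<one>] by (simp add: r_def)
    show "acts_by r \<phi>"
      unfolding acts_by_def
    proof (intro ballI)
      fix t h assume th: "t \<in> lists A" "h \<in> carrier H"
    show "\<phi> (unit_vec (Node t, h)) = (\<lambda>(j, f). if j = Node t \<and> f \<in> carrier H then r (inv h \<otimes> f) else 0)"
    proof (rule ext, safe)
      fix j f
      show "\<phi> (unit_vec (Node t, h)) (j, f) = (if j = Node t \<and> f \<in> carrier H then r (inv h \<otimes> f) else 0)"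
      proof (cases "j = Node t \<and> f \<in> carrier H")
        case True
        then have "f = h \<otimes> (inv h \<otimes> f)" using th by (simp add: m_assoc[symmetric])
        then show ?thesis using same'[OF th, of "inv h \<otimes> f"] th True by (simp add: r_def)
      qed (use single th in auto)
    qed
    qed
  qed
qed

lemma order_automorphism_translation:
  assumes R: "right_ordered_group H R" and A: "A \<noteq> {}"
    and \<phi>: "additive_map G \<phi>" and \<psi>: "additive_map G \<psi>" and inverse: "\<And>x. x \<in> G \<Longrightarrow> \<psi> (\<phi> x) = x"
    and pos: "\<And>t h. t \<in> lists A \<Longrightarrow> h \<in> carrier H \<Longrightarrow> \<exists>p. \<phi> (unit_vec (Node t, h)) p > 0 \<and> (\<forall>q\<in>supp (\<phi> (unit_vec (Node t, h))). q = p \<or> (q, p) \<in> L)"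
  obtains k where "k \<in> carrier H" "\<And>x. x \<in> G \<Longrightarrow> \<phi> x = translate k x"
proof -
  obtain r where r: "finite (supp r)" "supp r \<subseteq> carrier H" "\<And>k. r k \<in> \<int>" "acts_by r \<phi>"
    using additive_map_group_ring[OF \<phi> A] by blast
  obtain s where s: "finite (supp s)" "supp s \<subseteq> carrier H" "\<And>k. s k \<in> \<int>" "acts_by s \<psi>"
    using additive_map_group_ring[OF \<psi> A] by blast
  note r' = r(4)[unfolded acts_by_def, rule_format] and s' = s(4)[unfolded acts_by_def, rule_format]
  \<comment> \<open>Evaluating \<open>\<psi> (\<phi> e) = e\<close> at the root unit vector says
    that the product of \<open>r\<close> and \<open>s\<close> in the group ring is 1.\<close>
  have unit: "(\<Sum>k\<in>supp r. r k * s (inv k \<otimes> f)) = (if f = \<one> then 1 else 0)" if f: "f \<in> carrier H" for f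
  proof -
    let ?x = "\<phi> (unit_vec (Node [], \<one>))"
    have x: "?x (j, g) = (if j = Node [] \<and> g \<in> carrier H then r g else 0)" for j g
      using r'[of "[]" \<one>] by simp
    have inj: "inj_on (\<lambda>k. (Node [] :: 'b idx, k)) (supp r)" by (simp add: inj_on_def)
    have supp: "supp ?x \<subseteq> (\<lambda>k. (Node [], k)) ` supp r" by (auto simp: supp_def x split: if_splits)
    have "\<psi> ?x = (\<lambda>p. \<Sum>q\<in>(\<lambda>k. (Node [], k)) ` supp r. ?x q * \<psi> (unit_vec q) p)"
    proof (rule conjunct2[OF integral_combination[OF \<psi> _ _ supp]])
      show "?x p \<in> \<int>" for p by (cases p) (simp add: x r)
    qed (use r unit_vec_G in auto)
    also have "\<dots> = (\<lambda>p. \<Sum>k\<in>supp r. r k * \<psi> (unit_vec (Node [], k)) p)"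
      unfolding sum.reindex[OF inj] o_def using r(2) by (intro ext sum.cong) (auto simp: x)
    finally have eq: "\<psi> ?x = (\<lambda>p. \<Sum>k\<in>supp r. r k * \<psi> (unit_vec (Node [], k)) p)" .
    have "unit_vec (Node [], \<one>) = \<psi> ?x" using inverse unit_vec_G by simp
    from fun_cong[OF trans[OF this eq], of "(Node [], f)"]
    have "unit_vec (Node [] :: 'b idx, \<one>) (Node [], f) = (\<Sum>k\<in>supp r. r k * \<psi> (unit_vec (Node [], k)) (Node [], f))" .
    also have "\<dots> = (\<Sum>k\<in>supp r. r k * s (inv k \<otimes> f))"
      using r(2) f by (intro sum.cong) (auto simp: s')
    finally show ?thesis by (simp add: unit_vec_def)
  qed
  obtain a where a: "a \<in> carrier H" "supp r = {a}"
    using unit_trivial[OF R r(1,2) s(1,2) unit] by blast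
  have "r a * s (inv a) = 1" using unit[of \<one>] a by simp
  then have "\<bar>r a\<bar> = 1"
  proof -
    obtain m n where "r a = of_int m" "s (inv a) = of_int n" using r(3) s(3) by (meson Ints_cases)
    moreover from this \<open>r a * s (inv a) = 1\<close> have "m * n = 1" by (metis of_int_eq_1_iff of_int_mult)
    then have "\<bar>m\<bar> = 1" by (simp add: zmult_eq_1_iff) auto
    ultimately show ?thesis by (metis of_int_1 of_int_abs)
  qed
  moreover have "r a > 0"
  proof -
    obtain p where "\<phi> (unit_vec (Node [], \<one>)) p > 0" using pos[of "[]" \<one>] by auto
    then obtain f where "f \<in> carrier H" "r f > 0" using r'[of "[]" \<one>] by (auto split: prod.splits if_splits)
    then show ?thesis using a(2) by (auto simp: supp_def)
  qed
  ultimately have ra: "r k = (if k = a then 1 else 0)" for k using a(2) by (auto simp: supp_def)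
  have \<phi>unit_vec: "\<phi> (unit_vec (Node t, h)) = translate a (unit_vec (Node t, h))" if th: "t \<in> lists A" "h \<in> carrier H" for t h
  proof (rule ext, safe)
    fix j f
    have "inv h \<otimes> f = a \<longleftrightarrow> f = h \<otimes> a" if "f \<in> carrier H"
      using that th a by (metis inv_solve_left)
    moreover have "f \<noteq> h \<otimes> a" if "f \<notin> carrier H" using that th a by auto
    ultimately show "\<phi> (unit_vec (Node t, h)) (j, f) = translate a (unit_vec (Node t, h)) (j, f)"
      unfolding translate_unit_vec[OF th(2) a(1)] r'[OF th] ra by (auto simp: unit_vec_def)
  qed
  have tra: "additive_map G (translate a)" by (rule translate_additive[OF a(1)])
  \<comment> \<open>The difference of two endomorphisms that agree on the nodes vanishes there,
    hence everywhere by \<open>determined\<close>.\<close>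
  define \<theta> where "\<theta> x = (\<lambda>p. \<phi> x p - translate a x p)" for x
  have "additive_map G \<theta>"
    unfolding additive_map_def
  proof (intro conjI ballI)
    fix x assume x: "x \<in> G"
    then have "\<phi> x \<in> G" "translate a x \<in> G" using \<phi> tra by (auto simp: additive_map_def)
    then show "\<theta> x \<in> G" using lin[of "\<phi> x" "translate a x" 1 "-1"] by (simp add: \<theta>_def)
  next
    fix x y assume "x \<in> G" "y \<in> G"
    then show "\<theta> (\<lambda>p. x p + y p) = (\<lambda>p. \<theta> x p + \<theta> y p)"
      using \<phi> tra by (simp add: additive_map_def \<theta>_def fun_eq_iff)
  qed
  moreover have "\<theta> (unit_vec (Node t, h)) = (\<lambda>p. 0)" if "t \<in> lists A" "h \<in> carrier H" for t h
    using \<phi>unit_vec[OF that] by (simp add: \<theta>_def)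
  ultimately have "\<theta> x = (\<lambda>p. 0)" if "x \<in> G" for x using determined[of \<theta>] that by blast
  then have "\<phi> x = translate a x" if "x \<in> G" for x using that by (auto simp: \<theta>_def fun_eq_iff)
  then show ?thesis using that a(1) by blast
qed

end

lemma integral_subgroupI:
  assumes "G \<noteq> {}" and diff: "\<And>x y. x \<in> G \<Longrightarrow> y \<in> G \<Longrightarrow> (\<lambda>p. x p - y p) \<in> G"
  shows "integral_subgroup G"
proof
  have zero: "(\<lambda>p. 0) \<in> G" using assms(1) diff by fastforce
  have neg: "(\<lambda>p. - x p) \<in> G" if "x \<in> G" for x using diff[OF zero that] by simp
  have add: "(\<lambda>p. x p + y p) \<in> G" if "x \<in> G" "y \<in> G" for x y using diff[OF that(1) neg[OF that(2)]] by simp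
  have nat: "(\<lambda>p. of_nat n * x p) \<in> G" if x: "x \<in> G" for x n
  proof (induction n)
    case (Suc n)
    then show ?case using add[OF x Suc] by (simp add: distrib_right)
  qed (simp add: zero)
  have int: "(\<lambda>p. a * x p) \<in> G" if x: "x \<in> G" and a: "a \<in> \<int>" for x a
  proof -
    obtain k where k: "a = of_int k" using a by (meson Ints_cases)
    show ?thesis
    proof (cases k)
      case (nonneg n)
      then show ?thesis using nat[OF x, of n] k by simp
    next
      case (neg n)
      have "(\<lambda>p. - (of_nat (Suc n) * x p)) \<in> G"
        by (rule \<open>\<And>x. x \<in> G \<Longrightarrow> (\<lambda>p. - x p) \<in> G\<close>[OF nat[OF x]])
      then show ?thesis unfolding k neg by (simp del: of_nat_Suc)
    qed
  qed
  show "(\<lambda>p. a * x p + b * y p) \<in> G" if "x \<in> G" "y \<in> G" "a \<in> \<int>" "b \<in> \<int>" for x y a b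
    using add int that by blast
qed (rule assms(1))

section \<open>Realization of the given group by order automorphisms\<close>

context rigid_vectors
begin

lemma lex_positive_tr:
  assumes inv: "\<And>i j h g k. ((i, h), (j, g)) \<in> L \<Longrightarrow> k \<in> carrier H \<Longrightarrow> ((i, h \<otimes> k), (j, g \<otimes> k)) \<in> L"
    and x: "x \<in> G" "lex_positive L x" and k: "k \<in> carrier H"
  shows "lex_positive L (translate k x)"
proof -
  obtain i f where p: "x (i, f) > 0" "\<And>q. q \<in> supp x \<Longrightarrow> q = (i, f) \<or> (q, (i, f)) \<in> L"
    using x(2) by (force simp: lex_positive_def)
  have f: "f \<in> carrier H" using p(1) G_outside[OF x(1), of f i] by auto
  have supp: "supp (translate k x) = (\<lambda>(i, g). (i, g \<otimes> k)) ` supp x"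
    using translate_supp[OF k V_subset] G_V x(1) by blast
  have "translate k x (i, f \<otimes> k) > 0" using p(1) f k by (simp add: m_assoc)
  moreover have "q = (i, f \<otimes> k) \<or> (q, (i, f \<otimes> k)) \<in> L" if q: "q \<in> supp (translate k x)" for q
  proof -
    obtain s where s: "s \<in> supp x" "q = (\<lambda>(i, g). (i, g \<otimes> k)) s" using q unfolding supp by blast
    then show ?thesis using p(2)[OF s(1)] inv k by (cases s) auto
  qed
  ultimately show ?thesis unfolding lex_positive_def by blast
qed

text \<open>The vector group is transported along \<beta> in order to obtain a prescribed carrier;
  \<kappa> is the way back.\<close>

theorem realization:
  fixes \<beta> :: "('b, 'h) vec \<Rightarrow> 'c"
  assumes R: "right_ordered_group H R" and A: "A \<noteq> {}" and \<beta>: "bij_betw \<beta> G C"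
  shows "\<exists>(M :: 'c monoid) r. carrier M = C \<and> ordered_abelian_group M r \<and> aleph1_free M \<and>
    ordered_AutoGroup M r \<cong> H"
proof -
  define \<kappa> where "\<kappa> = inv_into G \<beta>"
  have \<kappa>\<beta> [simp]: "\<kappa> (\<beta> x) = x" if "x \<in> G" for x
    using \<beta> that by (simp add: \<kappa>_def bij_betw_inv_into_left)
  have \<beta>\<kappa> [simp]: "\<beta> (\<kappa> c) = c" if "c \<in> C" for c
    using \<beta> that by (simp add: \<kappa>_def bij_betw_inv_into_right)
  have \<beta>C [simp]: "\<beta> x \<in> C" if "x \<in> G" for x using \<beta> that by (auto simp: bij_betw_def)
  have \<kappa>: "bij_betw \<kappa> C G" unfolding \<kappa>_def by (rule bij_betw_inv_into[OF \<beta>])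
  then have \<kappa>G [simp]: "\<kappa> c \<in> G" if "c \<in> C" for c using that by (auto simp: bij_betw_def)
  have \<kappa>_eq: "c = c'" if "c \<in> C" "c' \<in> C" "\<kappa> c = \<kappa> c'" for c c' using that \<beta>\<kappa> by metis
  define M where "M = \<lparr>carrier = C, monoid.mult = (\<lambda>a b. \<beta> (\<lambda>p. \<kappa> a p + \<kappa> b p)), one = \<beta> (\<lambda>p. 0)\<rparr>"
  have M [simp]: "carrier M = C" "a \<otimes>\<^bsub>M\<^esub> b = \<beta> (\<lambda>p. \<kappa> a p + \<kappa> b p)" "\<one>\<^bsub>M\<^esub> = \<beta> (\<lambda>p. 0)" for a b
    by (simp_all add: M_def)
  have neg: "(\<lambda>p. - x p) \<in> G" if "x \<in> G" for x using scale[OF that, of "-1"] by simp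
  have comm: "comm_group M"
  proof (rule comm_groupI)
    show "\<exists>b\<in>carrier M. b \<otimes>\<^bsub>M\<^esub> a = \<one>\<^bsub>M\<^esub>" if "a \<in> carrier M" for a
      using that neg by (intro bexI[of _ "\<beta> (\<lambda>p. - \<kappa> a p)"]) auto
  qed (auto simp: add zero ac_simps)
  interpret M: comm_group M by (rule comm)
  obtain W0 :: "'b idx rel" where W0: "well_order_on UNIV W0" using well_order_on by blast
  define W where "W = W0 - Id"
  have "strict_linear_order_on UNIV W"
    using W0 unfolding W_def by (intro strict_linear_order_on_diff_Id) (simp add: well_order_on_def)
  then have W: "trans W" "irrefl W" "total_on UNIV W" by (auto simp: strict_linear_order_on_def)
  have Rlin: "trans R" "irrefl R" "total_on (carrier H) R" and Rsub: "R \<subseteq> carrier H \<times> carrier H"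
    and Rinv: "\<And>h g k. (h, g) \<in> R \<Longrightarrow> k \<in> carrier H \<Longrightarrow> (h \<otimes> k, g \<otimes> k) \<in> R"
    using R by (auto simp: right_ordered_group_def strict_linear_order_on_def)
  \<comment> \<open>Translations act on the group coordinate only, by right multiplication.
    Comparing indices first and group coordinates by \<open>R\<close> makes \<open>L\<close>
    invariant, so translations preserve the sign of leading coefficients.\<close>
  define L where "L = {((i, h), (j, g)) | i h j g. h \<in> carrier H \<and> g \<in> carrier H \<and> ((i, j) \<in> W \<or> i = j \<and> (h, g) \<in> R)}"
  have L: "strict_linear_order_on (UNIV \<times> carrier H) L"
    unfolding strict_linear_order_on_def
  proof (intro conjI)
    show "trans L" using W(1) Rlin(1) unfolding L_def by (intro transI) (auto dest: transD)
    show "irrefl L" using W(2) Rlin(2) by (auto simp: L_def irrefl_def)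
    show "total_on (UNIV \<times> carrier H) L" using W(3) Rlin(3) unfolding total_on_def L_def by blast
  qed
  have Linv: "((i, h \<otimes> k), (j, g \<otimes> k)) \<in> L" if "((i, h), (j, g)) \<in> L" "k \<in> carrier H" for i j h g k
    using that Rinv by (auto simp: L_def)
  have ordG: "ordered_abelian_group (vector_group G) (lex_less L G)"
    by (rule ordered_vector_group[OF L]) (use G_V in \<open>auto simp: V_def idxs_def\<close>)
  define r where "r = {(a, b). a \<in> C \<and> b \<in> C \<and> (\<kappa> a, \<kappa> b) \<in> lex_less L G}"
  have ord: "ordered_abelian_group M r"
    unfolding ordered_abelian_group_def strict_linear_order_on_def
  proof (intro conjI)
    have vl: "trans (lex_less L G)" "irrefl (lex_less L G)" "total_on G (lex_less L G)"
      and mono: "\<And>x y z. (x, y) \<in> lex_less L G \<Longrightarrow> x \<in> G \<Longrightarrow> y \<in> G \<Longrightarrow> z \<in> G \<Longrightarrow>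
        ((\<lambda>p. x p + z p), (\<lambda>p. y p + z p)) \<in> lex_less L G"
      using ordG by (auto simp: ordered_abelian_group_def strict_linear_order_on_def)
    show "trans r" using vl(1) unfolding r_def by (intro transI) (auto dest: transD)
    show "irrefl r" using vl(2) by (auto simp: r_def irrefl_def)
    show "total_on (carrier M) r"
    proof (rule total_onI)
      fix a b assume ab: "a \<in> carrier M" "b \<in> carrier M" "a \<noteq> b"
      then have "\<kappa> a \<noteq> \<kappa> b" using \<kappa>_eq by auto
      then show "(a, b) \<in> r \<or> (b, a) \<in> r" using vl(3) ab unfolding total_on_def r_def by auto
    qed
    show "\<forall>x\<in>carrier M. \<forall>y\<in>carrier M. \<forall>z\<in>carrier M. (x, y) \<in> r \<longrightarrow> (x \<otimes>\<^bsub>M\<^esub> z, y \<otimes>\<^bsub>M\<^esub> z) \<in> r"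
      using mono add by (auto simp: r_def)
  qed (use comm in \<open>auto simp: r_def\<close>)
  have free: "aleph1_free M"
    unfolding aleph1_free_def
  proof (intro conjI allI impI)
    fix B assume "subgroup B M \<and> countable B"
    then have B: "subgroup B M" "countable B" by auto
    have BC: "B \<subseteq> C" using subgroup.subset[OF B(1)] by simp
    have sub: "\<kappa> ` B \<subseteq> G" using BC by auto
    have inv: "inv\<^bsub>M\<^esub> b = \<beta> (\<lambda>p. - \<kappa> b p)" if "b \<in> C" for b
      using that neg by (intro M.inv_equality) auto
    have diff: "(\<lambda>p. x p - y p) \<in> \<kappa> ` B" if xy: "x \<in> \<kappa> ` B" "y \<in> \<kappa> ` B" for x y
    proof -
      obtain a b where ab: "a \<in> B" "x = \<kappa> a" "b \<in> B" "y = \<kappa> b" using xy by auto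
      have C: "a \<in> C" "b \<in> C" using ab BC by auto
      have "a \<otimes>\<^bsub>M\<^esub> inv\<^bsub>M\<^esub> b \<in> B" using B(1) ab by (simp add: subgroup.m_closed subgroup.m_inv_closed del: M)
      moreover have "a \<otimes>\<^bsub>M\<^esub> inv\<^bsub>M\<^esub> b = \<beta> (\<lambda>p. x p - y p)" using C neg by (simp add: inv ab)
      moreover have "(\<lambda>p. x p - y p) \<in> G" using lin[of x y 1 "-1"] C by (simp add: ab)
      ultimately show ?thesis by (metis \<kappa>\<beta> image_eqI)
    qed
    have "\<kappa> ` B \<noteq> {}" using subgroup.one_closed[OF B(1)] by auto
    then interpret B: integral_subgroup "\<kappa> ` B" using diff by (rule integral_subgroupI)
    have "bij_betw \<kappa> B (\<kappa> ` B)" using \<kappa> BC by (meson bij_betw_def inj_on_subset)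
    moreover have "countable (\<Union>x\<in>\<kappa> ` B. supp x)"
      using B(2) sub G_fin by (intro countable_UN) (auto intro: countable_finite)
    moreover have "\<exists>N::nat. N > 0 \<and> (\<forall>x p. x \<in> \<kappa> ` B \<longrightarrow> supp x \<subseteq> F \<longrightarrow> of_nat N * x p \<in> \<int>)" if "finite F" for F
      using bounded[OF that] sub by blast
    ultimately obtain S :: "'c set" where S: "free_Abelian_group S \<cong> vector_group (\<kappa> ` B)"
      using B.free_vector_group[of \<kappa> B] sub G_fin by blast
    have "\<kappa> \<in> iso (M\<lparr>carrier := B\<rparr>) (vector_group (\<kappa> ` B))"
    proof (rule isoI)
      show "\<kappa> \<in> hom (M\<lparr>carrier := B\<rparr>) (vector_group (\<kappa> ` B))"
        using BC add by (intro homI) (auto simp: subset_iff)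
      show "bij_betw \<kappa> (carrier (M\<lparr>carrier := B\<rparr>)) (carrier (vector_group (\<kappa> ` B)))"
        using \<open>bij_betw \<kappa> B (\<kappa> ` B)\<close> by simp
    qed
    then have "M\<lparr>carrier := B\<rparr> \<cong> vector_group (\<kappa> ` B)" by (auto simp: is_iso_def)
    then show "free_abelian (M\<lparr>carrier := B\<rparr>)"
      unfolding free_abelian_def using iso_trans group.iso_sym[OF group_free_Abelian_group S] by blast
  qed (rule comm)
  \<comment> \<open>Translations compose in reverse order; the inverse turns them into a
    homomorphism.\<close>
  define \<Theta> where "\<Theta> k = restrict (\<lambda>c. \<beta> (translate (inv k) (\<kappa> c))) C" for k
  have \<Theta>: "\<Theta> k c = \<beta> (translate (inv k) (\<kappa> c))" if "c \<in> C" for k c using that by (simp add: \<Theta>_def)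
  have \<Theta>C: "\<Theta> k c \<in> C" if "k \<in> carrier H" "c \<in> C" for k c using that translate_G by (simp add: \<Theta>)
  have \<Theta>_comp: "\<Theta> k (\<Theta> l c) = \<Theta> (k \<otimes> l) c" if "k \<in> carrier H" "l \<in> carrier H" "c \<in> C" for k l c
    using that translate_G by (simp add: \<Theta> translate_translate inv_mult_group)
  have \<Theta>_one: "\<Theta> \<one> c = c" if "c \<in> C" for c using that by (simp add: \<Theta> translate_one)
  have \<Theta>_bij: "\<Theta> k \<in> Bij C" if k: "k \<in> carrier H" for k
    unfolding Bij_def
  proof (intro IntI CollectI)
    show "\<Theta> k \<in> extensional C" by (simp add: \<Theta>_def)
    show "bij_betw (\<Theta> k) C C"
      by (rule bij_betw_byWitness[of _ "\<Theta> (inv k)"]) (use k \<Theta>_comp \<Theta>_one \<Theta>C in auto)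
  qed
  have \<Theta>_auto: "\<Theta> k \<in> auto M" if k: "k \<in> carrier H" for k
  proof -
    have "\<Theta> k \<in> hom M M"
    proof (rule homI)
      fix a b assume ab: "a \<in> carrier M" "b \<in> carrier M"
      have "translate (inv k) (\<lambda>p. \<kappa> a p + \<kappa> b p) = (\<lambda>p. translate (inv k) (\<kappa> a) p + translate (inv k) (\<kappa> b) p)"
        by (auto simp: translate_def)
      then show "\<Theta> k (a \<otimes>\<^bsub>M\<^esub> b) = \<Theta> k a \<otimes>\<^bsub>M\<^esub> \<Theta> k b"
        using ab k translate_G add by (simp add: \<Theta>)
    qed (use \<Theta>C k in auto)
    then show ?thesis using \<Theta>_bij[OF k] by (simp add: auto_def)
  qed
  have diffG: "(\<lambda>p. y p - x p) \<in> G" if "x \<in> G" "y \<in> G" for x y using lin[OF that(2,1), of 1 "-1"] by simp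
  have \<Theta>_mono: "(\<Theta> k a, \<Theta> k b) \<in> r" if k: "k \<in> carrier H" and ab: "(a, b) \<in> r" for k a b
  proof -
    have C: "a \<in> C" "b \<in> C" and pos: "lex_positive L (\<lambda>p. \<kappa> b p - \<kappa> a p)" using ab by (auto simp: r_def lex_less_def)
    have "lex_positive L (translate (inv k) (\<lambda>p. \<kappa> b p - \<kappa> a p))"
      using C k by (intro lex_positive_tr[OF Linv _ pos] diffG) auto
    moreover have "translate (inv k) (\<lambda>p. \<kappa> b p - \<kappa> a p) = (\<lambda>p. translate (inv k) (\<kappa> b) p - translate (inv k) (\<kappa> a) p)"
      by (auto simp: translate_def)
    ultimately show ?thesis using C k translate_G by (simp add: r_def lex_less_def \<Theta>)
  qed
  let ?Aut = "ordered_AutoGroup M r"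
  have carrier_Aut: "carrier ?Aut = {f \<in> auto M. \<forall>x\<in>C. \<forall>y\<in>C. (x, y) \<in> r \<longrightarrow> (f x, f y) \<in> r}"
    by (simp add: ordered_AutoGroup_def)
  have mult_Aut: "f \<otimes>\<^bsub>?Aut\<^esub> g = compose C f g" if "f \<in> Bij C" "g \<in> Bij C" for f g
    using that by (simp add: ordered_AutoGroup_def AutoGroup_def BijGroup_def)
  have "\<Theta> \<in> iso H ?Aut"
  proof (rule isoI)
    show "\<Theta> \<in> hom H ?Aut"
    proof (rule homI)
      show "\<Theta> k \<in> carrier ?Aut" if "k \<in> carrier H" for k
        using \<Theta>_auto \<Theta>_mono that by (simp add: carrier_Aut)
      fix k l assume kl: "k \<in> carrier H" "l \<in> carrier H"
      have "compose C (\<Theta> k) (\<Theta> l) = \<Theta> (k \<otimes> l)"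
      proof
        fix c
        show "compose C (\<Theta> k) (\<Theta> l) c = \<Theta> (k \<otimes> l) c"
          using \<Theta>_comp kl by (cases "c \<in> C") (simp_all add: compose_def, simp add: \<Theta>_def)
      qed
      then show "\<Theta> (k \<otimes> l) = \<Theta> k \<otimes>\<^bsub>?Aut\<^esub> \<Theta> l" using mult_Aut \<Theta>_bij kl by simp
    qed
    have inj: "inj_on \<Theta> (carrier H)"
    proof (rule inj_onI)
      fix k l assume kl: "k \<in> carrier H" "l \<in> carrier H" "\<Theta> k = \<Theta> l"
      let ?s = "unit_vec (Node [], \<one>) :: ('b, 'h) vec"
      have s: "?s \<in> G" by (rule unit_vec_G) auto
      have "\<beta> (translate (inv k) ?s) = \<beta> (translate (inv l) ?s)" using kl(3) s \<Theta>[of "\<beta> ?s"] by (metis \<kappa>\<beta> \<beta>C)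
      then have "translate (inv k) ?s = translate (inv l) ?s" using s kl translate_G by (metis \<kappa>\<beta> inv_closed)
      then have "unit_vec (Node [] :: 'b idx, inv k) = unit_vec (Node [], inv l)" using kl by (simp add: translate_unit_vec)
      then have "supp (unit_vec (Node [] :: 'b idx, inv k)) = supp (unit_vec (Node [], inv l))" by (rule arg_cong)
      then show "k = l" using kl inv_inj by (simp add: inj_on_def)
    qed
    have surj: "\<exists>k\<in>carrier H. f = \<Theta> k" if f: "f \<in> carrier ?Aut" for f
    proof -
      have hom: "f \<in> hom M M" and bij: "bij_betw f C C" and ext: "f \<in> extensional C"
        and mono: "\<And>x y. x \<in> C \<Longrightarrow> y \<in> C \<Longrightarrow> (x, y) \<in> r \<Longrightarrow> (f x, f y) \<in> r"
        using f by (auto simp: carrier_Aut auto_def Bij_def)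
      have fC: "f c \<in> C" if "c \<in> C" for c using bij that by (auto simp: bij_betw_def)
      define f' where "f' = inv_into C f"
      have f'f: "f' (f c) = c" and ff': "f (f' c) = c" if "c \<in> C" for c
        using bij that by (simp_all add: f'_def bij_betw_inv_into_left bij_betw_inv_into_right)
      have f'C: "f' c \<in> C" if "c \<in> C" for c using bij_betw_inv_into[OF bij] that by (auto simp: bij_betw_def f'_def)
      have fadd: "f (\<beta> (\<lambda>p. x p + y p)) = \<beta> (\<lambda>p. \<kappa> (f (\<beta> x)) p + \<kappa> (f (\<beta> y)) p)" if "x \<in> G" "y \<in> G" for x y
        using hom_mult[OF hom, of "\<beta> x" "\<beta> y"] that by simp
      define \<phi> where "\<phi> x = \<kappa> (f (\<beta> x))" for x
      define \<psi> where "\<psi> x = \<kappa> (f' (\<beta> x))" for x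
      have \<phi>: "additive_map G \<phi>"
        using fadd fC add by (simp add: additive_map_def \<phi>_def)
      have \<phi>\<psi>: "\<phi> (\<psi> x) = x" and \<psi>\<phi>: "\<psi> (\<phi> x) = x" and \<psi>G: "\<psi> x \<in> G" if "x \<in> G" for x
        using that fC f'C by (simp_all add: \<phi>_def \<psi>_def f'f ff')
      have \<psi>: "additive_map G \<psi>"
        unfolding additive_map_def
      proof (intro conjI ballI)
        fix x y assume xy: "x \<in> G" "y \<in> G"
        have "\<phi> (\<lambda>p. \<psi> x p + \<psi> y p) = (\<lambda>p. x p + y p)"
          using \<phi> \<psi>G \<phi>\<psi> xy by (simp add: additive_map_def)
        then show "\<psi> (\<lambda>p. x p + y p) = (\<lambda>p. \<psi> x p + \<psi> y p)"
          using \<psi>\<phi>[OF add[OF \<psi>G \<psi>G]] xy by metis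
      qed (rule \<psi>G)
      have zero\<phi>: "\<phi> (\<lambda>p. 0) = (\<lambda>p. 0)"
        using additive_map_lin[OF \<phi> zero zero, of 0 0] by simp
      have pos: "\<exists>p. \<phi> (unit_vec (Node t, h)) p > 0 \<and> (\<forall>q\<in>supp (\<phi> (unit_vec (Node t, h))). q = p \<or> (q, p) \<in> L)"
        if th: "t \<in> lists A" "h \<in> carrier H" for t h
      proof -
        have s: "unit_vec (Node t, h) \<in> G" by (rule unit_vec_G[OF th])
        \<comment> \<open>Order preservation enters here: unit vectors are positive, hence so are
          their images, which excludes the sign -1.\<close>
        have "lex_positive L (unit_vec (Node t, h))" unfolding lex_positive_def supp_unit_vec by (intro exI[of _ "(Node t, h)"]) (simp add: unit_vec_def)
        then have "(\<beta> (\<lambda>p. 0), \<beta> (unit_vec (Node t, h))) \<in> r" using s zero by (simp add: r_def lex_less_def)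
        then have "(f (\<beta> (\<lambda>p. 0)), f (\<beta> (unit_vec (Node t, h)))) \<in> r" using s zero by (intro mono) auto
        then have "lex_positive L (\<lambda>p. \<phi> (unit_vec (Node t, h)) p - \<phi> (\<lambda>p. 0) p)" by (simp add: r_def lex_less_def \<phi>_def)
        then show ?thesis unfolding zero\<phi> by (simp add: lex_positive_def)
      qed
      obtain k where k: "k \<in> carrier H" "\<And>x. x \<in> G \<Longrightarrow> \<phi> x = translate k x"
        using order_automorphism_translation[OF R A \<phi> \<psi> \<psi>\<phi> pos] by blast
      have "f = \<Theta> (inv k)"
      proof
        fix c
        show "f c = \<Theta> (inv k) c"
        proof (cases "c \<in> C")
          case True
          then have "f c = \<beta> (\<phi> (\<kappa> c))" using fC by (simp add: \<phi>_def)
          then show ?thesis using k True by (simp add: \<Theta>)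
        qed (use ext in \<open>simp add: \<Theta>_def extensional_def\<close>)
      qed
      then show ?thesis using k(1) by blast
    qed
    show "bij_betw \<Theta> (carrier H) (carrier ?Aut)"
      unfolding bij_betw_def
    proof (intro conjI equalityI subsetI)
      show "f \<in> carrier ?Aut" if "f \<in> \<Theta> ` carrier H" for f
        using that \<Theta>_auto \<Theta>_mono by (auto simp: carrier_Aut)
      show "f \<in> \<Theta> ` carrier H" if "f \<in> carrier ?Aut" for f
        using surj[OF that] by blast
    qed (rule inj)
  qed
  then have "?Aut \<cong> H" using iso_sym by (auto simp: is_iso_def)
  then show ?thesis using ord free M(1) by blast
qed

end

section \<open>Cardinalities\<close>

text \<open>A finitely supported vector is coded by a finite list of coordinates with their values;
  the bound on sequences controls the number of symbols.\<close>

lemma (in tree_vectors) card_of_V: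
  assumes inf: "infinite A" and seq: "|{\<zeta> :: nat \<Rightarrow> 'b. range \<zeta> \<subseteq> A}| \<le>o |A|" and H: "|carrier H| \<le>o |A|"
  shows "|V| \<le>o |A|"
proof -
  have nat: "|UNIV :: nat set| \<le>o |A|" using inf infinite_iff_card_of_nat by blast
  have lists: "|lists B| \<le>o |A|" if "|B| \<le>o |A|" for B :: "'c set"
    using card_of_lists_mono[OF that] card_of_lists_infinite[OF inf] by (rule ordLeq_ordIso_trans)
  have "|Node ` lists A| \<le>o |A|"
    using card_of_image lists[OF ordLeq_refl[OF card_of_Card_order]] by (rule ordLeq_transitive)
  moreover have "|{Symbol \<zeta> i | \<zeta> i. range \<zeta> \<subseteq> A}| \<le>o |A|"
  proof -
    have "{Symbol \<zeta> i | \<zeta> i. range \<zeta> \<subseteq> A} = (\<lambda>(\<zeta>, i). Symbol \<zeta> i) ` ({\<zeta>. range \<zeta> \<subseteq> A} \<times> UNIV)"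
      by auto
    then show ?thesis
      by (simp only:) (rule ordLeq_transitive[OF card_of_image card_of_Times_ordLeq_infinite[OF inf seq nat]])
  qed
  ultimately have "|Node ` lists A \<union> {Symbol \<zeta> i | \<zeta> i. range \<zeta> \<subseteq> A}| \<le>o |A|"
    by (rule card_of_Un_ordLeq_infinite[OF inf])
  then have "|idxs| \<le>o |A|" unfolding idxs_def by (rule card_of_Times_ordLeq_infinite[OF inf _ H])
  moreover have "|UNIV :: rat set| \<le>o |A|"
  proof -
    have "|UNIV :: rat set| \<le>o |UNIV :: nat set|"
      using card_of_ordLeq[of "UNIV :: rat set" "UNIV :: nat set"] countableE[OF countableI_type[of "UNIV :: rat set"]]
      by (metis subset_UNIV)
    then show ?thesis using nat by (rule ordLeq_transitive)
  qed
  ultimately have "|idxs \<times> (UNIV :: rat set)| \<le>o |A|" by (rule card_of_Times_ordLeq_infinite[OF inf])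
  then have L: "|lists (idxs \<times> (UNIV :: rat set))| \<le>o |A|" by (rule lists)
  have "V \<subseteq> (\<lambda>l p. case map_of l p of None \<Rightarrow> 0 | Some q \<Rightarrow> q) ` lists (idxs \<times> UNIV)"
  proof
    fix x assume x: "x \<in> V"
    then have "finite (supp x)" by (simp add: V_def)
    then obtain ps where ps: "set ps = supp x" using finite_list by blast
    define l where "l = map (\<lambda>p. (p, x p)) ps"
    have "l \<in> lists (idxs \<times> UNIV)" using x ps by (auto simp: l_def V_def)
    moreover have "x = (\<lambda>p. case map_of l p of None \<Rightarrow> 0 | Some q \<Rightarrow> q)"
      using ps by (auto simp: l_def map_of_map_restrict restrict_map_def supp_def)
    ultimately show "x \<in> (\<lambda>l p. case map_of l p of None \<Rightarrow> 0 | Some q \<Rightarrow> q) ` lists (idxs \<times> UNIV)" by blast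
  qed
  then have "|V| \<le>o |(\<lambda>l p. case map_of l p of None \<Rightarrow> 0 | Some q \<Rightarrow> q) ` lists (idxs \<times> (UNIV :: rat set))|"
    by (rule card_of_mono1)
  also have "|(\<lambda>l p. case map_of l p of None \<Rightarrow> 0 | Some q \<Rightarrow> q) ` lists (idxs \<times> (UNIV :: rat set))| \<le>o |lists (idxs \<times> (UNIV :: rat set))|"
    by (rule card_of_image)
  finally show ?thesis using L by (rule ordLeq_transitive)
qed

text \<open>The set \<open>A\<close> serves both as alphabet and as carrier of the result: its
  letters suffice to code triples from \<open>V\<close>, and the one-letter nodes show that the
  group is not smaller than \<open>A\<close>.\<close>

theorem (in group) ordered_automorphism_realization:
  fixes A :: "'c set"
  assumes R: "right_ordered_group G R"
    and inf: "infinite A" and seq: "|{\<zeta> :: nat \<Rightarrow> 'c. range \<zeta> \<subseteq> A}| \<le>o |A|" and H: "|carrier G| \<le>o |A|"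
  shows "\<exists>(M :: 'c monoid) r. carrier M = A \<and> ordered_abelian_group M r \<and> aleph1_free M \<and>
    ordered_AutoGroup M r \<cong> G"
proof -
  interpret tree_vectors G A by unfold_locales
  have V: "|V| \<le>o |A|" by (rule card_of_V[OF inf seq H])
  have le: "|V \<times> V \<times> V| \<le>o |A|"
    by (intro card_of_Times_ordLeq_infinite[OF inf] V)
  have "(\<lambda>p. 0) \<in> V" by (simp add: V_def supp_def)
  then have "V \<times> V \<times> V \<noteq> {}" by blast
  from iffD2[OF card_of_ordLeq2[OF this] le]
  obtain dec where dec: "dec ` A = V \<times> V \<times> V" by (elim exE)
  obtain K where "rigid_vectors G A K" using rigid_vectors_exist[OF equalityD2[OF dec]] by (elim exE)
  then interpret K: rigid_vectors G A K .
  have "|K| \<le>o |A|" using card_of_mono1[OF K.G_V] V by (rule ordLeq_transitive)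
  moreover have "|A| \<le>o |K|"
  proof (rule card_of_ordLeqI[of "\<lambda>a. unit_vec (Node [a], \<one>)"])
    show "inj_on (\<lambda>a. unit_vec (Node [a] :: 'c idx, \<one>)) A"
    proof (rule inj_onI)
      fix a b :: 'c assume "unit_vec (Node [a] :: 'c idx, \<one>) = unit_vec (Node [b], \<one>)"
      then have "supp (unit_vec (Node [a] :: 'c idx, \<one>)) = supp (unit_vec (Node [b], \<one>))" by (rule arg_cong)
      then show "a = b" by simp
    qed
  qed (use K.unit_vec_G in auto)
  ultimately have "|K| =o |A|" by (simp add: ordIso_iff_ordLeq)
  then obtain \<beta> where "bij_betw \<beta> K A" using card_of_ordIso by blast
  moreover have "A \<noteq> {}" using inf by auto
  ultimately show ?thesis using K.realization[OF R] by blast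
qed

section \<open>The one-element case and the conclusion\<close>

lemma iso_singleton_groups:
  assumes "group G" "group H" "carrier G = {a}" "carrier H = {b}"
  shows "G \<cong> H"
proof -
  interpret G: group G by (rule assms)
  interpret H: group H by (rule assms)
  have "(\<lambda>_. b) \<in> iso G H"
  proof (rule isoI)
    show "(\<lambda>_. b) \<in> hom G H" using H.m_closed[of b b] assms(4) by (intro homI) auto
  qed (simp add: assms bij_betw_def)
  then show ?thesis by (auto simp: is_iso_def)
qed

text \<open>Covers the cardinal 1, whose power is again 1, so that no infinite alphabet is available
  and the carrier must be a singleton.\<close>

lemma trivial_realization:
  fixes a :: 'b
  assumes H: "group H" "carrier H = {e}"
  shows "\<exists>(M :: 'b monoid) r. carrier M = {a} \<and> ordered_abelian_group M r \<and> aleph1_free M \<and>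
    ordered_AutoGroup M r \<cong> H"
proof -
  define M :: "'b monoid" where "M = \<lparr>carrier = {a}, monoid.mult = (\<lambda>_ _. a), one = a\<rparr>"
  have M: "carrier M = {a}" by (simp add: M_def)
  have comm: "comm_group M" by (rule comm_groupI) (auto simp: M_def)
  interpret M: comm_group M by (rule comm)
  have "ordered_abelian_group M {}"
    using comm by (simp add: ordered_abelian_group_def strict_linear_order_on_def M irrefl_def)
  moreover have "aleph1_free M"
    unfolding aleph1_free_def
  proof (intro conjI allI impI)
    fix B assume "subgroup B M \<and> countable B"
    then have B: "subgroup B M" by simp
    then have "carrier (M\<lparr>carrier := B\<rparr>) = {a}"
      using subgroup.subset[OF B] subgroup.one_closed[OF B] by (auto simp: M_def)
    moreover have "carrier (free_Abelian_group ({} :: 'b set)) = {0}" by auto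
    ultimately show "free_abelian (M\<lparr>carrier := B\<rparr>)"
      unfolding free_abelian_def
      using iso_singleton_groups[OF M.subgroup_imp_group[OF B] group_free_Abelian_group] by blast
  qed (rule comm)
  moreover have "ordered_AutoGroup M {} \<cong> H"
  proof (rule iso_singleton_groups[OF _ H(1) _ H(2)])
    have eq: "ordered_AutoGroup M {} = AutoGroup M" by (simp add: ordered_AutoGroup_def AutoGroup_def)
    show "group (ordered_AutoGroup M {})" unfolding eq by (rule M.AutoGroup)
    have "f = (\<lambda>x\<in>{a}. x)" if "f \<in> auto M" for f
      using that by (intro ext) (auto simp: auto_def Bij_def M bij_betw_def extensional_def)
    moreover have "(\<lambda>x\<in>{a}. x) \<in> auto M" using M.id_in_auto by (simp add: M)
    ultimately have "auto M = {\<lambda>x\<in>{a}. x}" by blast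
    then show "carrier (ordered_AutoGroup M {}) = {\<lambda>x\<in>{a}. x}"
      unfolding eq by (simp add: AutoGroup_def)
  qed
  ultimately show ?thesis using M by blast
qed

theorem corollary5:
  fixes H :: "('a, 'm) monoid_scheme" and lam :: "'l rel"
  assumes "right_orderable_group H"
    and "Card_order lam"
    and "|carrier H| \<le>o lam"
  shows "\<exists>(G :: (nat \<Rightarrow> 'l) monoid) r.
           ordered_abelian_group G r \<and> aleph1_free G \<and>
           |carrier G| =o lam ^c natLeq \<and>
           ordered_AutoGroup G r \<cong> H"
proof -
  obtain R where R: "right_ordered_group H R" using assms(1) by (auto simp: right_orderable_group_def)
  then interpret H: group H by (simp add: right_ordered_group_def)
  define F where "F = Field lam"
  define A :: "(nat \<Rightarrow> 'l) set" where "A = {f. range f \<subseteq> F}"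
  have F: "|F| =o lam" unfolding F_def using assms(2) by (rule card_of_Field_ordIso)
  have HF: "|carrier H| \<le>o |F|" using assms(3) ordIso_symmetric[OF F] by (rule ordLeq_ordIso_trans)
  have "Func UNIV F = A" by (auto simp: Func_def A_def)
  then have card: "|A| =o lam ^c natLeq"
    by (simp add: cexp_def Field_natLeq F_def card_of_refl)
  have "F \<noteq> {}" using card_of_ordLeq[of "carrier H" F] HF by auto
  then obtain x where x: "x \<in> F" by blast
  have "\<exists>(M :: (nat \<Rightarrow> 'l) monoid) r. carrier M = A \<and> ordered_abelian_group M r \<and> aleph1_free M \<and>
    ordered_AutoGroup M r \<cong> H"
  \<comment> \<open>With at least two values the set \<open>A\<close> of sequences is infinite, and
    pairing of indices turns a sequence in \<open>A\<close> into one element of \<open>A\<close>, as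
    the alphabet requires.\<close>
  proof (cases "F = {x}")
    case True
    obtain h where h: "inj_on h (carrier H)" "h ` carrier H \<subseteq> {x}"
      using card_of_ordLeq[of "carrier H" F] HF True by auto
    have "g = \<one>\<^bsub>H\<^esub>" if "g \<in> carrier H" for g
      using h that H.one_closed by (metis image_subset_iff inj_onD singletonD)
    then have "carrier H = {\<one>\<^bsub>H\<^esub>}" using H.one_closed by blast
    moreover have "A = {\<lambda>_. x}" by (auto simp: A_def True)
    ultimately show ?thesis using trivial_realization[OF H.is_group] by metis
  next
    case False
    then obtain y where y: "y \<in> F" "y \<noteq> x" using x by blast
    have "inj (\<lambda>n k. if k = n then y else x)"
      using y by (intro injI) (metis (mono_tags))
    moreover have "range (\<lambda>n k. if k = n then y else x) \<subseteq> A" using x y by (auto simp: A_def)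
    ultimately have inf: "infinite A" using infinite_iff_countable_subset by blast
    have seq: "|{\<zeta> :: nat \<Rightarrow> nat \<Rightarrow> 'l. range \<zeta> \<subseteq> A}| \<le>o |A|"
    proof (rule card_of_ordLeqI)
      show "inj_on (\<lambda>\<zeta> n. \<zeta> (fst (prod_decode n)) (snd (prod_decode n))) {\<zeta> :: nat \<Rightarrow> nat \<Rightarrow> 'l. range \<zeta> \<subseteq> A}"
      proof (rule inj_onI, intro ext)
        fix \<zeta> \<zeta>' :: "nat \<Rightarrow> nat \<Rightarrow> 'l" and m n
        assume "(\<lambda>n. \<zeta> (fst (prod_decode n)) (snd (prod_decode n))) = (\<lambda>n. \<zeta>' (fst (prod_decode n)) (snd (prod_decode n)))"
        from fun_cong[OF this, of "prod_encode (m, n)"] show "\<zeta> m n = \<zeta>' m n" by simp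
      qed
    qed (auto simp: A_def image_subset_iff)
    have "|F| \<le>o |A|"
      by (rule card_of_ordLeqI[of "\<lambda>a _. a"]) (auto simp: inj_on_def A_def fun_eq_iff)
    with HF have "|carrier H| \<le>o |A|" by (rule ordLeq_transitive)
    then show ?thesis using H.ordered_automorphism_realization[OF R inf seq] by blast
  qed
  then show ?thesis using card by metis
qed

end
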